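(* Let $(R,\mathfrak m)$ be a Cohen-Macaulay local ring of dimension $d$ with infinite residue field, let $I_1$ and $I_2$ be $\mathfrak m$-primary ideals, and let $k$ be an integer with $0\le k\le d$. Let $x_{11},\dots,x_{1k}\in I_1$ and $x_{21},\dots,x_{2,d-k}\in I_2$, and assume that $x_{11},\dots,x_{1k},x_{21},\dots,x_{2,d-k}$ is a Rees-superficial sequence for $I_1$ and $I_2$. Then $$\Delta^{k,d-k}\bigl[P_{\mathcal F}(n_1,n_2)-H_{\mathcal F}(n_1,n_2)\bigr]=\ell\!\left(\frac{I_1^{n_1}I_2^{n_2}}{(\mathbf x_{1k})I_1^{n_1-1}I_2^{n_2}+(\mathbf x_{2,d-k})I_1^{n_1}I_2^{n_2-1}}\right)-\sum_{i\ge 2}(-1)^i h_i(\mathbf x_{1k},\mathbf x_{2,d-k})(n_1,n_2).$$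
   Context: Conventions: $I^n=R$ for $n\le 0$; $\mathcal F=\{I_1^{n_1}I_2^{n_2}\}$; $\ell$ denotes length. $H_{\mathcal F}(n_1,n_2)=\ell(R/I_1^{n_1}I_2^{n_2})$, and $P_{\mathcal F}$ is the polynomial (of total degree $d$) with $P_{\mathcal F}(n_1,n_2)=H_{\mathcal F}(n_1,n_2)$ for all $n_1,n_2\gg 0$. $(\mathbf x_{1k})$ and $(\mathbf x_{2,d-k})$ are the ideals generated by $x_{11},\dots,x_{1k}$ and by $x_{21},\dots,x_{2,d-k}$. For $f:\mathbb Z^2\to\mathbb Z$ and $k_1,k_2\ge0$, $$\Delta^{k_1,k_2}f(n_1,n_2)=\sum_{i=0}^{k_1+k_2}(-1)^i\sum_{j=0}^{i}\binom{k_1}{i-j}\binom{k_2}{j}f(n_1-(i-j),n_2-j).$$ For elements $x_{11},\dots,x_{1k_1}\in I_1$, $x_{21},\dots,x_{2k_2}\in I_2$, the complex $C(\mathbf x_{1k_1},\mathbf x_{2k_2},\mathcal F,(n_1,n_2))$ has in homological degree $i$ the term $$\bigoplus_{j=0}^{i}\left(\frac{R}{I_1^{n_1-i+j}I_2^{n_2-j}}\right)^{\binom{k_1}{i-j}\binom{k_2}{j}},$$ the summands being indexed by pairs $(A,B)$ with $A\subseteq\{1,\dots,k_1\}$, $B\subseteq\{1,\dots,k_2\}$, $|A|=i-j$, $|B|=j$. The differential is the one induced by the Koszul complex of $R$ on $x_{11},\dots,x_{1k_1},x_{21},\dots,x_{2k_2}$. Thus it is the quotient of that Koszul complex by the subcomplex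 having $I_1^{n_1-|A|}I_2^{n_2-|B|}$ in the $(A,B)$ component. One sets $h_i(\mathbf x_{1k_1},\mathbf x_{2k_2})(n_1,n_2)=\ell\bigl(H_i(C(\mathbf x_{1k_1},\mathbf x_{2k_2},\mathcal F,(n_1,n_2)))\bigr)$; here $k_1=k$ and $k_2=d-k$. Superficial sequences: an element $x\in I_1$ is superficial for $I_1$ and $I_2$ if $(x)\cap I_1^{n_1}I_2^{n_2}=xI_1^{n_1-1}I_2^{n_2}$ for all $n_1\gg 0$ and all $n_2\ge 0$; symmetrically, $x\in I_2$ is superficial for $I_1$ and $I_2$ if $(x)\cap I_1^{n_1}I_2^{n_2}=xI_1^{n_1}I_2^{n_2-1}$ for all $n_2\gg 0$ and all $n_1\ge 0$. A sequence $y_1,\dots,y_{k_1+k_2}$ with $y_1,\dots,y_{k_1}\in I_1$ and $y_{k_1+1},\dots,y_{k_1+k_2}\in I_2$ is a (Rees-)superficial sequence for $I_1$ and $I_2$ if for each $i$ the image of $y_i$ in $R/(y_1,\dots,y_{i-1})$ is superficial for the images of $I_1$ and $I_2$.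
   Formalization: The formal theorem additionally assumes that the length of I_1^{n_1}I_2^{n_2}/((x_1k)I_1^{n_1-1}I_2^{n_2}+(x_2,d-k)I_1^{n_1}I_2^{n_2-1}) is finite; without this the claim fails, e.g. for d=k=1, x_11=0, which the stated definition of superficial allows. *)

theory Defs
  imports
    "HOL-Computational_Algebra.Polynomial"
    "HOL-Library.Extended_Nat"
    "HOL-Library.FuncSet"
    "HOL-Algebra.Ideal_Product"
    "HOL-Algebra.Ring_Divisibility"
    "HOL-Algebra.Module"
begin

section \<open>Modules, quotients and length\<close>

text \<open>The record type of modules extends that of rings; the fields \<open>mult\<close> and \<open>one\<close>
  of a module play no role and are left unspecified below.\<close>

definition ring_module :: "('a, 'b) ring_scheme \<Rightarrow> ('a, 'a) module" where
  "ring_module R =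
    \<lparr>carrier = carrier R, mult = undefined, one = undefined,
     zero = \<zero>\<^bsub>R\<^esub>, add = add R, smult = mult R\<rparr>"

definition quot_module :: "('a, 'c) module \<Rightarrow> 'c set \<Rightarrow> ('a, 'c set) module" where
  "quot_module M N =
    \<lparr>carrier = a_rcosets\<^bsub>M\<^esub> N, mult = undefined, one = undefined,
     zero = N, add = set_add M,
     smult = (\<lambda>r C. \<Union>c\<in>C. N +>\<^bsub>M\<^esub> (r \<odot>\<^bsub>M\<^esub> c))\<rparr>"

definition direct_sum_module :: "'i set \<Rightarrow> ('i \<Rightarrow> ('a, 'c) module) \<Rightarrow> ('a, 'i \<Rightarrow> 'c) module" where
  "direct_sum_module S M =
    \<lparr>carrier = (\<Pi>\<^sub>E p\<in>S. carrier (M p)), mult = undefined, one = undefined,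
     zero = (\<lambda>p\<in>S. \<zero>\<^bsub>M p\<^esub>),
     add = (\<lambda>f g. \<lambda>p\<in>S. f p \<oplus>\<^bsub>M p\<^esub> g p),
     smult = (\<lambda>r f. \<lambda>p\<in>S. r \<odot>\<^bsub>M p\<^esub> f p)\<rparr>"

definition module_length :: "('a, 'b) ring_scheme \<Rightarrow> ('a, 'c) module \<Rightarrow> enat" where
  "module_length R M =
    Sup {enat n | n. \<exists>N :: nat \<Rightarrow> 'c set.
      (\<forall>i\<le>n. submodule (N i) R M) \<and> (\<forall>i<n. N i \<subset> N (Suc i))}"

text \<open>The length as a natural number; meaningful only for modules of finite length.\<close>

definition len :: "('a, 'b) ring_scheme \<Rightarrow> ('a, 'c) module \<Rightarrow> nat" where
  "len R M = the_enat (module_length R M)"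

section \<open>Cohen-Macaulay local rings\<close>

definition local_ring :: "('a, 'b) ring_scheme \<Rightarrow> 'a set \<Rightarrow> bool" where
  "local_ring R m \<longleftrightarrow>
    cring R \<and> noetherian_ring R \<and> maximalideal m R \<and> (\<forall>n. maximalideal n R \<longrightarrow> n = m)"

definition krull_dim :: "('a, 'b) ring_scheme \<Rightarrow> enat" where
  "krull_dim R =
    Sup {enat n | n. \<exists>p :: nat \<Rightarrow> 'a set.
      (\<forall>i\<le>n. primeideal (p i) R) \<and> (\<forall>i<n. p i \<subset> p (Suc i))}"

definition nonzerodivisor :: "('a, 'b) ring_scheme \<Rightarrow> 'a \<Rightarrow> bool" where
  "nonzerodivisor R x \<longleftrightarrow>
    x \<in> carrier R \<and> (\<forall>y\<in>carrier R. x \<otimes>\<^bsub>R\<^esub> y = \<zero>\<^bsub>R\<^esub> \<longrightarrow> y = \<zero>\<^bsub>R\<^esub>)"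

definition regular_sequence :: "('a, 'b) ring_scheme \<Rightarrow> 'a list \<Rightarrow> bool" where
  "regular_sequence R ys \<longleftrightarrow>
    set ys \<subseteq> carrier R \<and> Idl\<^bsub>R\<^esub> (set ys) \<noteq> carrier R \<and>
    (\<forall>i<length ys.
      let J = Idl\<^bsub>R\<^esub> (set (take i ys)) in nonzerodivisor (R Quot J) (J +>\<^bsub>R\<^esub> (ys ! i)))"

definition depth :: "('a, 'b) ring_scheme \<Rightarrow> 'a set \<Rightarrow> enat" where
  "depth R m = Sup {enat (length ys) | ys. set ys \<subseteq> m \<and> regular_sequence R ys}"

definition cohen_macaulay_local_ring :: "('a, 'b) ring_scheme \<Rightarrow> 'a set \<Rightarrow> bool" where
  "cohen_macaulay_local_ring R m \<longleftrightarrow> local_ring R m \<and> depth R m = krull_dim R"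

definition radical :: "('a, 'b) ring_scheme \<Rightarrow> 'a set \<Rightarrow> 'a set" where
  "radical R I = {x \<in> carrier R. \<exists>n::nat. x [^]\<^bsub>R\<^esub> n \<in> I}"

definition primary_ideal :: "('a, 'b) ring_scheme \<Rightarrow> 'a set \<Rightarrow> bool" where
  "primary_ideal R Q \<longleftrightarrow>
    ideal Q R \<and> Q \<noteq> carrier R \<and>
    (\<forall>a\<in>carrier R. \<forall>b\<in>carrier R.
      a \<otimes>\<^bsub>R\<^esub> b \<in> Q \<longrightarrow> a \<in> Q \<or> (\<exists>n::nat. b [^]\<^bsub>R\<^esub> n \<in> Q))"

definition primary_to :: "('a, 'b) ring_scheme \<Rightarrow> 'a set \<Rightarrow> 'a set \<Rightarrow> bool" where
  "primary_to R p Q \<longleftrightarrow> primary_ideal R Q \<and> radical R Q = p"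

section \<open>The bigraded filtration and superficial sequences\<close>

definition ideal_pow :: "('a, 'b) ring_scheme \<Rightarrow> 'a set \<Rightarrow> int \<Rightarrow> 'a set" where
  "ideal_pow R I n = (if n \<le> 0 then carrier R else I [^]\<^bsub>ideals_set R\<^esub> nat n)"

definition filt :: "('a, 'b) ring_scheme \<Rightarrow> 'a set \<Rightarrow> 'a set \<Rightarrow> int \<Rightarrow> int \<Rightarrow> 'a set" where
  "filt R I\<^sub>1 I\<^sub>2 n\<^sub>1 n\<^sub>2 = ideal_pow R I\<^sub>1 n\<^sub>1 \<cdot>\<^bsub>R\<^esub> ideal_pow R I\<^sub>2 n\<^sub>2"

definition superficial_fst :: "('a, 'b) ring_scheme \<Rightarrow> 'a set \<Rightarrow> 'a set \<Rightarrow> 'a \<Rightarrow> bool" where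
  "superficial_fst R I\<^sub>1 I\<^sub>2 x \<longleftrightarrow>
    x \<in> I\<^sub>1 \<and>
    (\<forall>\<^sub>F n\<^sub>1 in at_top. \<forall>n\<^sub>2\<ge>0.
      PIdl\<^bsub>R\<^esub> x \<inter> filt R I\<^sub>1 I\<^sub>2 n\<^sub>1 n\<^sub>2 = x <#\<^bsub>R\<^esub> filt R I\<^sub>1 I\<^sub>2 (n\<^sub>1 - 1) n\<^sub>2)"

definition superficial_snd :: "('a, 'b) ring_scheme \<Rightarrow> 'a set \<Rightarrow> 'a set \<Rightarrow> 'a \<Rightarrow> bool" where
  "superficial_snd R I\<^sub>1 I\<^sub>2 x \<longleftrightarrow>
    x \<in> I\<^sub>2 \<and>
    (\<forall>\<^sub>F n\<^sub>2 in at_top. \<forall>n\<^sub>1\<ge>0.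
      PIdl\<^bsub>R\<^esub> x \<inter> filt R I\<^sub>1 I\<^sub>2 n\<^sub>1 n\<^sub>2 = x <#\<^bsub>R\<^esub> filt R I\<^sub>1 I\<^sub>2 n\<^sub>1 (n\<^sub>2 - 1))"

definition rees_superficial_sequence ::
    "('a, 'b) ring_scheme \<Rightarrow> 'a set \<Rightarrow> 'a set \<Rightarrow> 'a list \<Rightarrow> 'a list \<Rightarrow> bool" where
  "rees_superficial_sequence R I\<^sub>1 I\<^sub>2 xs\<^sub>1 xs\<^sub>2 \<longleftrightarrow>
    set xs\<^sub>1 \<subseteq> I\<^sub>1 \<and> set xs\<^sub>2 \<subseteq> I\<^sub>2 \<and>
    (\<forall>i < length (xs\<^sub>1 @ xs\<^sub>2).
      let J = Idl\<^bsub>R\<^esub> (set (take i (xs\<^sub>1 @ xs\<^sub>2)));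
          \<pi> = (\<lambda>r. J +>\<^bsub>R\<^esub> r);
          y = \<pi> ((xs\<^sub>1 @ xs\<^sub>2) ! i)
      in if i < length xs\<^sub>1
         then superficial_fst (R Quot J) (\<pi> ` I\<^sub>1) (\<pi> ` I\<^sub>2) y
         else superficial_snd (R Quot J) (\<pi> ` I\<^sub>1) (\<pi> ` I\<^sub>2) y)"

section \<open>Hilbert function, Hilbert polynomial and differences\<close>

definition hilbert_fun ::
    "('a, 'b) ring_scheme \<Rightarrow> 'a set \<Rightarrow> 'a set \<Rightarrow> int \<Rightarrow> int \<Rightarrow> int" where
  "hilbert_fun R I\<^sub>1 I\<^sub>2 n\<^sub>1 n\<^sub>2 = int (len R (quot_module (ring_module R) (filt R I\<^sub>1 I\<^sub>2 n\<^sub>1 n\<^sub>2)))"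

text \<open>A polynomial in two variables is a polynomial in the first variable whose
  coefficients are polynomials in the second one.\<close>

definition poly2 :: "rat poly poly \<Rightarrow> int \<Rightarrow> int \<Rightarrow> rat" where
  "poly2 P n\<^sub>1 n\<^sub>2 = poly (poly P [:of_int n\<^sub>1:]) (of_int n\<^sub>2)"

definition has_total_degree :: "rat poly poly \<Rightarrow> nat \<Rightarrow> bool" where
  "has_total_degree P d \<longleftrightarrow>
    (\<forall>i j. Polynomial.coeff (Polynomial.coeff P i) j \<noteq> 0 \<longrightarrow> i + j \<le> d) \<and>
    (\<exists>i j. Polynomial.coeff (Polynomial.coeff P i) j \<noteq> 0 \<and> i + j = d)"

definition is_hilbert_poly ::
    "('a, 'b) ring_scheme \<Rightarrow> 'a set \<Rightarrow> 'a set \<Rightarrow> nat \<Rightarrow> rat poly poly \<Rightarrow> bool" where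
  "is_hilbert_poly R I\<^sub>1 I\<^sub>2 d P \<longleftrightarrow>
    has_total_degree P d \<and>
    (\<exists>N. \<forall>n\<^sub>1\<ge>N. \<forall>n\<^sub>2\<ge>N. poly2 P n\<^sub>1 n\<^sub>2 = of_int (hilbert_fun R I\<^sub>1 I\<^sub>2 n\<^sub>1 n\<^sub>2))"

definition diff2 ::
    "nat \<Rightarrow> nat \<Rightarrow> (int \<Rightarrow> int \<Rightarrow> 'c::comm_ring_1) \<Rightarrow> int \<Rightarrow> int \<Rightarrow> 'c" where
  "diff2 k\<^sub>1 k\<^sub>2 f n\<^sub>1 n\<^sub>2 =
    (\<Sum>i=0..k\<^sub>1 + k\<^sub>2. (- 1) ^ i *
      (\<Sum>j=0..i. of_nat (k\<^sub>1 choose (i - j)) * of_nat (k\<^sub>2 choose j) *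
        f (n\<^sub>1 - int (i - j)) (n\<^sub>2 - int j)))"

section \<open>The quotient of the Koszul complex\<close>

text \<open>In homological degree \<open>i\<close> the Koszul complex of \<open>ys\<close> has the basis \<open>e S\<close>, where \<open>S\<close>
  ranges over the subsets of \<open>{..<length ys}\<close> of cardinality \<open>i\<close>; a chain is the family of
  its coefficients.  The differential maps \<open>e S\<close> to the sum over \<open>s\<close> in \<open>S\<close> of
  \<open>(-1) ^ card {t \<in> S. t < s}\<close> times \<open>ys ! s\<close> times \<open>e (S - {s})\<close>.\<close>

definition subsets_of_card :: "nat \<Rightarrow> nat \<Rightarrow> nat set set" where
  "subsets_of_card n i = {S. S \<subseteq> {..<n} \<and> card S = i}"

definition koszul_diff ::
    "('a, 'b) ring_scheme \<Rightarrow> 'a list \<Rightarrow> (nat set \<Rightarrow> 'a) \<Rightarrow> nat set \<Rightarrow> 'a" where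
  "koszul_diff R ys w T =
    (\<Oplus>\<^bsub>R\<^esub>s\<in>{..<length ys} - T.
      ((\<ominus>\<^bsub>R\<^esub> \<one>\<^bsub>R\<^esub>) [^]\<^bsub>R\<^esub> card {t \<in> T. t < s}) \<otimes>\<^bsub>R\<^esub> ((ys ! s) \<otimes>\<^bsub>R\<^esub> w (insert s T)))"

text \<open>For \<open>ys = xs\<^sub>1 @ xs\<^sub>2\<close> and \<open>k\<^sub>1 = length xs\<^sub>1\<close>, a set \<open>S\<close> of indices encodes the pair
  \<open>(A, B)\<close> with \<open>A = S \<inter> {..<k\<^sub>1}\<close> and \<open>B\<close> the translate of \<open>S - {..<k\<^sub>1}\<close> by \<open>- k\<^sub>1\<close>.\<close>

definition comp_ideal ::
    "('a, 'b) ring_scheme \<Rightarrow> 'a set \<Rightarrow> 'a set \<Rightarrow> nat \<Rightarrow> int \<Rightarrow> int \<Rightarrow> nat set \<Rightarrow> 'a set" where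
  "comp_ideal R I\<^sub>1 I\<^sub>2 k\<^sub>1 n\<^sub>1 n\<^sub>2 S =
    filt R I\<^sub>1 I\<^sub>2 (n\<^sub>1 - int (card (S \<inter> {..<k\<^sub>1}))) (n\<^sub>2 - int (card (S - {..<k\<^sub>1})))"

definition C_term ::
    "('a, 'b) ring_scheme \<Rightarrow> 'a set \<Rightarrow> 'a set \<Rightarrow> 'a list \<Rightarrow> 'a list \<Rightarrow> int \<Rightarrow> int \<Rightarrow> nat \<Rightarrow>
      ('a, nat set \<Rightarrow> 'a set) module" where
  "C_term R I\<^sub>1 I\<^sub>2 xs\<^sub>1 xs\<^sub>2 n\<^sub>1 n\<^sub>2 i =
    direct_sum_module (subsets_of_card (length xs\<^sub>1 + length xs\<^sub>2) i)
      (\<lambda>S. quot_module (ring_module R) (comp_ideal R I\<^sub>1 I\<^sub>2 (length xs\<^sub>1) n\<^sub>1 n\<^sub>2 S))"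

text \<open>The induced differential from degree \<open>i\<close> to degree \<open>i - 1\<close>, for \<open>i > 0\<close>.  An element \<open>z\<close>
  of degree \<open>i\<close> is a family of cosets, so the \<open>w\<close> below are exactly the Koszul chains lifting
  \<open>z\<close>; the cosets in the union coincide for all of them.\<close>

definition C_diff ::
    "('a, 'b) ring_scheme \<Rightarrow> 'a set \<Rightarrow> 'a set \<Rightarrow> 'a list \<Rightarrow> 'a list \<Rightarrow> int \<Rightarrow> int \<Rightarrow> nat \<Rightarrow>
      (nat set \<Rightarrow> 'a set) \<Rightarrow> (nat set \<Rightarrow> 'a set)" where
  "C_diff R I\<^sub>1 I\<^sub>2 xs\<^sub>1 xs\<^sub>2 n\<^sub>1 n\<^sub>2 i z =
    (\<lambda>T\<in>subsets_of_card (length xs\<^sub>1 + length xs\<^sub>2) (i - 1).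
      \<Union>w\<in>(\<Pi>\<^sub>E S\<in>subsets_of_card (length xs\<^sub>1 + length xs\<^sub>2) i. z S).
        comp_ideal R I\<^sub>1 I\<^sub>2 (length xs\<^sub>1) n\<^sub>1 n\<^sub>2 T +>\<^bsub>R\<^esub> koszul_diff R (xs\<^sub>1 @ xs\<^sub>2) w T)"

definition C_cycles ::
    "('a, 'b) ring_scheme \<Rightarrow> 'a set \<Rightarrow> 'a set \<Rightarrow> 'a list \<Rightarrow> 'a list \<Rightarrow> int \<Rightarrow> int \<Rightarrow> nat \<Rightarrow>
      (nat set \<Rightarrow> 'a set) set" where
  "C_cycles R I\<^sub>1 I\<^sub>2 xs\<^sub>1 xs\<^sub>2 n\<^sub>1 n\<^sub>2 i =
    {z \<in> carrier (C_term R I\<^sub>1 I\<^sub>2 xs\<^sub>1 xs\<^sub>2 n\<^sub>1 n\<^sub>2 i).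
      i = 0 \<or> C_diff R I\<^sub>1 I\<^sub>2 xs\<^sub>1 xs\<^sub>2 n\<^sub>1 n\<^sub>2 i z = \<zero>\<^bsub>C_term R I\<^sub>1 I\<^sub>2 xs\<^sub>1 xs\<^sub>2 n\<^sub>1 n\<^sub>2 (i - 1)\<^esub>}"

definition C_boundaries ::
    "('a, 'b) ring_scheme \<Rightarrow> 'a set \<Rightarrow> 'a set \<Rightarrow> 'a list \<Rightarrow> 'a list \<Rightarrow> int \<Rightarrow> int \<Rightarrow> nat \<Rightarrow>
      (nat set \<Rightarrow> 'a set) set" where
  "C_boundaries R I\<^sub>1 I\<^sub>2 xs\<^sub>1 xs\<^sub>2 n\<^sub>1 n\<^sub>2 i =
    C_diff R I\<^sub>1 I\<^sub>2 xs\<^sub>1 xs\<^sub>2 n\<^sub>1 n\<^sub>2 (Suc i) ` carrier (C_term R I\<^sub>1 I\<^sub>2 xs\<^sub>1 xs\<^sub>2 n\<^sub>1 n\<^sub>2 (Suc i))"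

definition C_homology ::
    "('a, 'b) ring_scheme \<Rightarrow> 'a set \<Rightarrow> 'a set \<Rightarrow> 'a list \<Rightarrow> 'a list \<Rightarrow> int \<Rightarrow> int \<Rightarrow> nat \<Rightarrow>
      ('a, (nat set \<Rightarrow> 'a set) set) module" where
  "C_homology R I\<^sub>1 I\<^sub>2 xs\<^sub>1 xs\<^sub>2 n\<^sub>1 n\<^sub>2 i =
    quot_module
      ((C_term R I\<^sub>1 I\<^sub>2 xs\<^sub>1 xs\<^sub>2 n\<^sub>1 n\<^sub>2 i)\<lparr>carrier := C_cycles R I\<^sub>1 I\<^sub>2 xs\<^sub>1 xs\<^sub>2 n\<^sub>1 n\<^sub>2 i\<rparr>)
      (C_boundaries R I\<^sub>1 I\<^sub>2 xs\<^sub>1 xs\<^sub>2 n\<^sub>1 n\<^sub>2 i)"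

definition h_len ::
    "('a, 'b) ring_scheme \<Rightarrow> 'a set \<Rightarrow> 'a set \<Rightarrow> 'a list \<Rightarrow> 'a list \<Rightarrow> int \<Rightarrow> int \<Rightarrow> nat \<Rightarrow> nat" where
  "h_len R I\<^sub>1 I\<^sub>2 xs\<^sub>1 xs\<^sub>2 n\<^sub>1 n\<^sub>2 i = len R (C_homology R I\<^sub>1 I\<^sub>2 xs\<^sub>1 xs\<^sub>2 n\<^sub>1 n\<^sub>2 i)"

text \<open>The quotient of \<open>I\<^sub>1\<^bsup>n\<^sub>1\<^esup> I\<^sub>2\<^bsup>n\<^sub>2\<^esup>\<close> by
  \<open>(xs\<^sub>1) I\<^sub>1\<^bsup>n\<^sub>1 - 1\<^esup> I\<^sub>2\<^bsup>n\<^sub>2\<^esup> + (xs\<^sub>2) I\<^sub>1\<^bsup>n\<^sub>1\<^esup> I\<^sub>2\<^bsup>n\<^sub>2 - 1\<^esup>\<close>.\<close>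

definition reduction_quot ::
    "('a, 'b) ring_scheme \<Rightarrow> 'a set \<Rightarrow> 'a set \<Rightarrow> 'a list \<Rightarrow> 'a list \<Rightarrow> int \<Rightarrow> int \<Rightarrow>
      ('a, 'a set) module" where
  "reduction_quot R I\<^sub>1 I\<^sub>2 xs\<^sub>1 xs\<^sub>2 n\<^sub>1 n\<^sub>2 =
    quot_module ((ring_module R)\<lparr>carrier := filt R I\<^sub>1 I\<^sub>2 n\<^sub>1 n\<^sub>2\<rparr>)
      ((Idl\<^bsub>R\<^esub> (set xs\<^sub>1) \<cdot>\<^bsub>R\<^esub> filt R I\<^sub>1 I\<^sub>2 (n\<^sub>1 - 1) n\<^sub>2) <+>\<^bsub>R\<^esub>
       (Idl\<^bsub>R\<^esub> (set xs\<^sub>2) \<cdot>\<^bsub>R\<^esub> filt R I\<^sub>1 I\<^sub>2 n\<^sub>1 (n\<^sub>2 - 1)))"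

end

theory Submission
  imports Defs
begin

text \<open>
  Let \<open>F = I\<^sub>1\<^bsup>n\<^sub>1\<^esup> I\<^sub>2\<^bsup>n\<^sub>2\<^esup>\<close> and let \<open>(x)\<close> be the ideal generated by the whole sequence. The alternating sum
  of the lengths of the terms of the complex is \<open>\<Delta>H(n\<^sub>1, n\<^sub>2)\<close>, so \<open>\<Delta>H = \<Sum>(-1)\<^sup>i h\<^sub>i\<close>. One
  has \<open>h\<^sub>0 = \<ell>(R / (F + (x)))\<close> and, because the first Koszul homology of \<open>x\<close> vanishes,
  \<open>h\<^sub>1 = \<ell>(((x) \<inter> F) / G)\<close>, where \<open>F / G\<close> is the quotient in the statement; hence
  \<open>\<ell>(F / G) = h\<^sub>1 - h\<^sub>0 + \<ell>(R / (x))\<close>. It remains to see \<open>\<Delta>P = \<ell>(R / (x))\<close>. As \<open>\<Delta>P\<close> is constant,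
  it is enough to compute \<open>\<Delta>H\<close> for large \<open>n\<^sub>1, n\<^sub>2\<close>. There superficiality turns each backward
  difference into passing to the quotient by one more element of the sequence, and finally
  \<open>F \<subseteq> (x)\<close>.

  An element such as \<open>0\<close> satisfies the superficiality condition, so regularity of the sequence
  comes from the finiteness of \<open>\<ell>(F / G)\<close> instead: it makes \<open>(x)\<close> primary to the maximal ideal, i.e. the
  sequence a system of parameters of a Cohen-Macaulay ring. That such a sequence is regular is proved
  without dimension theory, from the depth sensitivity of the Koszul complex.
\<close>

section \<open>Lengths of intervals of submodules\<close>

text \<open>Lengths are kept as intervals of submodules with values in \<open>enat\<close>:
  additivity and the isomorphism theorems then hold without finiteness conditions, and the identity
  linking \<open>F / G\<close> to the homology is proved as an equality of sums before anything is
  subtracted in the integers. The regular sequence that feeds the Koszul argument is not the given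
  one: it is supplied by the depth, and each of its members has a power in \<open>(x)\<close>. The
  obstacle is that exactness of the Koszul complex on a system of parameters only controls its last
  element. To reach an earlier element, its successor \<open>b\<close> is replaced by
  \<open>b [^] N\<close> and moved in front of it; the result is again a system of parameters, in
  which the element in question stands one place later. Letting \<open>N\<close> vary leaves the
  intersection of the ideals generated by the predecessors and \<open>b [^] N\<close>, which Krull's
  intersection theorem reduces to the ideal of the predecessors.\<close>

definition chain_length :: "'c set set \<Rightarrow> enat" where
  "chain_length F =
    Sup {enat n | n. \<exists>N :: nat \<Rightarrow> 'c set. (\<forall>i\<le>n. N i \<in> F) \<and> (\<forall>i<n. N i \<subset> N (Suc i))}"

definition rel_length ::
    "('a, 'b) ring_scheme \<Rightarrow> ('a, 'c, 'd) module_scheme \<Rightarrow> 'c set \<Rightarrow> 'c set \<Rightarrow> enat" where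
  "rel_length R M A B = chain_length {N. submodule N R M \<and> A \<subseteq> N \<and> N \<subseteq> B}"

lemma module_length_eq_chain_length:
  "module_length R M = chain_length {N. submodule N R M}"
  by (simp add: module_length_def chain_length_def)

text \<open>A supremum of naturals exceeds \<open>k\<close> only if some member does, so a chain
  with at least \<open>Suc k\<close> steps exists and can be cut off. The family has to be nonempty
  for the sake of \<open>n = 0\<close>: the supremum of the empty set is \<open>0\<close> as
  well.\<close>

lemma enat_le_chain_length_iff:
  assumes "F \<noteq> {}"
  shows "enat n \<le> chain_length F \<longleftrightarrow> (\<exists>N. (\<forall>i\<le>n. N i \<in> F) \<and> (\<forall>i<n. N i \<subset> N (Suc i)))"
proof
  assume le: "enat n \<le> chain_length F"
  show "\<exists>N. (\<forall>i\<le>n. N i \<in> F) \<and> (\<forall>i<n. N i \<subset> N (Suc i))"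
  proof (cases n)
    case 0
    with assms show ?thesis by (intro exI[of _ "\<lambda>_. SOME X. X \<in> F"]) (simp add: some_in_eq)
  next
    case (Suc k)
    then have "enat k < chain_length F"
      using le by (metis Suc_ile_eq)
    then obtain l N where "k < l" "\<forall>i\<le>l. N i \<in> F" "\<forall>i<l. N i \<subset> N (Suc i)"
      unfolding chain_length_def less_Sup_iff by auto
    with Suc show ?thesis by (intro exI[of _ N]) auto
  qed
next
  assume "\<exists>N. (\<forall>i\<le>n. N i \<in> F) \<and> (\<forall>i<n. N i \<subset> N (Suc i))"
  then show "enat n \<le> chain_length F"
    unfolding chain_length_def by (intro Sup_upper) auto
qed

lemma chain_length_le_if_strict_mono:
  assumes "\<And>X. X \<in> F \<Longrightarrow> \<phi> X \<in> G"
    and "\<And>X Y. \<lbrakk>X \<in> F; Y \<in> F; X \<subset> Y\<rbrakk> \<Longrightarrow> \<phi> X \<subset> \<phi> Y"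
  shows "chain_length F \<le> chain_length G"
  unfolding chain_length_def
proof (rule Sup_subset_mono, safe)
  fix n N assume "\<forall>i\<le>n. N i \<in> F" "\<forall>i<n. N i \<subset> N (Suc i)"
  with assms show "\<exists>m. enat n = enat m \<and> (\<exists>N'. (\<forall>i\<le>m. N' i \<in> G) \<and> (\<forall>i<m. N' i \<subset> N' (Suc i)))"
    by (intro exI[of _ n] conjI exI[of _ "\<lambda>i. \<phi> (N i)"]) auto
qed

lemma rel_length_mono:
  assumes "A' \<subseteq> A" "B \<subseteq> B'"
  shows "rel_length R M A B \<le> rel_length R M A' B'"
  unfolding rel_length_def
  by (rule chain_length_le_if_strict_mono[where \<phi> = id]) (use assms in auto)

lemma chain_length_singleton: "chain_length {A} = 0"
proof -
  have "\<not> enat 1 \<le> chain_length {A}"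
    by (subst enat_le_chain_length_iff) auto
  then show ?thesis
    by (metis One_nat_def Suc_ile_eq i0_lb leI one_enat_def order_antisym_conv zero_enat_def)
qed

lemma rel_length_eq_0_if_superset: "B \<subseteq> A \<Longrightarrow> rel_length R M A B = 0"
proof -
  assume "B \<subseteq> A"
  then have "\<And>N. submodule N R M \<and> A \<subseteq> N \<and> N \<subseteq> B \<Longrightarrow> N = A" by auto
  then have "{N. submodule N R M \<and> A \<subseteq> N \<and> N \<subseteq> B} \<subseteq> {A}" by blast
  then have "rel_length R M A B \<le> chain_length {A}"
    unfolding rel_length_def by (intro chain_length_le_if_strict_mono[where \<phi> = id]) auto
  then show ?thesis by (simp add: chain_length_singleton)
qed

text \<open>Putting \<open>Y\<close> on top of a chain below \<open>X\<close> adds one step. If the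
  length below \<open>X\<close> is infinite, monotonicity alone suffices.\<close>

lemma rel_length_strict_mono_upper:
  assumes "submodule A R M" "submodule Y R M" "A \<subseteq> X" "X \<subset> Y"
  shows "rel_length R M A X + 1 \<le> rel_length R M A Y"
proof (cases "rel_length R M A X = 0")
  case True
  have "enat 1 \<le> chain_length {N. submodule N R M \<and> A \<subseteq> N \<and> N \<subseteq> Y}"
  proof (subst enat_le_chain_length_iff)
    show "{N. submodule N R M \<and> A \<subseteq> N \<and> N \<subseteq> Y} \<noteq> {}" using assms by blast
    show "\<exists>N. (\<forall>i\<le>1. N i \<in> {N. submodule N R M \<and> A \<subseteq> N \<and> N \<subseteq> Y}) \<and> (\<forall>i<1. N i \<subset> N (Suc i))"
      by (rule exI[of _ "\<lambda>i. if i = 0 then A else Y"]) (use assms in auto)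
  qed
  with True show ?thesis by (simp add: rel_length_def one_enat_def)
next
  case False
  let ?F = "\<lambda>X. {N. submodule N R M \<and> A \<subseteq> N \<and> N \<subseteq> X}"
  have FX: "?F X \<noteq> {}" and FY: "?F Y \<noteq> {}" using assms by blast+
  have "enat (Suc n) \<le> rel_length R M A Y" if "enat n \<le> rel_length R M A X" for n
  proof -
    from that obtain N where N: "\<forall>i\<le>n. N i \<in> ?F X" "\<forall>i<n. N i \<subset> N (Suc i)"
      unfolding rel_length_def enat_le_chain_length_iff[OF FX] by auto
    have NX: "N i \<subseteq> X" if "i \<le> n" for i using N that by blast
    have mem: "\<forall>i\<le>n. N i \<in> ?F Y" using N NX assms by blast
    have "N n \<subset> Y" "Y \<in> ?F Y" using NX[of n] assms by blast+
    with mem N show ?thesis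
      unfolding rel_length_def enat_le_chain_length_iff[OF FY]
      by (intro exI[of _ "\<lambda>i. if i \<le> n then N i else Y"]) (simp add: less_Suc_eq)
  qed
  note step = this
  show ?thesis
  proof (cases "rel_length R M A X")
    case (enat n)
    then show ?thesis using step[of n] by (simp add: one_enat_def)
  next
    case infinity
    then show ?thesis
      using rel_length_mono[of A A X Y R M] assms by auto
  qed
qed

lemma (in abelian_group) add_minus_cancel_left:
  "u \<in> carrier G \<Longrightarrow> v \<in> carrier G \<Longrightarrow> (u \<oplus> v) \<ominus> u = v"
  by (subst a_comm) (simp_all add: a_minus_def a_assoc r_neg)

lemma (in module) submodule_simps:
  assumes "submodule H R M"
  shows "\<zero>\<^bsub>M\<^esub> \<in> H" "x \<in> H \<Longrightarrow> x \<in> carrier M" "x \<in> H \<Longrightarrow> y \<in> H \<Longrightarrow> x \<oplus>\<^bsub>M\<^esub> y \<in> H"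
    "x \<in> H \<Longrightarrow> \<ominus>\<^bsub>M\<^esub> x \<in> H" "r \<in> carrier R \<Longrightarrow> x \<in> H \<Longrightarrow> r \<odot>\<^bsub>M\<^esub> x \<in> H"
    "x \<in> H \<Longrightarrow> y \<in> H \<Longrightarrow> x \<ominus>\<^bsub>M\<^esub> y \<in> H"
proof -
  note E = submoduleE[OF assms]
  show "\<zero>\<^bsub>M\<^esub> \<in> H" using subgroup.one_closed[OF submodule.axioms(1)[OF assms]] by simp
  show "x \<in> H \<Longrightarrow> x \<in> carrier M" "x \<in> H \<Longrightarrow> y \<in> H \<Longrightarrow> x \<oplus>\<^bsub>M\<^esub> y \<in> H"
    "x \<in> H \<Longrightarrow> \<ominus>\<^bsub>M\<^esub> x \<in> H" "r \<in> carrier R \<Longrightarrow> x \<in> H \<Longrightarrow> r \<odot>\<^bsub>M\<^esub> x \<in> H"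
    "x \<in> H \<Longrightarrow> y \<in> H \<Longrightarrow> x \<ominus>\<^bsub>M\<^esub> y \<in> H"
    using E by (auto simp: a_minus_def)
qed

lemma (in module) mem_set_add_iff:
  "x \<in> A <+>\<^bsub>M\<^esub> B \<longleftrightarrow> (\<exists>a\<in>A. \<exists>b\<in>B. x = a \<oplus>\<^bsub>M\<^esub> b)"
  by (auto simp: set_add_def')

text \<open>Negatives come for free as multiples by \<open>\<ominus> \<one>\<close>.\<close>

lemma (in module) submoduleI_smult:
  assumes "H \<subseteq> carrier M" "\<zero>\<^bsub>M\<^esub> \<in> H" "\<And>x y. x \<in> H \<Longrightarrow> y \<in> H \<Longrightarrow> x \<oplus>\<^bsub>M\<^esub> y \<in> H"
    and smult: "\<And>r x. r \<in> carrier R \<Longrightarrow> x \<in> H \<Longrightarrow> r \<odot>\<^bsub>M\<^esub> x \<in> H"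
  shows "submodule H R M"
proof (rule submoduleI)
  show "\<ominus>\<^bsub>M\<^esub> x \<in> H" if "x \<in> H" for x
    using smult[of "\<ominus> \<one>" x] that assms(1) by (auto simp: smult_l_minus)
qed (use assms in auto)

lemma (in module) submodule_inter:
  "submodule A R M \<Longrightarrow> submodule B R M \<Longrightarrow> submodule (A \<inter> B) R M"
  by (rule submoduleI) (auto simp: submodule_simps)

lemma (in module) submodule_set_add:
  assumes A: "submodule A R M" and B: "submodule B R M"
  shows "submodule (A <+>\<^bsub>M\<^esub> B) R M"
proof (rule submoduleI_smult)
  note a = submodule_simps[OF A] and b = submodule_simps[OF B]
  show "A <+>\<^bsub>M\<^esub> B \<subseteq> carrier M" using a b by (auto simp: mem_set_add_iff)
  show "\<zero>\<^bsub>M\<^esub> \<in> A <+>\<^bsub>M\<^esub> B" unfolding mem_set_add_iff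
    by (rule bexI[of _ "\<zero>\<^bsub>M\<^esub>"], rule bexI[of _ "\<zero>\<^bsub>M\<^esub>"]) (use a b in auto)
  show "x \<oplus>\<^bsub>M\<^esub> y \<in> A <+>\<^bsub>M\<^esub> B" if xy: "x \<in> A <+>\<^bsub>M\<^esub> B" "y \<in> A <+>\<^bsub>M\<^esub> B" for x y
  proof -
    obtain u v u' v' where "u \<in> A" "v \<in> B" "x = u \<oplus>\<^bsub>M\<^esub> v" "u' \<in> A" "v' \<in> B" "y = u' \<oplus>\<^bsub>M\<^esub> v'"
      using xy unfolding mem_set_add_iff by blast
    then show ?thesis unfolding mem_set_add_iff
      by (intro bexI[of _ "u \<oplus>\<^bsub>M\<^esub> u'"] bexI[of _ "v \<oplus>\<^bsub>M\<^esub> v'"]) (auto simp: a b M.a_ac)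
  qed
  show "r \<odot>\<^bsub>M\<^esub> x \<in> A <+>\<^bsub>M\<^esub> B" if rx: "r \<in> carrier R" "x \<in> A <+>\<^bsub>M\<^esub> B" for r x
  proof -
    obtain u v where "u \<in> A" "v \<in> B" "x = u \<oplus>\<^bsub>M\<^esub> v" using rx unfolding mem_set_add_iff by blast
    then show ?thesis unfolding mem_set_add_iff using rx
      by (intro bexI[of _ "r \<odot>\<^bsub>M\<^esub> u"] bexI[of _ "r \<odot>\<^bsub>M\<^esub> v"]) (auto simp: a b smult_r_distr)
  qed
qed

lemma (in module) set_add_upper:
  assumes A: "submodule A R M" and B: "submodule B R M"
  shows "A \<subseteq> A <+>\<^bsub>M\<^esub> B" "B \<subseteq> A <+>\<^bsub>M\<^esub> B"
proof -
  note a = submodule_simps[OF A] and b = submodule_simps[OF B]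
  show "A \<subseteq> A <+>\<^bsub>M\<^esub> B"
  proof
    fix x assume "x \<in> A"
    then have "x = x \<oplus>\<^bsub>M\<^esub> \<zero>\<^bsub>M\<^esub>" by (simp add: a)
    then show "x \<in> A <+>\<^bsub>M\<^esub> B" unfolding mem_set_add_iff using b(1) \<open>x \<in> A\<close> by blast
  qed
  show "B \<subseteq> A <+>\<^bsub>M\<^esub> B"
  proof
    fix x assume "x \<in> B"
    then have "x = \<zero>\<^bsub>M\<^esub> \<oplus>\<^bsub>M\<^esub> x" by (simp add: b)
    then show "x \<in> A <+>\<^bsub>M\<^esub> B" unfolding mem_set_add_iff using a(1) \<open>x \<in> B\<close> by blast
  qed
qed

lemma (in module) set_add_least:
  assumes "submodule C R M" "A \<subseteq> C" "B \<subseteq> C"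
  shows "A <+>\<^bsub>M\<^esub> B \<subseteq> C"
  using assms(2,3) submodule_simps(3)[OF assms(1)] by (fastforce simp: mem_set_add_iff)

text \<open>A strict inclusion stays strict either after intersecting with \<open>B\<close> or after adding \<open>B\<close>
  (the modular law), so a chain from \<open>A\<close> to \<open>C\<close> splits into chains below and above \<open>B\<close>.\<close>

lemma (in module) rel_length_le_add:
  assumes A: "submodule A R M" and B: "submodule B R M" and C: "submodule C R M"
    and AB: "A \<subseteq> B" and BC: "B \<subseteq> C"
  shows "rel_length R M A C \<le> rel_length R M A B + rel_length R M B C"
proof -
  have "enat n \<le> rel_length R M A B + rel_length R M B C"
    if N: "\<forall>i\<le>n. submodule (N i) R M \<and> A \<subseteq> N i \<and> N i \<subseteq> C" "\<forall>i<n. N i \<subset> N (Suc i)" for n N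
  proof -
    have "enat i \<le> rel_length R M A (N i \<inter> B) + rel_length R M B (N i <+>\<^bsub>M\<^esub> B)" if "i \<le> n" for i
      using that
    proof (induction i)
      case 0
      show ?case by (simp add: zero_enat_def[symmetric])
    next
      case (Suc i)
      have S: "submodule (N i) R M" "submodule (N (Suc i)) R M" and sub: "A \<subseteq> N i" "N i \<subset> N (Suc i)"
        using N Suc.prems by auto
      let ?X = "N i \<inter> B" and ?X' = "N (Suc i) \<inter> B"
      let ?Y = "N i <+>\<^bsub>M\<^esub> B" and ?Y' = "N (Suc i) <+>\<^bsub>M\<^esub> B"
      have XX: "?X \<subseteq> ?X'" using sub by auto
      have YY: "?Y \<subseteq> ?Y'" using sub unfolding subset_iff mem_set_add_iff by blast
      have "?X \<noteq> ?X' \<or> ?Y \<noteq> ?Y'"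
      proof (rule ccontr)
        assume "\<not> ?thesis"
        then have eq: "?X = ?X'" "?Y = ?Y'" by auto
        have "N (Suc i) \<subseteq> N i"
        proof
          fix x assume x: "x \<in> N (Suc i)"
          then have "x \<in> ?Y'" using set_add_upper(1)[OF S(2) B] by auto
          then obtain u v where uv: "u \<in> N i" "v \<in> B" "x = u \<oplus>\<^bsub>M\<^esub> v"
            unfolding eq(2)[symmetric] mem_set_add_iff by blast
          have c: "u \<in> carrier M" "v \<in> carrier M" using uv S B by (auto simp: submodule_simps(2))
          have "v = x \<ominus>\<^bsub>M\<^esub> u"
            using uv(3) c by (simp add: M.add_minus_cancel_left)
          then have "v \<in> N (Suc i)" using submodule_simps(6)[OF S(2)] x uv(1) sub by auto
          then have "v \<in> N i" using uv(2) eq(1) by auto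
          then show "x \<in> N i" using uv submodule_simps(3)[OF S(1)] by simp
        qed
        with sub show False by auto
      qed
      then consider "?X \<subset> ?X'" | "?Y \<subset> ?Y'" using XX YY by auto
      then have "rel_length R M A ?X + rel_length R M B ?Y + 1
          \<le> rel_length R M A ?X' + rel_length R M B ?Y'"
      proof cases
        case 1
        then have "rel_length R M A ?X + 1 \<le> rel_length R M A ?X'"
          using A S B AB sub by (intro rel_length_strict_mono_upper submodule_inter) auto
        moreover have "rel_length R M B ?Y \<le> rel_length R M B ?Y'"
          using YY by (intro rel_length_mono) auto
        ultimately have "(rel_length R M A ?X + 1) + rel_length R M B ?Y
            \<le> rel_length R M A ?X' + rel_length R M B ?Y'" by (rule add_mono)
        then show ?thesis by (simp add: ac_simps)
      next
        case 2
        then have "rel_length R M B ?Y + 1 \<le> rel_length R M B ?Y'"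
          using S B set_add_upper(2)[OF S(1) B]
          by (intro rel_length_strict_mono_upper submodule_set_add) auto
        moreover have "rel_length R M A ?X \<le> rel_length R M A ?X'"
          using XX by (intro rel_length_mono) auto
        ultimately have "rel_length R M A ?X + (rel_length R M B ?Y + 1)
            \<le> rel_length R M A ?X' + rel_length R M B ?Y'" by (metis add_mono)
        then show ?thesis by (simp add: ac_simps)
      qed
      moreover have "enat (Suc i) \<le> rel_length R M A ?X + rel_length R M B ?Y + 1"
        using add_right_mono[OF Suc.IH, of 1] Suc.prems by (simp add: one_enat_def)
      ultimately show ?case by (rule order_trans[rotated])
    qed
    then have "enat n \<le> rel_length R M A (N n \<inter> B) + rel_length R M B (N n <+>\<^bsub>M\<^esub> B)" by simp
    also have "\<dots> \<le> rel_length R M A B + rel_length R M B C"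
      using N B C BC by (intro add_mono rel_length_mono set_add_least) auto
    finally show ?thesis .
  qed
  note bound = this
  show ?thesis
    unfolding rel_length_def[of R M A C] chain_length_def
  proof (rule Sup_least, clarify)
    fix n N
    assume "\<forall>i\<le>n. N i \<in> {N. submodule N R M \<and> A \<subseteq> N \<and> N \<subseteq> C}" "\<forall>i<n. N i \<subset> N (Suc i)"
    then show "enat n \<le> rel_length R M A B + rel_length R M B C"
      by (intro bound[of n N]) simp_all
  qed
qed

text \<open>A longest chain up to \<open>B\<close> is continued by a longest chain above
  \<open>B\<close>. Such chains exist because both lengths are bounded by that of the whole
  interval; if that one is infinite, nothing is to be shown.\<close>

lemma add_le_rel_length:
  assumes A: "submodule A R M" and B: "submodule B R M" and C: "submodule C R M"
    and AB: "A \<subseteq> B" and BC: "B \<subseteq> C"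
  shows "rel_length R M A B + rel_length R M B C \<le> rel_length R M A C"
proof (cases "rel_length R M A C")
  case (enat l)
  let ?F = "\<lambda>A B. {N. submodule N R M \<and> A \<subseteq> N \<and> N \<subseteq> B}"
  have ne: "?F A B \<noteq> {}" "?F B C \<noteq> {}" "?F A C \<noteq> {}" using assms by auto
  have "rel_length R M A B \<le> enat l" "rel_length R M B C \<le> enat l"
    using rel_length_mono[of A A B C R M] rel_length_mono[of A B C C R M] enat assms by auto
  then obtain p q where pq: "rel_length R M A B = enat p" "rel_length R M B C = enat q"
    by (metis enat_ile)
  obtain N where N: "\<forall>i\<le>p. N i \<in> ?F A B" "\<forall>i<p. N i \<subset> N (Suc i)"
    using pq(1) enat_le_chain_length_iff[OF ne(1), of p] unfolding rel_length_def by auto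
  obtain N' where N': "\<forall>i\<le>q. N' i \<in> ?F B C" "\<forall>i<q. N' i \<subset> N' (Suc i)"
    using pq(2) enat_le_chain_length_iff[OF ne(2), of q] unfolding rel_length_def by auto
  \<comment> \<open>The top \<open>N p\<close> of the lower chain is dropped in favour of
    \<open>N' 0\<close>, which contains \<open>B\<close> and hence \<open>N p\<close>; the number of
    strict steps remains \<open>p + q\<close>.\<close>
  let ?N = "\<lambda>i. if i < p then N i else N' (i - p)"
  have 1: "?N i \<in> ?F A C" if "i \<le> p + q" for i
  proof (cases "i < p")
    case True
    then have "N i \<in> ?F A B" using N(1) by simp
    then show ?thesis using True assms by auto
  next
    case False
    then have "N' (i - p) \<in> ?F B C" using N'(1) that by simp
    then show ?thesis using False assms by auto
  qed
  have 2: "?N i \<subset> ?N (Suc i)" if "i < p + q" for i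
  proof -
    consider "Suc i < p" | "Suc i = p" | "p \<le> i" by linarith
    then show ?thesis
    proof cases
      case 2
      then have "N i \<subset> N (Suc i)" "N (Suc i) \<subseteq> B" "B \<subseteq> N' 0" using N N' by auto
      then have "N i \<subset> N' 0" by (meson order_trans psubset_subset_trans)
      then show ?thesis using 2 by auto
    qed (use N N' that in \<open>auto simp: Suc_diff_le\<close>)
  qed
  have "enat (p + q) \<le> rel_length R M A C"
    unfolding rel_length_def enat_le_chain_length_iff[OF ne(3)] using 1 2 by (intro exI[of _ ?N]) blast
  then show ?thesis using pq by simp
qed simp

lemma (in module) rel_length_add:
  assumes "submodule A R M" "submodule B R M" "submodule C R M" "A \<subseteq> B" "B \<subseteq> C"
  shows "rel_length R M A C = rel_length R M A B + rel_length R M B C"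
  using rel_length_le_add[OF assms] add_le_rel_length[OF assms] by (rule order_antisym)

section \<open>Homomorphisms and the isomorphism theorems for lengths\<close>

locale module_hom = M: module R M + N: module R N for R (structure) and M N +
  fixes f
  assumes hom_closed [simp, intro]: "x \<in> carrier M \<Longrightarrow> f x \<in> carrier N"
    and hom_add: "x \<in> carrier M \<Longrightarrow> y \<in> carrier M \<Longrightarrow> f (x \<oplus>\<^bsub>M\<^esub> y) = f x \<oplus>\<^bsub>N\<^esub> f y"
    and hom_smult: "r \<in> carrier R \<Longrightarrow> x \<in> carrier M \<Longrightarrow> f (r \<odot>\<^bsub>M\<^esub> x) = r \<odot>\<^bsub>N\<^esub> f x"
begin

lemma hom_zero: "f \<zero>\<^bsub>M\<^esub> = \<zero>\<^bsub>N\<^esub>"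
  using hom_smult[of \<zero> "\<zero>\<^bsub>M\<^esub>"] by simp

lemma hom_minus: "x \<in> carrier M \<Longrightarrow> f (\<ominus>\<^bsub>M\<^esub> x) = \<ominus>\<^bsub>N\<^esub> f x"
  using hom_smult[of "\<ominus> \<one>" x] by (simp add: M.smult_l_minus N.smult_l_minus)

lemma submodule_vimage:
  assumes "submodule B R N"
  shows "submodule {x \<in> carrier M. f x \<in> B} R M"
  by (rule M.submoduleI)
    (use N.submodule_simps[OF assms] in \<open>auto simp: hom_zero hom_minus hom_add hom_smult\<close>)

lemma submodule_image:
  assumes "submodule C R M"
  shows "submodule (f ` C) R N"
proof (rule N.submoduleI_smult)
  note c = M.submodule_simps[OF assms]
  show "f ` C \<subseteq> carrier N" using c by auto
  show "\<zero>\<^bsub>N\<^esub> \<in> f ` C" using hom_zero c(1) by force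
  show "a \<oplus>\<^bsub>N\<^esub> b \<in> f ` C" if "a \<in> f ` C" "b \<in> f ` C" for a b
    using that c by (auto simp: hom_add[symmetric])
  show "r \<odot>\<^bsub>N\<^esub> a \<in> f ` C" if "r \<in> carrier R" "a \<in> f ` C" for r a
    using that c by (auto simp: hom_smult[symmetric])
qed

text \<open>The isomorphism theorems for lengths all follow from this: pulling back along \<open>f\<close>
  identifies the submodules between \<open>B\<close> and \<open>B + f C\<close> with those between \<open>f\<^sup>-\<^sup>1 B \<inter> C\<close>
  and \<open>C\<close>.\<close>

lemma rel_length_vimage:
  assumes B: "submodule B R N" and C: "submodule C R M"
  shows "rel_length R M {x \<in> C. f x \<in> B} C = rel_length R N B (B <+>\<^bsub>N\<^esub> f ` C)"
proof (rule order_antisym)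
  note b = N.submodule_simps[OF B] and c = M.submodule_simps[OF C]
  have mono: "B <+>\<^bsub>N\<^esub> f ` X \<subseteq> B <+>\<^bsub>N\<^esub> f ` Y" if "X \<subseteq> Y" for X Y
    using that unfolding subset_iff N.mem_set_add_iff by blast
  have "B <+>\<^bsub>N\<^esub> f ` X \<subset> B <+>\<^bsub>N\<^esub> f ` Y"
    if X: "submodule X R M" "{x \<in> C. f x \<in> B} \<subseteq> X" and Y: "submodule Y R M" "Y \<subseteq> C" and XY: "X \<subset> Y"
    for X Y
  proof -
    note x = M.submodule_simps[OF X(1)] and y = M.submodule_simps[OF Y(1)]
    obtain u where u: "u \<in> Y" "u \<notin> X" using XY by auto
    have "f u \<in> B <+>\<^bsub>N\<^esub> f ` Y"
      using N.set_add_upper(2)[OF B submodule_image[OF Y(1)]] u(1) by auto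
    moreover have "f u \<notin> B <+>\<^bsub>N\<^esub> f ` X"
    proof
      assume "f u \<in> B <+>\<^bsub>N\<^esub> f ` X"
      then obtain w v where wv: "w \<in> B" "v \<in> X" "f u = w \<oplus>\<^bsub>N\<^esub> f v" by (auto simp: N.mem_set_add_iff)
      have car: "u \<in> carrier M" "v \<in> carrier M" "w \<in> carrier N" using u wv x y b by auto
      have "f (u \<ominus>\<^bsub>M\<^esub> v) = f u \<ominus>\<^bsub>N\<^esub> f v"
        using car by (simp add: a_minus_def hom_add hom_minus)
      also have "\<dots> = w"
        using car by (simp add: wv(3) a_minus_def N.M.a_assoc N.M.r_neg)
      finally have "u \<ominus>\<^bsub>M\<^esub> v \<in> {x \<in> C. f x \<in> B}"
        using wv u(1) XY Y y(6)[of u v] by auto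
      then have "u \<ominus>\<^bsub>M\<^esub> v \<in> X" using X(2) by auto
      then have "(u \<ominus>\<^bsub>M\<^esub> v) \<oplus>\<^bsub>M\<^esub> v \<in> X" using x(3) wv(2) by blast
      then show False using u(2) car by (simp add: a_minus_def M.M.a_assoc M.M.l_neg)
    qed
    ultimately show ?thesis using mono[of X Y] XY by blast
  qed
  then show "rel_length R M {x \<in> C. f x \<in> B} C \<le> rel_length R N B (B <+>\<^bsub>N\<^esub> f ` C)"
    unfolding rel_length_def
    by (intro chain_length_le_if_strict_mono[where \<phi> = "\<lambda>X. B <+>\<^bsub>N\<^esub> f ` X"])
      (auto simp: N.submodule_set_add B submodule_image N.set_add_upper[THEN subsetD]
        mono[THEN subsetD])
  show "rel_length R N B (B <+>\<^bsub>N\<^esub> f ` C) \<le> rel_length R M {x \<in> C. f x \<in> B} C"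
    unfolding rel_length_def
  proof (rule chain_length_le_if_strict_mono[where \<phi> = "\<lambda>Y. {x \<in> C. f x \<in> Y}"])
    fix X assume X: "X \<in> {N'. submodule N' R N \<and> B \<subseteq> N' \<and> N' \<subseteq> B <+>\<^bsub>N\<^esub> f ` C}"
    have "{x \<in> C. f x \<in> X} = C \<inter> {x \<in> carrier M. f x \<in> X}" using c by auto
    then show "{x \<in> C. f x \<in> X} \<in> {N. submodule N R M \<and> {x \<in> C. f x \<in> B} \<subseteq> N \<and> N \<subseteq> C}"
      using X by (auto simp: M.submodule_inter C submodule_vimage)
  next
    fix X Y assume X: "X \<in> {N'. submodule N' R N \<and> B \<subseteq> N' \<and> N' \<subseteq> B <+>\<^bsub>N\<^esub> f ` C}"
      and Y: "Y \<in> {N'. submodule N' R N \<and> B \<subseteq> N' \<and> N' \<subseteq> B <+>\<^bsub>N\<^esub> f ` C}" and XY: "X \<subset> Y"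
    then have SX: "submodule X R N" and SY: "submodule Y R N" by auto
    note x = N.submodule_simps[OF SX] and y = N.submodule_simps[OF SY]
    obtain v where v: "v \<in> Y" "v \<notin> X" using XY by auto
    then obtain w u where wu: "w \<in> B" "u \<in> C" "v = w \<oplus>\<^bsub>N\<^esub> f u"
      using Y unfolding mem_Collect_eq subset_iff[of Y] N.mem_set_add_iff by (metis imageE)
    have "w \<in> X" "w \<in> Y" using wu X Y by auto
    have car: "w \<in> carrier N" "f u \<in> carrier N" using wu b c by auto
    have "f u = v \<ominus>\<^bsub>N\<^esub> w" using car wu(3) by (simp add: N.M.add_minus_cancel_left)
    then have "f u \<in> Y" using y v \<open>w \<in> Y\<close> by auto
    moreover have "f u \<notin> X" using v(2) wu x(3)[OF \<open>w \<in> X\<close>, of "f u"] by auto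
    ultimately show "{x \<in> C. f x \<in> X} \<subset> {x \<in> C. f x \<in> Y}" using XY wu(2) by blast
  qed
qed

text \<open>The general pull-back formula with the image of \<open>D\<close> as lower bound: since
  the kernel inside \<open>C\<close> is contained in \<open>D\<close>, pulling that image back to
  \<open>C\<close> returns \<open>D\<close>.\<close>

lemma rel_length_image:
  assumes D: "submodule D R M" and C: "submodule C R M" and DC: "D \<subseteq> C"
    and ker: "\<And>x. x \<in> C \<Longrightarrow> f x = \<zero>\<^bsub>N\<^esub> \<Longrightarrow> x \<in> D"
  shows "rel_length R N (f ` D) (f ` C) = rel_length R M D C"
proof -
  note c = M.submodule_simps[OF C] and d = M.submodule_simps[OF D]
  have "{x \<in> C. f x \<in> f ` D} = D"
  proof (safe)
    fix x y assume x: "x \<in> C" and y: "y \<in> D" and eq: "f x = f y"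
    have car: "x \<in> carrier M" "y \<in> carrier M" "y \<in> C" using x y c d DC by auto
    have "f (x \<ominus>\<^bsub>M\<^esub> y) = \<zero>\<^bsub>N\<^esub>"
      using car eq by (simp add: a_minus_def hom_add hom_minus N.M.r_neg)
    then have "x \<ominus>\<^bsub>M\<^esub> y \<in> D" using ker[OF c(6)[OF x car(3)]] by simp
    then have "(x \<ominus>\<^bsub>M\<^esub> y) \<oplus>\<^bsub>M\<^esub> y \<in> D" using d(3) y by simp
    then show "x \<in> D" using car by (simp add: a_minus_def M.M.a_assoc M.M.l_neg)
  qed (use DC in auto)
  moreover have "f ` D <+>\<^bsub>N\<^esub> f ` C = f ` C"
  proof
    show "f ` D <+>\<^bsub>N\<^esub> f ` C \<subseteq> f ` C"
      using submodule_image[OF C] DC by (intro N.set_add_least) auto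
    show "f ` C \<subseteq> f ` D <+>\<^bsub>N\<^esub> f ` C"
      using submodule_image[OF C] submodule_image[OF D] by (intro N.set_add_upper)
  qed
  ultimately show ?thesis
    using rel_length_vimage[OF submodule_image[OF D] C] by simp
qed

end

section \<open>The modules of the statement\<close>

lemma module_length_eq_rel_length:
  fixes M :: "('a, 'c) module"
  assumes "module R M"
  shows "module_length R M = rel_length R M {\<zero>\<^bsub>M\<^esub>} (carrier M)"
proof -
  interpret module R M by (rule assms)
  have "{N. submodule N R M} = {N. submodule N R M \<and> {\<zero>\<^bsub>M\<^esub>} \<subseteq> N \<and> N \<subseteq> carrier M}"
    using submodule_simps(1,2) by blast
  then show ?thesis
    by (simp add: module_length_eq_chain_length rel_length_def)
qed

lemma (in module) zero_submodule: "submodule {\<zero>\<^bsub>M\<^esub>} R M"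
  by (rule submoduleI) auto

lemma (in module) submodule_restrict:
  assumes Z: "submodule Z R M" and N: "submodule N R M" "N \<subseteq> Z"
  shows "submodule N R (M\<lparr>carrier := Z\<rparr>)"
proof -
  interpret Z: module R "M\<lparr>carrier := Z\<rparr>"
    using submodule.submodule_is_module[OF Z module_axioms] .
  have "module R (M\<lparr>carrier := N\<rparr>)"
    using submodule.submodule_is_module[OF N(1) module_axioms] .
  with N(2) show ?thesis
    by (intro Z.module_incl_imp_submodule) simp_all
qed

lemma (in module) rel_length_restrict:
  assumes Z: "submodule Z R M" and A: "submodule A R M" and B: "submodule B R M"
    and "A \<subseteq> B" "B \<subseteq> Z"
  shows "rel_length R (M\<lparr>carrier := Z\<rparr>) A B = rel_length R M A B"
proof -
  interpret Z: module R "M\<lparr>carrier := Z\<rparr>"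
    using submodule.submodule_is_module[OF Z module_axioms] .
  interpret module_hom R "M\<lparr>carrier := Z\<rparr>" M "\<lambda>x. x"
    by unfold_locales (use submodule_simps(2)[OF Z] in auto)
  have "A \<subseteq> Z" using assms by auto
  moreover have "x \<in> A" if "x = \<zero>\<^bsub>M\<^esub>" for x using submodule_simps(1)[OF A] that by simp
  ultimately show ?thesis
    using rel_length_image[OF submodule_restrict[OF Z A] submodule_restrict[OF Z B]] assms by simp
qed

section \<open>Quotient modules built from cosets\<close>

locale module_quotient = module R M for R (structure) and M :: "('a, 'c) module" +
  fixes N
  assumes submodule_N: "submodule N R M"
begin

lemma abelian_subgroup_N: "abelian_subgroup N M"
  by (rule abelian_subgroupI3)
    (auto intro: additive_subgroupI submodule.axioms(1)[OF submodule_N] M.abelian_group_axioms)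

sublocale N: abelian_subgroup N M by (rule abelian_subgroup_N)

abbreviation MN where "MN \<equiv> quot_module M N"

lemma carrier_quot: "carrier (MN) = (\<lambda>x. N +>\<^bsub>M\<^esub> x) ` carrier M"
  by (auto simp: quot_module_def A_RCOSETS_def')

lemma zero_quot: "\<zero>\<^bsub>MN\<^esub> = N"
  by (simp add: quot_module_def)

lemma add_quot:
  "x \<in> carrier M \<Longrightarrow> y \<in> carrier M \<Longrightarrow>
    (N +>\<^bsub>M\<^esub> x) \<oplus>\<^bsub>MN\<^esub> (N +>\<^bsub>M\<^esub> y) = N +>\<^bsub>M\<^esub> (x \<oplus>\<^bsub>M\<^esub> y)"
  by (simp add: quot_module_def N.a_rcos_sum)

lemma coset_eq_iff:
  assumes "x \<in> carrier M" "y \<in> carrier M"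
  shows "N +>\<^bsub>M\<^esub> x = N +>\<^bsub>M\<^esub> y \<longleftrightarrow> x \<ominus>\<^bsub>M\<^esub> y \<in> N"
  by (metis N.a_rcos_module N.a_rcos_self N.a_repr_independence' M.minus_eq assms)

lemma coset_eq_self_iff: "x \<in> carrier M \<Longrightarrow> N +>\<^bsub>M\<^esub> x = N \<longleftrightarrow> x \<in> N"
  by (metis N.a_rcos_const N.a_rcos_self)

text \<open>The union defining the scalar action is taken over a family of equal cosets, because
  \<open>r\<close> times a difference of two representatives stays in \<open>N\<close>.\<close>

lemma smult_quot:
  assumes r: "r \<in> carrier R" and x: "x \<in> carrier M"
  shows "r \<odot>\<^bsub>MN\<^esub> (N +>\<^bsub>M\<^esub> x) = N +>\<^bsub>M\<^esub> (r \<odot>\<^bsub>M\<^esub> x)"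
proof -
  have "N +>\<^bsub>M\<^esub> (r \<odot>\<^bsub>M\<^esub> c) = N +>\<^bsub>M\<^esub> (r \<odot>\<^bsub>M\<^esub> x)" if "c \<in> N +>\<^bsub>M\<^esub> x" for c
  proof -
    have c: "c \<in> carrier M" using N.a_elemrcos_carrier[OF x that] .
    have "c \<ominus>\<^bsub>M\<^esub> x \<in> N" using N.a_rcos_module_imp[OF x that] by (simp add: a_minus_def)
    then have "r \<odot>\<^bsub>M\<^esub> (c \<ominus>\<^bsub>M\<^esub> x) \<in> N" using submodule_simps(5)[OF submodule_N r] by simp
    then show ?thesis using r x c
      by (simp add: coset_eq_iff a_minus_def smult_r_distr smult_r_minus)
  qed
  then have "(\<Union>c\<in>N +>\<^bsub>M\<^esub> x. N +>\<^bsub>M\<^esub> (r \<odot>\<^bsub>M\<^esub> c)) = N +>\<^bsub>M\<^esub> (r \<odot>\<^bsub>M\<^esub> x)"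
    using N.a_rcos_self[OF x] by blast
  then show ?thesis by (simp add: quot_module_def)
qed

lemma module_quot: "module R (MN)"
proof (rule moduleI)
  show "cring R" by (rule R.cring_axioms)
  show "abelian_group (MN)"
  proof (rule abelian_groupI)
    have zero: "\<zero>\<^bsub>MN\<^esub> = N +>\<^bsub>M\<^esub> \<zero>\<^bsub>M\<^esub>"
      using submodule_simps(1)[OF submodule_N] by (simp add: zero_quot N.a_rcos_const)
    show "\<zero>\<^bsub>MN\<^esub> \<in> carrier (MN)"
      unfolding zero carrier_quot by simp
    show "\<zero>\<^bsub>MN\<^esub> \<oplus>\<^bsub>MN\<^esub> x = x" if "x \<in> carrier (MN)" for x
      using that unfolding zero carrier_quot by (auto simp: add_quot)
    show "\<exists>y\<in>carrier (MN). y \<oplus>\<^bsub>MN\<^esub> x = \<zero>\<^bsub>MN\<^esub>"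
      if x: "x \<in> carrier (MN)" for x
    proof -
      obtain u where "u \<in> carrier M" "x = N +>\<^bsub>M\<^esub> u" using x by (auto simp: carrier_quot)
      then show ?thesis
        by (intro bexI[of _ "N +>\<^bsub>M\<^esub> (\<ominus>\<^bsub>M\<^esub> u)"]) (auto simp: add_quot zero carrier_quot M.l_neg)
    qed
    show "x \<oplus>\<^bsub>MN\<^esub> y = y \<oplus>\<^bsub>MN\<^esub> x"
      if "x \<in> carrier (MN)" "y \<in> carrier (MN)" for x y
      using that unfolding carrier_quot by (auto simp only: add_quot M.a_comm)
  qed (auto simp: carrier_quot add_quot M.a_assoc)
qed (auto simp: carrier_quot smult_quot add_quot smult_l_distr smult_r_distr smult_assoc1)

sublocale quot: module R "MN" by (rule module_quot)

sublocale proj: module_hom R M "MN" "\<lambda>x. N +>\<^bsub>M\<^esub> x"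
  by unfold_locales (auto simp: carrier_quot smult_quot add_quot)

text \<open>Pull back the zero submodule, whose only element is the coset \<open>N\<close>, along
  the projection.\<close>

lemma module_length_quot:
  "module_length R (MN) = rel_length R M N (carrier M)"
proof -
  have "{x \<in> carrier M. N +>\<^bsub>M\<^esub> x \<in> {N}} = N"
    using submodule_simps(2)[OF submodule_N] coset_eq_self_iff by blast
  moreover have "{N} <+>\<^bsub>MN\<^esub> (\<lambda>x. N +>\<^bsub>M\<^esub> x) ` carrier M = carrier (MN)"
    using quot.set_add_upper(2)[OF quot.zero_submodule quot.carrier_is_submodule]
      quot.set_add_least[OF quot.carrier_is_submodule, of "{N}" "carrier (MN)"]
      quot.M.zero_closed
    by (auto simp: zero_quot carrier_quot)
  ultimately show ?thesis
    using proj.rel_length_vimage[OF quot.zero_submodule carrier_is_submodule]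
    by (simp add: module_length_eq_rel_length[OF module_quot] zero_quot)
qed

end

text \<open>Homology modules and the quotient in the statement are both defined by shrinking the
  carrier of an ambient module before dividing; this brings their lengths back to intervals in the
  ambient module.\<close>

lemma module_length_quot_restrict:
  fixes M :: "('a, 'c) module"
  assumes M: "module R M" and Z: "submodule Z R M" and N: "submodule N R M" and "N \<subseteq> Z"
  shows "module_length R (quot_module (M\<lparr>carrier := Z\<rparr>) N) = rel_length R M N Z"
proof -
  interpret M: module R M by (rule M)
  interpret Z: module R "M\<lparr>carrier := Z\<rparr>"
    using submodule.submodule_is_module[OF Z M] .
  interpret Q: module_quotient R "M\<lparr>carrier := Z\<rparr>" N
    by (intro module_quotient.intro module_quotient_axioms.intro Z.module_axioms
        M.submodule_restrict[OF Z N \<open>N \<subseteq> Z\<close>])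
  show ?thesis
    using Q.module_length_quot M.rel_length_restrict[OF Z N Z \<open>N \<subseteq> Z\<close>] by simp
qed

subsection \<open>The ring as a module over itself\<close>

lemma ring_module_simps [simp]:
  "carrier (ring_module R) = carrier R" "add (ring_module R) = add R"
  "\<zero>\<^bsub>ring_module R\<^esub> = \<zero>\<^bsub>R\<^esub>" "smult (ring_module R) = mult R"
  by (simp_all add: ring_module_def)

lemma ring_module_set_add [simp]: "set_add (ring_module R) = set_add R"
  by (intro ext) (auto simp: set_add_def')

lemma ring_module_coset [simp]: "a_r_coset (ring_module R) = a_r_coset R"
  by (intro ext) (auto simp: a_r_coset_def')

context cring
begin

lemma ring_module_module: "module R (ring_module R)"
proof (rule moduleI)
  show "cring R" by (rule cring_axioms)
  show "abelian_group (ring_module R)"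
    by (rule abelian_groupI) (auto simp: a_ac intro: add.inv_closed l_neg)
qed (auto simp: l_distr r_distr m_assoc)

sublocale self: module R "ring_module R" by (rule ring_module_module)

abbreviation ring_length where "ring_length \<equiv> rel_length R (ring_module R)"

lemma self_minus [simp]: "x \<in> carrier R \<Longrightarrow> \<ominus>\<^bsub>ring_module R\<^esub> x = \<ominus> x"
  using self.M.minus_equality[of "\<ominus> x" x] by (simp add: l_neg)

lemma self_a_minus [simp]: "y \<in> carrier R \<Longrightarrow> x \<ominus>\<^bsub>ring_module R\<^esub> y = x \<ominus> y"
  by (simp add: a_minus_def)

lemma submodule_ring_module_iff: "submodule J R (ring_module R) \<longleftrightarrow> ideal J R"
proof
  assume J: "submodule J R (ring_module R)"
  note j = self.submodule_simps[OF J]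
  show "ideal J R"
  proof (rule idealI)
    show "ring R" by (rule ring_axioms)
    show "subgroup J (add_monoid R)"
      by (rule subgroup.intro) (use j in \<open>auto simp: a_inv_def[symmetric] simp flip: self_minus\<close>)
    show "x \<otimes> a \<in> J" if "a \<in> J" "x \<in> carrier R" for a x
      using j(5)[OF that(2,1)] by simp
    then show "a \<otimes> x \<in> J" if "a \<in> J" "x \<in> carrier R" for a x
      using that j(2)[OF that(1)] by (simp add: m_comm[of a x])
  qed
next
  assume "ideal J R"
  then interpret ideal J R .
  show "submodule J R (ring_module R)"
    by (rule self.submoduleI) (auto simp: I_l_closed)
qed

end

subsection \<open>Direct sums\<close>

lemma direct_sum_module_simps:
  "carrier (direct_sum_module S M) = (\<Pi>\<^sub>E p\<in>S. carrier (M p))"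
  "\<zero>\<^bsub>direct_sum_module S M\<^esub> = (\<lambda>p\<in>S. \<zero>\<^bsub>M p\<^esub>)"
  "f \<oplus>\<^bsub>direct_sum_module S M\<^esub> g = (\<lambda>p\<in>S. f p \<oplus>\<^bsub>M p\<^esub> g p)"
  "r \<odot>\<^bsub>direct_sum_module S M\<^esub> f = (\<lambda>p\<in>S. r \<odot>\<^bsub>M p\<^esub> f p)"
  by (simp_all add: direct_sum_module_def)

locale module_family = cring R for R :: "('a, 'b) ring_scheme" (structure) and S :: "'i set" and M :: "'i \<Rightarrow> ('a, 'c) module" +
  assumes module_M: "p \<in> S \<Longrightarrow> module R (M p)"
begin

abbreviation DS where "DS \<equiv> direct_sum_module S M"

lemma direct_sum_is_module: "module R DS"
proof (rule moduleI)
  note [simp] = direct_sum_module_simps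
  have a: "abelian_group (M p)" if "p \<in> S" for p
    using module_M[OF that] by (simp add: module_def)
  have m: "abelian_monoid (M p)" if "p \<in> S" for p
    using a[OF that] by (simp add: abelian_group_def)
  have mem: "x p \<in> carrier (M p)" if "x \<in> carrier DS" "p \<in> S" for x p
    using that by (auto simp: PiE_iff)
  have ext: "(\<lambda>p\<in>S. x p) = x" if "x \<in> carrier DS" for x
    using that by (auto simp: PiE_restrict)
  show "cring R" by (rule cring_axioms)
  show "abelian_group DS"
  proof (rule abelian_groupI)
    fix x assume x: "x \<in> carrier DS"
    show "\<exists>y\<in>carrier DS. y \<oplus>\<^bsub>DS\<^esub> x = \<zero>\<^bsub>DS\<^esub>"
    proof (intro bexI)
      show "(\<lambda>p\<in>S. \<ominus>\<^bsub>M p\<^esub> x p) \<oplus>\<^bsub>DS\<^esub> x = \<zero>\<^bsub>DS\<^esub>"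
        using mem[OF x] by (auto intro!: restrict_ext simp: abelian_group.l_neg[OF a])
      show "(\<lambda>p\<in>S. \<ominus>\<^bsub>M p\<^esub> x p) \<in> carrier DS"
        using mem[OF x] by (auto simp: abelian_group.a_inv_closed[OF a])
    qed
    have "\<zero>\<^bsub>DS\<^esub> \<oplus>\<^bsub>DS\<^esub> x = (\<lambda>p\<in>S. x p)"
      unfolding direct_sum_module_simps
      by (rule restrict_ext) (simp add: abelian_monoid.l_zero[OF m] mem[OF x])
    then show "\<zero>\<^bsub>DS\<^esub> \<oplus>\<^bsub>DS\<^esub> x = x"
      using ext[OF x] by (rule trans)
    fix y assume y: "y \<in> carrier DS"
    show "x \<oplus>\<^bsub>DS\<^esub> y \<in> carrier DS"
      using mem[OF x] mem[OF y] by (auto simp: abelian_monoid.a_closed[OF m])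
    show "x \<oplus>\<^bsub>DS\<^esub> y = y \<oplus>\<^bsub>DS\<^esub> x"
      unfolding direct_sum_module_simps
      by (rule restrict_ext) (rule abelian_monoid.a_comm[OF m mem[OF x] mem[OF y]])
    fix z assume z: "z \<in> carrier DS"
    show "(x \<oplus>\<^bsub>DS\<^esub> y) \<oplus>\<^bsub>DS\<^esub> z =
        x \<oplus>\<^bsub>DS\<^esub> (y \<oplus>\<^bsub>DS\<^esub> z)"
      unfolding direct_sum_module_simps
      by (rule restrict_ext) (simp add: abelian_monoid.a_assoc[OF m] mem[OF x] mem[OF y] mem[OF z])
  qed (auto simp: abelian_monoid.zero_closed[OF m])
  fix x assume x: "x \<in> carrier DS"
  have "\<one> \<odot>\<^bsub>DS\<^esub> x = (\<lambda>p\<in>S. x p)"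
    unfolding direct_sum_module_simps
    by (rule restrict_ext) (simp add: module.smult_one[OF module_M] mem[OF x])
  then show "\<one> \<odot>\<^bsub>DS\<^esub> x = x" using ext[OF x] by (rule trans)
  fix r assume r: "r \<in> carrier R"
  show "r \<odot>\<^bsub>DS\<^esub> x \<in> carrier DS"
    using mem[OF x] r by (auto simp: module.smult_closed[OF module_M])
  show "r \<odot>\<^bsub>DS\<^esub> (x \<oplus>\<^bsub>DS\<^esub> y) =
      r \<odot>\<^bsub>DS\<^esub> x \<oplus>\<^bsub>DS\<^esub> r \<odot>\<^bsub>DS\<^esub> y"
    if y: "y \<in> carrier DS" for y
    unfolding direct_sum_module_simps
    by (rule restrict_ext) (simp add: module.smult_r_distr[OF module_M] mem[OF x] mem[OF y] r)
  fix s assume s: "s \<in> carrier R"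
  show "(r \<oplus> s) \<odot>\<^bsub>DS\<^esub> x =
      r \<odot>\<^bsub>DS\<^esub> x \<oplus>\<^bsub>DS\<^esub> s \<odot>\<^bsub>DS\<^esub> x"
    unfolding direct_sum_module_simps
    by (rule restrict_ext) (simp add: module.smult_l_distr[OF module_M] mem[OF x] r s)
  show "(r \<otimes> s) \<odot>\<^bsub>DS\<^esub> x = r \<odot>\<^bsub>DS\<^esub> (s \<odot>\<^bsub>DS\<^esub> x)"
    unfolding direct_sum_module_simps
    by (rule restrict_ext) (simp add: module.smult_assoc1[OF module_M] mem[OF x] r s)
qed

sublocale sum: module R "DS" by (rule direct_sum_is_module)

lemma module_hom_component:
  assumes "p \<in> S"
  shows "module_hom R DS (M p) (\<lambda>w. w p)"
proof -
  interpret p: module R "M p" by (rule module_M[OF assms])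
  show ?thesis
    by unfold_locales (use assms in \<open>auto simp: direct_sum_module_simps\<close>)
qed

lemma direct_sum_submodule:
  assumes F: "\<And>p. p \<in> S \<Longrightarrow> submodule (F p) R (M p)"
  shows "submodule (\<Pi>\<^sub>E p\<in>S. F p) R DS"
proof (rule sum.submoduleI_smult)
  note f = module.submodule_simps[OF module_M F]
  show "(\<Pi>\<^sub>E p\<in>S. F p) \<subseteq> carrier DS"
    using f(2) by (auto simp: direct_sum_module_simps PiE_iff)
qed (use module.submodule_simps[OF module_M F] in \<open>auto simp: direct_sum_module_simps PiE_mem\<close>)

text \<open>The components are enlarged one at a time: \<open>X T\<close> has the full module at the
  indices in \<open>T\<close> and \<open>F p\<close> elsewhere. The component at a new
  \<open>p\<close> maps \<open>X (insert p T)\<close> onto \<open>M p\<close>, and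
  \<open>X T\<close> is the preimage of \<open>F p\<close>.\<close>

lemma rel_length_direct_sum:
  assumes fin: "finite S" and F: "\<And>p. p \<in> S \<Longrightarrow> submodule (F p) R (M p)"
  shows "rel_length R DS (\<Pi>\<^sub>E p\<in>S. F p) (carrier DS) =
    (\<Sum>p\<in>S. rel_length R (M p) (F p) (carrier (M p)))"
proof -
  define X where "X T = (\<Pi>\<^sub>E p\<in>S. if p \<in> T then carrier (M p) else F p)" for T
  have FC: "F p \<subseteq> carrier (M p)" if "p \<in> S" for p
    using module.submodule_simps(2)[OF module_M F] that by blast
  have X: "submodule (X T) R DS" for T
    unfolding X_def using F module_M
    by (intro direct_sum_submodule) (auto intro: module.carrier_is_submodule)
  have mono: "X T \<subseteq> X T'" if "T \<subseteq> T'" for T T'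
    unfolding X_def using that FC by (intro PiE_mono) auto
  have "rel_length R DS (X {}) (X T) =
      (\<Sum>p\<in>T. rel_length R (M p) (F p) (carrier (M p)))" if "T \<subseteq> S" for T
    using finite_subset[OF that fin] that
  proof (induction T rule: finite_induct)
    case empty
    then show ?case by (simp add: rel_length_eq_0_if_superset)
  next
    case (insert p T)
    have p: "p \<in> S" using insert by auto
    interpret p: module R "M p" by (rule module_M[OF p])
    interpret pr: module_hom R "DS" "M p" "\<lambda>w. w p"
      by (rule module_hom_component[OF p])
    have X_iff: "w \<in> X U \<longleftrightarrow>
        w \<in> extensional S \<and> (\<forall>q\<in>S. if q \<in> U then w q \<in> carrier (M q) else w q \<in> F q)" for w U
      by (auto simp: X_def PiE_iff)
    have 1: "{w \<in> X (insert p T). w p \<in> F p} = X T"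
    proof (intro Set.set_eqI iffI)
      fix w assume w: "w \<in> X T"
      then have "w \<in> X (insert p T)" using mono[of T "insert p T"] by blast
      moreover have "w p \<in> F p" using w p insert(2) unfolding X_iff by meson
      ultimately show "w \<in> {w \<in> X (insert p T). w p \<in> F p}" by simp
    next
      fix w assume "w \<in> {w \<in> X (insert p T). w p \<in> F p}"
      then show "w \<in> X T" unfolding mem_Collect_eq X_iff insert_iff using insert(2) by metis
    qed
    have 2: "(\<lambda>w. w p) ` X (insert p T) = carrier (M p)"
    proof
      show "(\<lambda>w. w p) ` X (insert p T) \<subseteq> carrier (M p)"
        using p by (auto simp: X_iff)
      show "carrier (M p) \<subseteq> (\<lambda>w. w p) ` X (insert p T)"
      proof
        fix x assume x: "x \<in> carrier (M p)"
        have "(\<lambda>q\<in>S. if q = p then x else \<zero>\<^bsub>M q\<^esub>) \<in> X (insert p T)"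
          using x module.submodule_simps(1)[OF module_M F] FC by (auto simp: X_iff)
        then show "x \<in> (\<lambda>w. w p) ` X (insert p T)"
          using p by (intro image_eqI[where x = "\<lambda>q\<in>S. if q = p then x else \<zero>\<^bsub>M q\<^esub>"]) auto
      qed
    qed
    have "F p <+>\<^bsub>M p\<^esub> carrier (M p) = carrier (M p)"
      using p.set_add_least[OF p.carrier_is_submodule FC[OF p] order_refl]
        p.set_add_upper(2)[OF F[OF p] p.carrier_is_submodule] by auto
    then have "rel_length R DS (X T) (X (insert p T)) =
        rel_length R (M p) (F p) (carrier (M p))"
      using pr.rel_length_vimage[OF F[OF p] X[of "insert p T"]] 1 2 by simp
    moreover have "rel_length R DS (X {}) (X (insert p T)) =
        rel_length R DS (X {}) (X T) +
        rel_length R DS (X T) (X (insert p T))"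
      by (intro sum.rel_length_add X mono) auto
    ultimately show ?case using insert by (simp add: add.commute)
  qed
  from this[of S] show ?thesis
    by (simp add: X_def direct_sum_module_simps cong: PiE_cong)
qed

end

text \<open>With all components equal to \<open>R\<close>, this is the projection of the Koszul
  complex onto its quotient.\<close>

lemma (in module_family) module_hom_direct_sum_proj:
  assumes F: "\<And>p. p \<in> S \<Longrightarrow> submodule (F p) R (M p)"
  shows "module_hom R DS (direct_sum_module S (\<lambda>p. quot_module (M p) (F p)))
    (\<lambda>w. \<lambda>p\<in>S. F p +>\<^bsub>M p\<^esub> w p)"
proof -
  have q: "module_quotient R (M p) (F p)" if "p \<in> S" for p
    using that F module_M by (simp add: module_quotient_def module_quotient_axioms_def)
  interpret Q: module_family R S "\<lambda>p. quot_module (M p) (F p)"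
  proof (rule module_family.intro[OF cring_axioms], rule module_family_axioms.intro)
    fix p assume "p \<in> S"
    then show "module R (quot_module (M p) (F p))" by (rule module_quotient.module_quot[OF q])
  qed
  show ?thesis
  proof (intro module_hom.intro module_hom_axioms.intro sum.module_axioms Q.sum.module_axioms)
    fix x assume x: "x \<in> carrier DS"
    have xp: "x p \<in> carrier (M p)" if "p \<in> S" for p
      using x that by (auto simp: direct_sum_module_simps)
    show "(\<lambda>p\<in>S. F p +>\<^bsub>M p\<^esub> x p) \<in> carrier (direct_sum_module S (\<lambda>p. quot_module (M p) (F p)))"
      using xp by (auto simp: direct_sum_module_simps module_quotient.carrier_quot[OF q])
    show "(\<lambda>p\<in>S. F p +>\<^bsub>M p\<^esub> (r \<odot>\<^bsub>DS\<^esub> x) p) =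
        r \<odot>\<^bsub>direct_sum_module S (\<lambda>p. quot_module (M p) (F p))\<^esub> (\<lambda>p\<in>S. F p +>\<^bsub>M p\<^esub> x p)"
      if r: "r \<in> carrier R" for r
      unfolding direct_sum_module_simps
      by (rule restrict_ext) (simp add: module_quotient.smult_quot[OF q] xp r)
    fix y assume y: "y \<in> carrier DS"
    have yp: "y p \<in> carrier (M p)" if "p \<in> S" for p
      using y that by (auto simp: direct_sum_module_simps)
    show "(\<lambda>p\<in>S. F p +>\<^bsub>M p\<^esub> (x \<oplus>\<^bsub>DS\<^esub> y) p) =
        (\<lambda>p\<in>S. F p +>\<^bsub>M p\<^esub> x p) \<oplus>\<^bsub>direct_sum_module S (\<lambda>p. quot_module (M p) (F p))\<^esub>
        (\<lambda>p\<in>S. F p +>\<^bsub>M p\<^esub> y p)"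
      unfolding direct_sum_module_simps
      by (rule restrict_ext) (simp add: module_quotient.add_quot[OF q] xp yp)
  qed
qed

section \<open>The Koszul complex\<close>

text \<open>By induction on \<open>A\<close>: the row and the column of the new index cancel term by
  term. The diagonal is left out, since \<open>g s s \<oplus> g s s = \<zero>\<close> would not make
  \<open>g s s\<close> vanish. This is the cancellation in the square of the Koszul
  differential.\<close>

lemma (in abelian_group) finsum_antisymmetric:
  assumes "finite A"
    and "\<And>s t. s \<in> A \<Longrightarrow> t \<in> A \<Longrightarrow> s \<noteq> t \<Longrightarrow> g s t \<in> carrier G"
    and "\<And>s t. s \<in> A \<Longrightarrow> t \<in> A \<Longrightarrow> s \<noteq> t \<Longrightarrow> g s t \<oplus> g t s = \<zero>"
  shows "(\<Oplus>s\<in>A. \<Oplus>t\<in>A - {s}. g s t) = \<zero>"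
  using assms
proof (induction A rule: finite_induct)
  case (insert a A)
  have cl: "g s t \<in> carrier G" if "s \<in> insert a A" "t \<in> insert a A" "s \<noteq> t" for s t
    using insert.prems(1) that by blast
  have cla: "g s a \<in> carrier G" "g a s \<in> carrier G" if "s \<in> A" for s
    using that insert.hyps(2) by (auto intro!: cl)
  have inner: "(\<Oplus>t\<in>insert a A - {s}. g s t) = g s a \<oplus> (\<Oplus>t\<in>A - {s}. g s t)" if "s \<in> A" for s
  proof -
    have "insert a A - {s} = insert a (A - {s})" using that insert.hyps(2) by blast
    moreover have "finite (A - {s})" "a \<notin> A - {s}" using insert.hyps by simp_all
    moreover have "g s \<in> A - {s} \<rightarrow> carrier G" by (rule Pi_I) (use that cl in blast)
    moreover have "g s a \<in> carrier G" using that cl insert.hyps(2) by blast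
    ultimately show ?thesis by (simp add: finsum_insert)
  qed
  have sub: "(\<Oplus>t\<in>A - {s}. g s t) \<in> carrier G" if "s \<in> A" for s
    using that cl by (intro finsum_closed) auto
  have "(\<Oplus>s\<in>insert a A. \<Oplus>t\<in>insert a A - {s}. g s t) =
      (\<Oplus>t\<in>A. g a t) \<oplus> (\<Oplus>s\<in>A. \<Oplus>t\<in>insert a A - {s}. g s t)"
  proof -
    have "insert a A - {a} = A" using insert.hyps(2) by blast
    moreover have "(\<lambda>s. \<Oplus>t\<in>insert a A - {s}. g s t) \<in> A \<rightarrow> carrier G"
      by (intro Pi_I finsum_closed) (use cl in auto)
    moreover have "(\<Oplus>t\<in>A. g a t) \<in> carrier G"
      by (intro Pi_I finsum_closed) (use cl insert.hyps in blast)
    ultimately show ?thesis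
      using finsum_insert[of A a "\<lambda>s. \<Oplus>t\<in>insert a A - {s}. g s t"] insert.hyps by simp
  qed
  also have "(\<Oplus>s\<in>A. \<Oplus>t\<in>insert a A - {s}. g s t) = (\<Oplus>s\<in>A. g s a \<oplus> (\<Oplus>t\<in>A - {s}. g s t))"
    by (rule finsum_cong') (simp_all add: inner sub cla Pi_iff)
  also have "\<dots> = (\<Oplus>s\<in>A. g s a) \<oplus> (\<Oplus>s\<in>A. \<Oplus>t\<in>A - {s}. g s t)"
    by (rule finsum_addf) (simp_all add: sub cla Pi_iff)
  also have "(\<Oplus>s\<in>A. \<Oplus>t\<in>A - {s}. g s t) = \<zero>"
    using insert.prems by (intro insert.IH) auto
  also have "(\<Oplus>t\<in>A. g a t) \<oplus> ((\<Oplus>s\<in>A. g s a) \<oplus> \<zero>) = (\<Oplus>t\<in>A. g a t \<oplus> g t a)"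
    by (subst finsum_addf) (simp_all add: cla Pi_iff)
  also have "\<dots> = (\<Oplus>t\<in>A. \<zero>)"
    using insert.prems(2) insert.hyps by (intro finsum_cong') auto
  finally show ?case by simp
qed simp

lemma (in ideal) finsum_mem:
  assumes "finite A" "\<And>s. s \<in> A \<Longrightarrow> f s \<in> I"
  shows "(\<Oplus>s\<in>A. f s) \<in> I"
  using assms
proof (induction A rule: finite_induct)
  case (insert a A)
  then have "f \<in> A \<rightarrow> carrier R" "f a \<in> carrier R" by auto
  with insert show ?case by simp
qed simp

text \<open>Source of the Koszul signs: an index inserted below \<open>x\<close> moves the position
  of \<open>x\<close> by one.\<close>

lemma card_less_insert:
  assumes "finite U" "s \<notin> U"
  shows "card {t \<in> insert s U. t < x} = card {t \<in> U. t < x} + (if s < x then 1 else 0)"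
proof -
  have "{t \<in> insert s U. t < x} = (if s < x then insert s {t \<in> U. t < x} else {t \<in> U. t < x})"
    by auto
  then show ?thesis using assms by simp
qed

context ring
begin

definition sign :: "nat \<Rightarrow> 'a" where "sign k = (\<ominus> \<one>) [^] k"

lemma sign_closed [simp]: "sign k \<in> carrier R"
  by (simp add: sign_def)

lemma sign_0 [simp]: "sign 0 = \<one>"
  by (simp add: sign_def)

lemma sign_Suc [simp]: "sign (Suc k) = \<ominus> sign k"
  by (simp add: sign_def r_minus)

lemma sign_square: "sign k \<otimes> sign k = \<one>"
  by (induction k) (simp_all add: l_minus r_minus)

end

section \<open>Ideals generated by one further element\<close>

context cring
begin

lemma mem_set_add_iff: "x \<in> A <+>\<^bsub>R\<^esub> B \<longleftrightarrow> (\<exists>a\<in>A. \<exists>b\<in>B. x = a \<oplus> b)"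
  by (auto simp: set_add_def')

text \<open>For an ideal \<open>J\<close> this is the sum of \<open>J\<close> and the principal
  ideal of \<open>y\<close>, written so that membership hands over the coefficient \<open>r\<close>
  of \<open>y\<close>.\<close>

definition adjoin :: "'a set \<Rightarrow> 'a \<Rightarrow> 'a set" where
  "adjoin J y = {a \<in> carrier R. \<exists>r\<in>carrier R. a \<ominus> y \<otimes> r \<in> J}"

lemma adjoin_eq_set_add:
  assumes J: "ideal J R" and y: "y \<in> carrier R"
  shows "adjoin J y = J <+>\<^bsub>R\<^esub> (\<lambda>r. y \<otimes> r) ` carrier R"
proof (intro Set.set_eqI iffI)
  fix a assume "a \<in> J <+>\<^bsub>R\<^esub> (\<lambda>r. y \<otimes> r) ` carrier R"
  then obtain b r where br: "b \<in> J" "r \<in> carrier R" "a = b \<oplus> y \<otimes> r" by (auto simp: mem_set_add_iff)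
  have bc: "b \<in> carrier R" using ideal.Icarr[OF J br(1)] .
  have "a \<ominus> y \<otimes> r = b" using br bc y by algebra
  then have "a \<ominus> y \<otimes> r \<in> J" "a \<in> carrier R" using br bc y by simp_all
  then show "a \<in> adjoin J y" using br(2) unfolding adjoin_def by blast
next
  fix a assume "a \<in> adjoin J y"
  then obtain r where r: "a \<in> carrier R" "r \<in> carrier R" "a \<ominus> y \<otimes> r \<in> J" unfolding adjoin_def by blast
  have "a = (a \<ominus> y \<otimes> r) \<oplus> y \<otimes> r" using r(1,2) y by algebra
  then show "a \<in> J <+>\<^bsub>R\<^esub> (\<lambda>r. y \<otimes> r) ` carrier R" using r(2,3) unfolding mem_set_add_iff by blast
qed

lemma mult_hom: "y \<in> carrier R \<Longrightarrow> module_hom R (ring_module R) (ring_module R) (\<lambda>r. y \<otimes> r)"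
  by (intro module_hom.intro module_hom_axioms.intro ring_module_module)
    (simp_all add: r_distr m_lcomm)

lemma ideal_adjoin:
  assumes J: "ideal J R" and y: "y \<in> carrier R"
  shows "ideal (adjoin J y) R"
  using module_hom.submodule_image[OF mult_hom[OF y] self.carrier_is_submodule] add_ideals[OF J]
  by (simp add: adjoin_eq_set_add[OF J y] submodule_ring_module_iff)

lemma adjoin_superset:
  assumes J: "ideal J R" and y: "y \<in> carrier R"
  shows "J \<subseteq> adjoin J y"
proof
  fix a assume a: "a \<in> J"
  then have "a \<in> carrier R" using ideal.Icarr[OF J] by simp
  then show "a \<in> adjoin J y" using a y by (auto simp: adjoin_def a_minus_def intro!: bexI[of _ \<zero>])
qed

lemma adjoin_self:
  assumes J: "ideal J R" and y: "y \<in> carrier R"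
  shows "y \<in> adjoin J y"
proof -
  have "y \<ominus> y \<otimes> \<one> \<in> J"
    using y additive_subgroup.zero_closed[OF ideal.axioms(1)[OF J]] by (simp add: a_minus_def r_neg)
  then show ?thesis using y unfolding adjoin_def by blast
qed

lemma adjoin_least:
  assumes L: "ideal L R" and "J \<subseteq> L" "y \<in> L"
  shows "adjoin J y \<subseteq> L"
proof
  interpret L: ideal L R by (rule L)
  fix a assume "a \<in> adjoin J y"
  then obtain r where r: "a \<in> carrier R" "r \<in> carrier R" "a \<ominus> y \<otimes> r \<in> J" by (auto simp: adjoin_def)
  have yc: "y \<in> carrier R" using \<open>y \<in> L\<close> by simp
  have "(a \<ominus> y \<otimes> r) \<oplus> y \<otimes> r \<in> L" using r assms by (auto intro: L.I_r_closed)
  moreover have "(a \<ominus> y \<otimes> r) \<oplus> y \<otimes> r = a" using r yc by algebra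
  ultimately show "a \<in> L" by simp
qed

lemma genideal_insert:
  assumes A: "A \<subseteq> carrier R" and y: "y \<in> carrier R"
  shows "Idl (insert y A) = adjoin (Idl A) y"
proof
  have iA: "ideal (Idl A) R" using A by (rule genideal_ideal)
  show "Idl (insert y A) \<subseteq> adjoin (Idl A) y"
    using adjoin_superset[OF iA y] adjoin_self[OF iA y] genideal_self[OF A]
    by (intro genideal_minimal ideal_adjoin iA y) blast
  have yA: "insert y A \<subseteq> carrier R" using A y by blast
  show "adjoin (Idl A) y \<subseteq> Idl (insert y A)"
    using genideal_self[OF yA] by (intro adjoin_least genideal_minimal genideal_ideal yA) auto
qed

lemma genideal_empty: "Idl {} = {\<zero>}"
  using genideal_minimal[OF zeroideal, of "{}"] additive_subgroup.zero_closed[OF ideal.axioms(1)[OF genideal_ideal]]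
  by blast

end

section \<open>Koszul chains and the differential\<close>

locale koszul = cring R for R (structure) +
  fixes ys :: "'a list"
  assumes ys_closed: "set ys \<subseteq> carrier R"
begin

abbreviation \<delta> :: "(nat set \<Rightarrow> 'a) \<Rightarrow> nat set \<Rightarrow> 'a" where
  "\<delta> \<equiv> koszul_diff R ys"

text \<open>Coefficients of all degrees are collected in one function. Nothing is asked at sets
  outside the index range, so identities between chains in this locale are stated on subsets of
  \<open>{..<length ys}\<close>.\<close>

definition chain :: "(nat set \<Rightarrow> 'a) \<Rightarrow> bool" where
  "chain w \<longleftrightarrow> (\<forall>S. S \<subseteq> {..<length ys} \<longrightarrow> w S \<in> carrier R)"

lemma chainD [simp]: "chain w \<Longrightarrow> S \<subseteq> {..<length ys} \<Longrightarrow> w S \<in> carrier R"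
  by (simp add: chain_def)

lemma ys_nth [simp]: "s < length ys \<Longrightarrow> ys ! s \<in> carrier R"
  using ys_closed by (auto simp: subset_iff)

lemma koszul_diff_eq:
  "\<delta> w T = (\<Oplus>s\<in>{..<length ys} - T. sign (card {t \<in> T. t < s}) \<otimes> (ys ! s \<otimes> w (insert s T)))"
  by (simp add: koszul_diff_def sign_def)

lemma koszul_diff_closed [simp]:
  "chain w \<Longrightarrow> T \<subseteq> {..<length ys} \<Longrightarrow> \<delta> w T \<in> carrier R"
  unfolding koszul_diff_eq by (intro finsum_closed) auto

lemma chain_koszul_diff [simp]: "chain w \<Longrightarrow> chain (\<delta> w)"
  by (simp add: chain_def[of "\<delta> w"])

lemma koszul_diff_cong:
  assumes "chain v" "T \<subseteq> {..<length ys}"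
    and "\<And>s. s < length ys \<Longrightarrow> s \<notin> T \<Longrightarrow> w (insert s T) = v (insert s T)"
  shows "\<delta> w T = \<delta> v T"
  unfolding koszul_diff_eq using assms by (intro finsum_cong') auto

lemma koszul_diff_add:
  assumes "chain v" "chain w" "T \<subseteq> {..<length ys}"
  shows "\<delta> (\<lambda>S. v S \<oplus> w S) T = \<delta> v T \<oplus> \<delta> w T"
proof -
  have "\<delta> (\<lambda>S. v S \<oplus> w S) T = (\<Oplus>s\<in>{..<length ys} - T.
      sign (card {t \<in> T. t < s}) \<otimes> (ys ! s \<otimes> v (insert s T)) \<oplus>
      sign (card {t \<in> T. t < s}) \<otimes> (ys ! s \<otimes> w (insert s T)))"
    unfolding koszul_diff_eq using assms by (intro finsum_cong') (auto simp: r_distr)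
  then show ?thesis
    unfolding koszul_diff_eq using assms by (subst (asm) finsum_addf) auto
qed

lemma koszul_diff_smult:
  assumes "chain w" "r \<in> carrier R" "T \<subseteq> {..<length ys}"
  shows "\<delta> (\<lambda>S. r \<otimes> w S) T = r \<otimes> \<delta> w T"
proof -
  have "\<delta> (\<lambda>S. r \<otimes> w S) T = (\<Oplus>s\<in>{..<length ys} - T.
      r \<otimes> (sign (card {t \<in> T. t < s}) \<otimes> (ys ! s \<otimes> w (insert s T))))"
    unfolding koszul_diff_eq using assms by (intro finsum_cong') (auto simp: m_ac)
  then show ?thesis
    unfolding koszul_diff_eq using assms by (subst finsum_rdistr) auto
qed

lemma koszul_diff_minus:
  assumes "chain v" "chain w" "T \<subseteq> {..<length ys}"
  shows "\<delta> (\<lambda>S. v S \<ominus> w S) T = \<delta> v T \<ominus> \<delta> w T"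
proof -
  have w: "chain (\<lambda>S. \<ominus> \<one> \<otimes> w S)" using assms by (simp add: chain_def)
  have "\<delta> (\<lambda>S. v S \<ominus> w S) T = \<delta> (\<lambda>S. v S \<oplus> \<ominus> \<one> \<otimes> w S) T"
    using assms by (intro koszul_diff_cong) (auto simp: chain_def a_minus_def l_minus)
  also have "\<dots> = \<delta> v T \<ominus> \<delta> w T"
    using assms w by (simp add: koszul_diff_add koszul_diff_smult l_minus a_minus_def)
  finally show ?thesis .
qed

text \<open>Adjoining \<open>s\<close> and \<open>t\<close> in either order leads to the same
  coefficient of \<open>w\<close>, but exactly one of the two indices has its position shifted by
  the other, so the two terms have opposite signs.\<close>

lemma koszul_diff_koszul_diff:
  assumes w: "chain w" and U: "U \<subseteq> {..<length ys}"
  shows "\<delta> (\<delta> w) U = \<zero>"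
proof -
  let ?A = "{..<length ys} - U"
  have fU: "finite U" using U finite_subset by blast
  define c where "c s = card {t \<in> U. t < s}" for s
  define g where "g s t = sign (c s) \<otimes> (ys ! s \<otimes> (sign (card {u \<in> insert s U. u < t}) \<otimes>
      (ys ! t \<otimes> w (insert t (insert s U)))))" for s t
  have g: "g s t \<in> carrier R" if "s \<in> ?A" "t \<in> ?A" for s t
    using that w U by (auto simp: g_def)
  have "\<delta> (\<delta> w) U = (\<Oplus>s\<in>?A. \<Oplus>t\<in>?A - {s}. g s t)"
    unfolding koszul_diff_eq[of "\<delta> w"]
  proof (rule finsum_cong', goal_cases)
    case 2
    then show ?case using g by (auto intro!: finsum_closed)
  next
    case (3 s)
    have A: "{..<length ys} - insert s U = ?A - {s}" by auto
    have "sign (c s) \<otimes> (ys ! s \<otimes> \<delta> w (insert s U)) = (\<Oplus>t\<in>?A - {s}. g s t)"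
      unfolding koszul_diff_eq A g_def using 3 w U
      by (subst finsum_rdistr, force, force, force)+ (intro finsum_cong', auto)
    then show ?case by (simp add: c_def)
  qed simp
  also have "\<dots> = \<zero>"
  proof (rule finsum_antisymmetric)
    fix s t assume st: "s \<in> ?A" "t \<in> ?A" "s \<noteq> t"
    define x where "x = sign (c s) \<otimes> (sign (c t) \<otimes> (ys ! s \<otimes> (ys ! t \<otimes> w (insert t (insert s U)))))"
    have xc: "x \<in> carrier R" using st w U by (auto simp: x_def)
    have cl: "ys ! s \<in> carrier R" "ys ! t \<in> carrier R" "w (insert t (insert s U)) \<in> carrier R"
      using st w U by auto
    have c: "card {u \<in> insert s U. u < t} = c t + (if s < t then 1 else 0)"
      "card {u \<in> insert t U. u < s} = c s + (if t < s then 1 else 0)"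
      using st card_less_insert[OF fU] unfolding c_def by blast+
    have "g s t = (if s < t then \<ominus> x else x)"
      unfolding g_def x_def c using cl by (simp add: l_minus r_minus m_ac)
    moreover have "g t s = (if t < s then \<ominus> x else x)"
      unfolding g_def x_def c insert_commute[of s t] using cl
      by (simp add: l_minus r_minus m_ac insert_commute)
    ultimately show "g s t \<oplus> g t s = \<zero>" using st(3) xc by (auto simp: l_neg r_neg)
  qed (use g in auto)
  finally show ?thesis .
qed

text \<open>The coefficients of the exterior product of the basis vector of index \<open>j\<close>
  with \<open>w\<close>; the sign moves that vector to its place in \<open>S\<close>.\<close>

definition homotopy :: "nat \<Rightarrow> (nat set \<Rightarrow> 'a) \<Rightarrow> nat set \<Rightarrow> 'a" where
  "homotopy j w S = (if j \<in> S then sign (card {t \<in> S. t < j}) \<otimes> w (S - {j}) else \<zero>)"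

lemma chain_homotopy [simp]: "chain w \<Longrightarrow> chain (homotopy j w)"
proof -
  assume w: "chain w"
  have "homotopy j w S \<in> carrier R" if "S \<subseteq> {..<length ys}" for S
  proof -
    have "S - {j} \<subseteq> {..<length ys}" using that by blast
    then show ?thesis using w by (simp add: homotopy_def)
  qed
  then show ?thesis by (simp add: chain_def)
qed

text \<open>If \<open>j \<notin> T\<close>, only the summand \<open>s = j\<close> of the
  differential survives, with its sign squared. If \<open>j \<in> T\<close>, the differential of
  \<open>w\<close> at \<open>T - {j}\<close> contributes the right-hand side through its summand
  \<open>s = j\<close>, and its remaining summands cancel against the first term.\<close>

lemma koszul_homotopy:
  assumes w: "chain w" and j: "j < length ys" and T: "T \<subseteq> {..<length ys}"
  shows "\<delta> (homotopy j w) T \<oplus> homotopy j (\<delta> w) T = ys ! j \<otimes> w T"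
proof (cases "j \<in> T")
  case False
  have fT: "finite T" using T finite_subset by blast
  have "\<delta> (homotopy j w) T = (\<Oplus>s\<in>{..<length ys} - T. if j = s then ys ! s \<otimes> w T else \<zero>)"
    unfolding koszul_diff_eq
  proof (rule finsum_cong', goal_cases)
    case (3 s)
    show ?case
    proof (cases "j = s")
      case True
      have cl: "ys ! s \<in> carrier R" "w T \<in> carrier R" using 3 w T by auto
      have "{t \<in> insert s T. t < s} = {t \<in> T. t < s}" "insert s T - {s} = T" using 3 by auto
      then have "sign (card {t \<in> T. t < s}) \<otimes> (ys ! s \<otimes> homotopy j w (insert s T)) =
          (sign (card {t \<in> T. t < s}) \<otimes> sign (card {t \<in> T. t < s})) \<otimes> (ys ! s \<otimes> w T)"
        using True cl by (simp add: homotopy_def m_ac)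
      then show ?thesis using True cl by (simp add: sign_square)
    next
      case neq: False
      then have "homotopy j w (insert s T) = \<zero>" using False by (simp add: homotopy_def)
      then show ?thesis using neq 3 by simp
    qed
  qed (use w T in auto)
  also have "\<dots> = ys ! j \<otimes> w T"
    using finsum_singleton[of j "{..<length ys} - T" "\<lambda>s. ys ! s \<otimes> w T"] False j w T by auto
  finally show ?thesis using False w T j by (simp add: homotopy_def)
next
  case True
  define U where "U = T - {j}"
  have U: "j \<notin> U" "T = insert j U" "U \<subseteq> {..<length ys}" "finite U"
    using True T finite_subset by (auto simp: U_def)
  let ?B = "{..<length ys} - T"
  have B: "{..<length ys} - U = insert j ?B" "j \<notin> ?B" "finite ?B" using U j by auto
  have cj: "{t \<in> T. t < j} = {t \<in> U. t < j}" using U by auto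
  define e where "e s = sign (card {t \<in> U. t < j}) \<otimes> (sign (card {t \<in> U. t < s}) \<otimes> (ys ! s \<otimes> w (insert s U)))" for s
  have e: "e s \<in> carrier R" if "s < length ys" for s
    using that w U by (auto simp: e_def)
  have "homotopy j (\<delta> w) T = sign (card {t \<in> U. t < j}) \<otimes> \<delta> w U"
    using True cj by (simp add: homotopy_def U_def)
  also have "\<dots> = (\<Oplus>s\<in>insert j ?B. e s)"
  proof -
    have "(\<lambda>s. sign (card {t \<in> U. t < s}) \<otimes> (ys ! s \<otimes> w (insert s U))) \<in> insert j ?B \<rightarrow> carrier R"
      by (rule Pi_I) (use w U(3) j in auto)
    then show ?thesis
      unfolding koszul_diff_eq e_def B(1) by (intro finsum_rdistr) simp_all
  qed
  also have "\<dots> = e j \<oplus> (\<Oplus>s\<in>?B. e s)"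
    using B e j by (intro finsum_insert) auto
  also have "e j = ys ! j \<otimes> w T"
  proof -
    have "e j = (sign (card {t \<in> U. t < j}) \<otimes> sign (card {t \<in> U. t < j})) \<otimes> (ys ! j \<otimes> w (insert j U))"
      using w U j by (simp add: e_def m_assoc)
    then show ?thesis using w U(2) T j by (simp add: sign_square)
  qed
  finally have 1: "homotopy j (\<delta> w) T = ys ! j \<otimes> w T \<oplus> (\<Oplus>s\<in>?B. e s)" .
  have "\<delta> (homotopy j w) T = (\<Oplus>s\<in>?B. \<ominus> \<one> \<otimes> e s)"
    unfolding koszul_diff_eq
  proof (rule finsum_cong', goal_cases)
    case (3 s)
    then have s: "s < length ys" "s \<noteq> j" "s \<notin> U" using U by auto
    have "{t \<in> insert s T. t < j} = {t \<in> insert s U. t < j}" "insert s T - {j} = insert s U"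
      using U s by auto
    then have "homotopy j w (insert s T) = sign (card {t \<in> insert s U. t < j}) \<otimes> w (insert s U)"
      using True by (simp add: homotopy_def)
    moreover have "card {t \<in> insert s U. t < j} = card {t \<in> U. t < j} + (if s < j then 1 else 0)"
      "card {t \<in> T. t < s} = card {t \<in> U. t < s} + (if j < s then 1 else 0)"
      unfolding U(2) using s U card_less_insert by blast+
    moreover have "ys ! s \<in> carrier R" "w (insert s U) \<in> carrier R" using s U w by auto
    ultimately show ?case
      unfolding e_def using s(2) by (simp add: l_minus r_minus m_ac)
  qed (use e in auto)
  also have "\<dots> = \<ominus> \<one> \<otimes> (\<Oplus>s\<in>?B. e s)"
    using e by (intro finsum_rdistr[symmetric]) auto
  finally have 2: "\<delta> (homotopy j w) T = \<ominus> (\<Oplus>s\<in>?B. e s)"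
    using e by (simp add: l_minus finsum_closed Pi_iff)
  have c: "(\<Oplus>s\<in>?B. e s) \<in> carrier R" "ys ! j \<otimes> w T \<in> carrier R"
    using e w T j by (auto intro!: finsum_closed)
  show ?thesis unfolding 1 2 using c by (simp add: a_ac r_neg r_neg2 r_neg1)
qed

section \<open>Exactness in high degrees\<close>

definition above :: "nat \<Rightarrow> (nat set \<Rightarrow> 'a) \<Rightarrow> bool" where
  "above m w \<longleftrightarrow> (\<forall>S. S \<subseteq> {..<length ys} \<longrightarrow> card S < m \<longrightarrow> w S = \<zero>)"

text \<open>The homology of the Koszul complex with coefficients in \<open>R / J\<close> vanishes in all degrees
  \<open>\<ge> m\<close>; chains need not be homogeneous.\<close>

definition exact_above :: "'a set \<Rightarrow> nat \<Rightarrow> bool" where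
  "exact_above J m \<longleftrightarrow>
    (\<forall>z. chain z \<longrightarrow> above m z \<longrightarrow> (\<forall>T\<subseteq>{..<length ys}. \<delta> z T \<in> J) \<longrightarrow>
      (\<exists>u. chain u \<and> above (Suc m) u \<and> (\<forall>S\<subseteq>{..<length ys}. z S \<ominus> \<delta> u S \<in> J)))"

lemma koszul_diff_zero: "T \<subseteq> {..<length ys} \<Longrightarrow> \<delta> (\<lambda>_. \<zero>) T = \<zero>"
  using koszul_diff_smult[of "\<lambda>_. \<zero>" \<zero> T] by (simp add: chain_def)

text \<open>Start of a descending induction: no index set has more than \<open>length ys\<close>
  elements, so such a chain is zero and is the boundary of zero.\<close>

lemma exact_above_length:
  assumes "ideal J R"
  shows "exact_above J (Suc (length ys))"
  unfolding exact_above_def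
proof (intro allI impI)
  interpret J: ideal J R by fact
  fix z assume z: "chain z" "above (Suc (length ys)) z"
  have "z S = \<zero>" if "S \<subseteq> {..<length ys}" for S
    using z(2) that card_mono[OF _ that] by (auto simp: above_def less_Suc_eq_le)
  then show "\<exists>u. chain u \<and> above (Suc (Suc (length ys))) u \<and> (\<forall>S\<subseteq>{..<length ys}. z S \<ominus> \<delta> u S \<in> J)"
    by (intro exI[of _ "\<lambda>_. \<zero>"]) (simp add: chain_def above_def koszul_diff_zero a_minus_def)
qed

lemma koszul_diff_mem_ideal:
  assumes "ideal J R"
    and e: "\<And>s. s < length ys \<Longrightarrow> s \<notin> T \<Longrightarrow> ys ! s \<otimes> e (insert s T) \<in> J"
  shows "\<delta> e T \<in> J"
proof -
  interpret J: ideal J R by fact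
  show ?thesis
    unfolding koszul_diff_eq by (rule J.finsum_mem) (auto intro!: J.I_l_closed e)
qed

lemma homotopy_above:
  assumes "above m w" shows "above (Suc m) (homotopy j w)"
  unfolding above_def
proof (intro allI impI)
  fix S assume S: "S \<subseteq> {..<length ys}" "card S < Suc m"
  have "finite S" using S(1) finite_subset by blast
  then have "w (S - {j}) = \<zero>" if "j \<in> S"
    using assms S that unfolding above_def by (metis Diff_subset card_Diff1_less less_Suc_eq_le
        order_less_le_trans subset_trans)
  then show "homotopy j w S = \<zero>" by (simp add: homotopy_def)
qed

text \<open>By the homotopy, the elements of \<open>ys\<close>, hence of the ideal they generate, annihilate the
  homology.\<close>

lemma annihilates_homology:
  assumes J: "ideal J R" and z: "chain z" "above m z" and cyc: "\<And>T. T \<subseteq> {..<length ys} \<Longrightarrow> \<delta> z T \<in> J"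
    and r: "r \<in> Idl (set ys)"
  shows "\<exists>q. chain q \<and> above (Suc m) q \<and> (\<forall>S\<subseteq>{..<length ys}. r \<otimes> z S \<ominus> \<delta> q S \<in> J)"
proof -
  interpret J: ideal J R by fact
  let ?P = "\<lambda>r q. chain q \<and> above (Suc m) q \<and> (\<forall>S\<subseteq>{..<length ys}. r \<otimes> z S \<ominus> \<delta> q S \<in> J)"
  define B where "B = {r \<in> carrier R. \<exists>q. ?P r q}"
  have smult: "a \<otimes> r \<in> B" if a: "a \<in> carrier R" and "r \<in> B" for a r
  proof -
    from \<open>r \<in> B\<close> obtain q where r: "r \<in> carrier R" and q: "?P r q" by (auto simp: B_def)
    have "?P (a \<otimes> r) (\<lambda>S. a \<otimes> q S)"
    proof (intro conjI allI impI)
      show "chain (\<lambda>S. a \<otimes> q S)" "above (Suc m) (\<lambda>S. a \<otimes> q S)"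
        using q a by (simp_all add: chain_def above_def)
      fix S assume S: "S \<subseteq> {..<length ys}"
      have "(a \<otimes> r) \<otimes> z S \<ominus> \<delta> (\<lambda>S. a \<otimes> q S) S = a \<otimes> (r \<otimes> z S \<ominus> \<delta> q S)"
        using q z a r S by (simp add: koszul_diff_smult a_minus_def r_distr r_minus m_assoc)
      then show "(a \<otimes> r) \<otimes> z S \<ominus> \<delta> (\<lambda>S. a \<otimes> q S) S \<in> J"
        using q S a by (simp add: J.I_l_closed)
    qed
    then show ?thesis using a r by (auto simp: B_def)
  qed
  have add: "r \<oplus> r' \<in> B" if "r \<in> B" "r' \<in> B" for r r'
  proof -
    from that obtain q q' where r: "r \<in> carrier R" "r' \<in> carrier R" and q: "?P r q" and q': "?P r' q'"
      unfolding B_def by blast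
    have "?P (r \<oplus> r') (\<lambda>S. q S \<oplus> q' S)"
    proof (intro conjI allI impI)
      show "chain (\<lambda>S. q S \<oplus> q' S)" "above (Suc m) (\<lambda>S. q S \<oplus> q' S)"
        using q q' by (simp_all add: chain_def above_def)
      fix S assume S: "S \<subseteq> {..<length ys}"
      have c: "\<delta> q S \<in> carrier R" "\<delta> q' S \<in> carrier R" "z S \<in> carrier R" using q q' z S by auto
      have "(r \<oplus> r') \<otimes> z S \<ominus> \<delta> (\<lambda>S. q S \<oplus> q' S) S = (r \<otimes> z S \<ominus> \<delta> q S) \<oplus> (r' \<otimes> z S \<ominus> \<delta> q' S)"
        using q q' S r c by (simp add: koszul_diff_add a_minus_def l_distr minus_add a_ac)
      then show "(r \<oplus> r') \<otimes> z S \<ominus> \<delta> (\<lambda>S. q S \<oplus> q' S) S \<in> J"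
        using q q' S by simp
    qed
    then show ?thesis using r unfolding B_def by blast
  qed
  have mem: "set ys \<subseteq> B"
  proof
    fix y assume "y \<in> set ys"
    then obtain j where j: "j < length ys" "y = ys ! j" by (metis in_set_conv_nth)
    have "?P y (homotopy j z)"
    proof (intro conjI allI impI)
      show "chain (homotopy j z)" "above (Suc m) (homotopy j z)" using z homotopy_above by auto
      fix S assume S: "S \<subseteq> {..<length ys}"
      have "y \<otimes> z S = \<delta> (homotopy j z) S \<oplus> homotopy j (\<delta> z) S"
        using koszul_homotopy[OF z(1) j(1) S] j by simp
      then have "y \<otimes> z S \<ominus> \<delta> (homotopy j z) S = homotopy j (\<delta> z) S"
        using z S by (simp add: add_minus_cancel_left)
      also have "\<dots> \<in> J"
        using cyc[of "S - {j}"] S by (auto simp: homotopy_def intro!: J.I_l_closed)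
      finally show "y \<otimes> z S \<ominus> \<delta> (homotopy j z) S \<in> J" .
    qed
    then show "y \<in> B" using j by (auto simp: B_def)
  qed
  have "submodule B R (ring_module R)"
  proof (rule self.submoduleI_smult)
    have "?P \<zero> (\<lambda>_. \<zero>)" using z by (simp add: chain_def above_def koszul_diff_zero a_minus_def)
    then show "\<zero>\<^bsub>ring_module R\<^esub> \<in> B" unfolding B_def by auto
  qed (use smult add in \<open>auto simp: B_def\<close>)
  then have "ideal B R" by (simp add: submodule_ring_module_iff)
  then have "r \<in> B" using genideal_minimal[OF _ mem] r by auto
  then show ?thesis by (simp add: B_def)
qed

text \<open>In terms of the long exact sequence for multiplication by \<open>y\<close> on
  \<open>R / J\<close>: vanishing of the homology over \<open>R / (J + y R)\<close> above degree
  \<open>m\<close> makes \<open>y\<close> injective on the homology over \<open>R / J\<close> from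
  degree \<open>m\<close> on, while a power of \<open>y\<close> lies in the ideal of
  \<open>ys\<close> and acts there as zero. The proof carries this out on chains, showing by descent
  in \<open>i\<close> that \<open>y [^] i\<close> times the cycle bounds modulo
  \<open>J\<close>.\<close>

lemma exact_above_adjoin:
  assumes J: "ideal J R" and y: "y \<in> carrier R" and pow: "y [^] (N::nat) \<in> Idl (set ys)"
    and nzd: "\<And>r. r \<in> carrier R \<Longrightarrow> y \<otimes> r \<in> J \<Longrightarrow> r \<in> J"
    and ex: "exact_above (adjoin J y) (Suc m)"
  shows "exact_above J m"
  unfolding exact_above_def
proof (intro allI impI)
  interpret J: ideal J R by fact
  fix z assume z: "chain z" "above m z" and cyc: "\<forall>T\<subseteq>{..<length ys}. \<delta> z T \<in> J"
  have "\<exists>q. chain q \<and> above (Suc m) q \<and> (\<forall>S\<subseteq>{..<length ys}. y [^] i \<otimes> z S \<ominus> \<delta> q S \<in> J)"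
    if "i \<le> N" for i
    using that
  proof (induction rule: inc_induct)
    case base
    show ?case using annihilates_homology[OF J z _ pow] cyc by blast
  next
    case (step i)
    then obtain q where q: "chain q" "above (Suc m) q"
      and qJ: "\<And>S. S \<subseteq> {..<length ys} \<Longrightarrow> y [^] Suc i \<otimes> z S \<ominus> \<delta> q S \<in> J" by blast
    \<comment> \<open>Modulo \<open>y\<close> the chain \<open>q\<close> becomes a cycle, hence
      \<open>q\<close> is \<open>\<delta> v\<close> plus \<open>y\<close> times some
      \<open>u\<close> modulo \<open>J\<close>. Applying \<open>\<delta>\<close> and cancelling
      \<open>y\<close> shows that \<open>u\<close> bounds \<open>y [^] i\<close> times
      \<open>z\<close>.\<close>
    have "\<delta> q T \<in> adjoin J y" if T: "T \<subseteq> {..<length ys}" for T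
    proof -
      have "\<ominus> (y [^] Suc i \<otimes> z T \<ominus> \<delta> q T) \<in> J" using qJ[OF T] by simp
      moreover have "\<ominus> (y [^] Suc i \<otimes> z T \<ominus> \<delta> q T) = \<delta> q T \<ominus> y \<otimes> (y [^] i \<otimes> z T)"
        using y q z T by (simp add: a_minus_def minus_add m_ac a_comm)
      ultimately show ?thesis
        using q z T y by (auto simp: adjoin_def intro!: bexI[of _ "y [^] i \<otimes> z T"])
    qed
    then obtain v where v: "chain v" and vq: "\<And>S. S \<subseteq> {..<length ys} \<Longrightarrow> q S \<ominus> \<delta> v S \<in> adjoin J y"
      using ex q unfolding exact_above_def by blast
    have "\<forall>S. \<exists>r. S \<subseteq> {..<length ys} \<longrightarrow> r \<in> carrier R \<and> (q S \<ominus> \<delta> v S) \<ominus> y \<otimes> r \<in> J"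
      using vq unfolding adjoin_def by blast
    then obtain u where u: "\<And>S. S \<subseteq> {..<length ys} \<Longrightarrow> u S \<in> carrier R \<and> (q S \<ominus> \<delta> v S) \<ominus> y \<otimes> u S \<in> J"
      by metis
    then have uc: "chain u" by (simp add: chain_def)
    \<comment> \<open>\<open>u\<close> comes from a choice at each index set and may be nonzero in
      degrees up to \<open>m\<close>. Cutting it off there does not change \<open>\<delta> u\<close>
      from degree \<open>m\<close> on, and below \<open>m\<close> both \<open>z\<close> and
      \<open>\<delta> u'\<close> vanish.\<close>
    define u' where "u' S = (if card S < Suc m then \<zero> else u S)" for S :: "nat set"
    have u'c: "chain u'" "above (Suc m) u'" using uc by (auto simp: chain_def above_def u'_def)
    have main: "y [^] i \<otimes> z S \<ominus> \<delta> u S \<in> J" if S: "S \<subseteq> {..<length ys}" for S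
    proof -
      have "chain (\<lambda>S. q S \<ominus> \<delta> v S)" "chain (\<lambda>S. y \<otimes> u S)"
        using q v uc y by (simp_all add: chain_def a_minus_def)
      then have "\<delta> (\<lambda>S. (q S \<ominus> \<delta> v S) \<ominus> y \<otimes> u S) S = \<delta> q S \<ominus> y \<otimes> \<delta> u S"
        using q v uc y S by (simp add: koszul_diff_minus koszul_diff_smult koszul_diff_koszul_diff)
          (simp add: a_minus_def)
      moreover have "\<delta> (\<lambda>S. (q S \<ominus> \<delta> v S) \<ominus> y \<otimes> u S) S \<in> J"
        using u S by (intro koszul_diff_mem_ideal[OF J] J.I_l_closed ys_nth) auto
      ultimately have "(y [^] Suc i \<otimes> z S \<ominus> \<delta> q S) \<oplus> (\<delta> q S \<ominus> y \<otimes> \<delta> u S) \<in> J"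
        using qJ[OF S] by simp
      moreover have "(y [^] Suc i \<otimes> z S \<ominus> \<delta> q S) \<oplus> (\<delta> q S \<ominus> y \<otimes> \<delta> u S)
          = y \<otimes> (y [^] i \<otimes> z S \<ominus> \<delta> u S)"
      proof -
        have c: "\<delta> q S \<in> carrier R" "\<delta> u S \<in> carrier R" "z S \<in> carrier R" "y [^] i \<in> carrier R"
          using q uc z y S by auto
        show ?thesis unfolding nat_pow_Suc using c y by algebra
      qed
      ultimately show ?thesis using nzd[of "y [^] i \<otimes> z S \<ominus> \<delta> u S"] z uc y S by simp
    qed
    have "y [^] i \<otimes> z S \<ominus> \<delta> u' S \<in> J" if S: "S \<subseteq> {..<length ys}" for S
    proof (cases "card S < m")
      case True
      have fS: "finite S" using S finite_subset by blast
      have "\<delta> u' S = \<delta> (\<lambda>_. \<zero>) S"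
        using True S fS by (intro koszul_diff_cong) (auto simp: chain_def u'_def)
      then show ?thesis using True S z y by (simp add: koszul_diff_zero above_def a_minus_def)
    next
      case False
      have fS: "finite S" using S finite_subset by blast
      have "\<delta> u' S = \<delta> u S"
        using False S uc fS by (intro koszul_diff_cong) (auto simp: u'_def)
      then show ?thesis using main[OF S] by simp
    qed
    then show ?case using u'c by blast
  qed
  from this[of 0] show "\<exists>u. chain u \<and> above (Suc m) u \<and> (\<forall>S\<subseteq>{..<length ys}. z S \<ominus> \<delta> u S \<in> J)"
    using z by simp
qed

end

section \<open>The quotient of the Koszul complex\<close>

context cring
begin

lemma ideals_set_simps [simp]:
  "\<one>\<^bsub>ideals_set R\<^esub> = carrier R" "mult (ideals_set R) = ideal_prod R"
  by (simp_all add: ideals_set_def)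

lemma ideal_nat_pow:
  assumes "ideal I R" shows "ideal (I [^]\<^bsub>ideals_set R\<^esub> (k::nat)) R"
  by (induction k) (simp_all add: oneideal ideal_prod_is_ideal assms)

lemma ideal_ideal_pow: "ideal I R \<Longrightarrow> ideal (ideal_pow R I n) R"
  unfolding ideal_pow_def using oneideal ideal_nat_pow by presburger

lemma ideal_pow_nonneg: "0 \<le> n \<Longrightarrow> ideal_pow R I n = I [^]\<^bsub>ideals_set R\<^esub> nat n"
  by (auto simp: ideal_pow_def)

lemma ideal_filt: "ideal I R \<Longrightarrow> ideal J R \<Longrightarrow> ideal (filt R I J n n') R"
  by (simp add: filt_def ideal_prod_is_ideal ideal_ideal_pow)

text \<open>For \<open>n \<le> 0\<close> the target is the whole ring, so the convention on
  non-positive exponents is compatible with multiplication by \<open>I\<close>. This lets the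
  subcomplex exist for all integers \<open>n\<^sub>1\<close> and \<open>n\<^sub>2\<close>.\<close>

lemma ideal_pow_mult:
  assumes I: "ideal I R" and x: "x \<in> I" and a: "a \<in> ideal_pow R I (n - 1)"
  shows "x \<otimes> a \<in> ideal_pow R I n"
proof -
  interpret I: ideal I R by (rule I)
  have ac: "a \<in> carrier R" using ideal.Icarr[OF ideal_ideal_pow[OF I] a] .
  have xc: "x \<in> carrier R" using x by (rule I.Icarr)
  show ?thesis
  proof (cases "n \<le> 0")
    case True
    then show ?thesis using xc ac by (simp add: ideal_pow_def)
  next
    case False
    define k where "k = nat (n - 1)"
    have k: "nat n = Suc k" "nat (n - 1) = k" using False by (simp_all add: k_def)
    have "a \<in> I [^]\<^bsub>ideals_set R\<^esub> k" using a False ideal_pow_nonneg[of "n - 1" I, unfolded k(2)] by simp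
    then have "a \<otimes> x \<in> ideal_pow R I n"
      using x False ideal_pow_nonneg[of n I, unfolded k(1)] by (simp add: ideal_prod.prod)
    then show ?thesis using xc ac by (simp add: m_comm)
  qed
qed

lemma filt_commute: "ideal I R \<Longrightarrow> ideal J R \<Longrightarrow> filt R I J n n' = filt R J I n' n"
  by (simp add: filt_def ideal_prod_commute ideal_ideal_pow)

lemma filt_mult_fst:
  assumes I: "ideal I R" and J: "ideal J R" and x: "x \<in> I" and a: "a \<in> filt R I J (n - 1) n'"
  shows "x \<otimes> a \<in> filt R I J n n'"
  using a unfolding filt_def
proof (induction rule: ideal_prod.induct)
  case (prod i j)
  have "x \<in> carrier R" "i \<in> carrier R" "j \<in> carrier R"
    using ideal.Icarr[OF I x] ideal.Icarr[OF ideal_ideal_pow[OF I] prod(1)]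
      ideal.Icarr[OF ideal_ideal_pow[OF J] prod(2)] by auto
  then have "x \<otimes> (i \<otimes> j) = (x \<otimes> i) \<otimes> j" by (simp add: m_assoc)
  then show ?case using ideal_pow_mult[OF I x prod(1)] prod(2) by (auto intro: ideal_prod.prod)
next
  case (sum s t)
  have "s \<in> carrier R" "t \<in> carrier R"
    using sum(1,2) ideal.Icarr[OF ideal_filt[OF I J]] unfolding filt_def by blast+
  then have "x \<otimes> (s \<oplus> t) = x \<otimes> s \<oplus> x \<otimes> t" using ideal.Icarr[OF I x] by (simp add: r_distr)
  then show ?case using sum by (auto intro: ideal_prod.sum)
qed

lemma filt_mult_snd:
  assumes "ideal I R" "ideal J R" "x \<in> J" "a \<in> filt R I J n (n' - 1)"
  shows "x \<otimes> a \<in> filt R I J n n'"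
  using filt_mult_fst[OF assms(2,1,3)] assms by (simp add: filt_commute[of I J])

end

lemma finite_subsets_of_card [simp]: "finite (subsets_of_card n i)"
  by (rule finite_subset[of _ "Pow {..<n}"]) (auto simp: subsets_of_card_def)

lemma subsets_of_card_empty: "n < i \<Longrightarrow> subsets_of_card n i = {}"
proof (rule ccontr)
  assume "n < i" "subsets_of_card n i \<noteq> {}"
  then obtain S where "S \<subseteq> {..<n}" "card S = i" by (auto simp: subsets_of_card_def)
  then show False using card_mono[of "{..<n}" S] \<open>n < i\<close> by simp
qed

lemma insert_in_subsets_of_card:
  "T \<in> subsets_of_card n i \<Longrightarrow> s < n \<Longrightarrow> s \<notin> T \<Longrightarrow> insert s T \<in> subsets_of_card n (Suc i)"
  using finite_subset[of T "{..<n}"] by (auto simp: subsets_of_card_def)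

section \<open>The complex as a quotient of free modules\<close>

locale bigraded_koszul = cring R for R :: "('a, 'b) ring_scheme" (structure) +
  fixes I\<^sub>1 I\<^sub>2 :: "'a set" and xs\<^sub>1 xs\<^sub>2 :: "'a list" and n\<^sub>1 n\<^sub>2 :: int
  assumes ideal_I1: "ideal I\<^sub>1 R" and ideal_I2: "ideal I\<^sub>2 R"
    and xs1: "set xs\<^sub>1 \<subseteq> I\<^sub>1" and xs2: "set xs\<^sub>2 \<subseteq> I\<^sub>2"
begin

abbreviation "ys \<equiv> xs\<^sub>1 @ xs\<^sub>2"
abbreviation "n \<equiv> length xs\<^sub>1 + length xs\<^sub>2"

sublocale koszul R "xs\<^sub>1 @ xs\<^sub>2"
proof unfold_locales
  show "set (xs\<^sub>1 @ xs\<^sub>2) \<subseteq> carrier R"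
    using xs1 xs2 ideal.Icarr[OF ideal_I1] ideal.Icarr[OF ideal_I2] by auto
qed

abbreviation \<F> where "\<F> \<equiv> filt R I\<^sub>1 I\<^sub>2"
abbreviation homology_length where
  "homology_length i \<equiv> module_length R (C_homology R I\<^sub>1 I\<^sub>2 xs\<^sub>1 xs\<^sub>2 n\<^sub>1 n\<^sub>2 i)"
abbreviation reduction_length where
  "reduction_length \<equiv> module_length R (reduction_quot R I\<^sub>1 I\<^sub>2 xs\<^sub>1 xs\<^sub>2 n\<^sub>1 n\<^sub>2)"

abbreviation J :: "nat set \<Rightarrow> 'a set" where
  "J \<equiv> comp_ideal R I\<^sub>1 I\<^sub>2 (length xs\<^sub>1) n\<^sub>1 n\<^sub>2"

abbreviation K :: "nat \<Rightarrow> ('a, nat set \<Rightarrow> 'a) module" where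
  "K i \<equiv> direct_sum_module (subsets_of_card n i) (\<lambda>_. ring_module R)"

abbreviation C :: "nat \<Rightarrow> ('a, nat set \<Rightarrow> 'a set) module" where
  "C \<equiv> C_term R I\<^sub>1 I\<^sub>2 xs\<^sub>1 xs\<^sub>2 n\<^sub>1 n\<^sub>2"

definition F :: "nat \<Rightarrow> (nat set \<Rightarrow> 'a) set" where
  "F i = (\<Pi>\<^sub>E S\<in>subsets_of_card n i. J S)"

definition diff :: "nat \<Rightarrow> (nat set \<Rightarrow> 'a) \<Rightarrow> nat set \<Rightarrow> 'a" where
  "diff i w = (\<lambda>T\<in>subsets_of_card n i. \<delta> w T)"

definition proj :: "nat \<Rightarrow> (nat set \<Rightarrow> 'a) \<Rightarrow> nat set \<Rightarrow> 'a set" where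
  "proj i w = (\<lambda>S\<in>subsets_of_card n i. J S +> w S)"

text \<open>\<open>Z i\<close> and \<open>B i\<close> turn out to be the preimages in the free
  module \<open>K i\<close> of the cycles and boundaries of the quotient complex. Homology lengths
  are computed between them, which avoids calculating with families of cosets.\<close>

definition Z :: "nat \<Rightarrow> (nat set \<Rightarrow> 'a) set" where
  "Z i = {w \<in> carrier (K i). i = 0 \<or> diff (i - 1) w \<in> F (i - 1)}"

definition B :: "nat \<Rightarrow> (nat set \<Rightarrow> 'a) set" where
  "B i = F i <+>\<^bsub>K i\<^esub> diff i ` carrier (K (Suc i))"

lemma ideal_J: "ideal (J S) R"
  by (simp add: comp_ideal_def ideal_filt ideal_I1 ideal_I2)

text \<open>Removing \<open>s\<close> from the index set raises exactly one of the two exponents by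
  one, and it is the exponent of the ideal containing \<open>ys ! s\<close>. This is what makes
  \<open>F\<close> a subcomplex.\<close>

lemma J_mult:
  assumes s: "s < n" "s \<notin> T" and T: "finite T" and a: "a \<in> J (insert s T)"
  shows "ys ! s \<otimes> a \<in> J T"
proof (cases "s < length xs\<^sub>1")
  case True
  have "insert s T \<inter> {..<length xs\<^sub>1} = insert s (T \<inter> {..<length xs\<^sub>1})"
    "insert s T - {..<length xs\<^sub>1} = T - {..<length xs\<^sub>1}" using True by auto
  then have "J (insert s T) = \<F> (n\<^sub>1 - int (card (T \<inter> {..<length xs\<^sub>1})) - 1)
      (n\<^sub>2 - int (card (T - {..<length xs\<^sub>1})))"
    using s T by (simp add: comp_ideal_def algebra_simps)
  moreover have "ys ! s \<in> I\<^sub>1" using True xs1 by (auto simp: nth_append)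
  ultimately show ?thesis
    using filt_mult_fst[OF ideal_I1 ideal_I2] a by (simp add: comp_ideal_def)
next
  case False
  have "insert s T \<inter> {..<length xs\<^sub>1} = T \<inter> {..<length xs\<^sub>1}"
    "insert s T - {..<length xs\<^sub>1} = insert s (T - {..<length xs\<^sub>1})" using False by auto
  then have "J (insert s T) = \<F> (n\<^sub>1 - int (card (T \<inter> {..<length xs\<^sub>1})))
      (n\<^sub>2 - int (card (T - {..<length xs\<^sub>1})) - 1)"
    using s T by (simp add: comp_ideal_def algebra_simps)
  moreover have "ys ! s \<in> I\<^sub>2" using False xs2 s by (auto simp: nth_append)
  ultimately show ?thesis
    using filt_mult_snd[OF ideal_I1 ideal_I2] a by (simp add: comp_ideal_def)
qed

sublocale K: module_family R "subsets_of_card n i" "\<lambda>_. ring_module R" for i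
  by (intro module_family.intro cring_axioms module_family_axioms.intro ring_module_module)

lemma submodule_J: "submodule (J S) R (ring_module R)"
  by (simp add: submodule_ring_module_iff ideal_J)

lemma Q: "module_quotient R (ring_module R) (J S)"
  by (intro module_quotient.intro ring_module_module module_quotient_axioms.intro submodule_J)

lemma C_eq: "C i = direct_sum_module (subsets_of_card n i) (\<lambda>S. quot_module (ring_module R) (J S))"
  by (simp add: C_term_def)

lemma carrier_K: "carrier (K i) = (\<Pi>\<^sub>E S\<in>subsets_of_card n i. carrier R)"
  by (simp add: direct_sum_module_simps)

lemma carrier_C: "carrier (C i) = (\<Pi>\<^sub>E S\<in>subsets_of_card n i. (\<lambda>x. J S +> x) ` carrier R)"
  using module_quotient.carrier_quot[OF Q] by (simp add: C_eq direct_sum_module_simps)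

lemma submodule_F: "submodule (F i) R (K i)"
  unfolding F_def by (rule K.direct_sum_submodule) (rule submodule_J)

lemma proj_hom: "module_hom R (K i) (C i) (proj i)"
  using K.module_hom_direct_sum_proj[of i J] submodule_J unfolding C_eq proj_def by simp

sublocale P: module_hom R "K i" "C i" "proj i" for i by (rule proj_hom)

text \<open>Elements of \<open>K i\<close> are \<open>undefined\<close> outside the index set, so that a chain in the sense of
  the Koszul complex is obtained by extending with \<open>\<zero>\<close>.\<close>

definition zero_ext :: "nat \<Rightarrow> (nat set \<Rightarrow> 'a) \<Rightarrow> nat set \<Rightarrow> 'a" where
  "zero_ext i w S = (if S \<in> subsets_of_card n i then w S else \<zero>)"

lemma chain_zero_ext: "w \<in> carrier (K i) \<Longrightarrow> chain (zero_ext i w)"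
  by (auto simp: chain_def zero_ext_def carrier_K PiE_iff)

lemma subset_lessThan: "T \<in> subsets_of_card n i \<Longrightarrow> T \<subseteq> {..<length ys}"
  by (simp add: subsets_of_card_def)

lemma koszul_diff_zero_ext:
  assumes "w \<in> carrier (K (Suc i))" "T \<in> subsets_of_card n i"
  shows "\<delta> w T = \<delta> (zero_ext (Suc i) w) T"
  using assms
  by (intro koszul_diff_cong chain_zero_ext)
    (use insert_in_subsets_of_card subset_lessThan[OF assms(2)] in \<open>auto simp: zero_ext_def\<close>)

lemma diff_hom: "module_hom R (K (Suc i)) (K i) (diff i)"
proof (intro module_hom.intro module_hom_axioms.intro K.sum.module_axioms)
  fix w assume w: "w \<in> carrier (K (Suc i))"
  show "diff i w \<in> carrier (K i)"
    unfolding diff_def carrier_K using koszul_diff_zero_ext[OF w] chain_zero_ext[OF w] subset_lessThan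
    by auto
  show "diff i (w \<oplus>\<^bsub>K (Suc i)\<^esub> v) = diff i w \<oplus>\<^bsub>K i\<^esub> diff i v" if v: "v \<in> carrier (K (Suc i))" for v
    unfolding diff_def direct_sum_module_simps
  proof (rule restrict_ext)
    fix T assume T: "T \<in> subsets_of_card n i"
    have wv: "w \<oplus>\<^bsub>K (Suc i)\<^esub> v \<in> carrier (K (Suc i))" using w v by simp
    have "\<delta> (w \<oplus>\<^bsub>K (Suc i)\<^esub> v) T = \<delta> (zero_ext (Suc i) (w \<oplus>\<^bsub>K (Suc i)\<^esub> v)) T"
      by (rule koszul_diff_zero_ext[OF wv T])
    also have "zero_ext (Suc i) (w \<oplus>\<^bsub>K (Suc i)\<^esub> v) = (\<lambda>S. zero_ext (Suc i) w S \<oplus> zero_ext (Suc i) v S)"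
      by (auto simp: zero_ext_def direct_sum_module_simps)
    also have "\<delta> \<dots> T = \<delta> w T \<oplus> \<delta> v T"
      using koszul_diff_add[OF chain_zero_ext[OF w] chain_zero_ext[OF v] subset_lessThan[OF T]]
        koszul_diff_zero_ext[OF w T] koszul_diff_zero_ext[OF v T] by simp
    finally have "\<delta> (w \<oplus>\<^bsub>K (Suc i)\<^esub> v) T = \<delta> w T \<oplus> \<delta> v T" .
    then show "\<delta> (\<lambda>p\<in>subsets_of_card n (Suc i). w p \<oplus>\<^bsub>ring_module R\<^esub> v p) T =
        (\<lambda>T\<in>subsets_of_card n i. \<delta> w T) T \<oplus>\<^bsub>ring_module R\<^esub> (\<lambda>T\<in>subsets_of_card n i. \<delta> v T) T"
      using T by (simp add: direct_sum_module_simps)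
  qed
  show "diff i (r \<odot>\<^bsub>K (Suc i)\<^esub> w) = r \<odot>\<^bsub>K i\<^esub> diff i w" if r: "r \<in> carrier R" for r
    unfolding diff_def direct_sum_module_simps
  proof (rule restrict_ext)
    fix T assume T: "T \<in> subsets_of_card n i"
    have rw: "r \<odot>\<^bsub>K (Suc i)\<^esub> w \<in> carrier (K (Suc i))" using r w by simp
    have "\<delta> (r \<odot>\<^bsub>K (Suc i)\<^esub> w) T = \<delta> (zero_ext (Suc i) (r \<odot>\<^bsub>K (Suc i)\<^esub> w)) T"
      by (rule koszul_diff_zero_ext[OF rw T])
    also have "zero_ext (Suc i) (r \<odot>\<^bsub>K (Suc i)\<^esub> w) = (\<lambda>S. r \<otimes> zero_ext (Suc i) w S)"
      using r by (auto simp: zero_ext_def direct_sum_module_simps)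
    also have "\<delta> \<dots> T = r \<otimes> \<delta> w T"
      using koszul_diff_smult[OF chain_zero_ext[OF w] r subset_lessThan[OF T]]
        koszul_diff_zero_ext[OF w T] by simp
    finally have "\<delta> (r \<odot>\<^bsub>K (Suc i)\<^esub> w) T = r \<otimes> \<delta> w T" .
    then show "\<delta> (\<lambda>p\<in>subsets_of_card n (Suc i). r \<odot>\<^bsub>ring_module R\<^esub> w p) T =
        r \<odot>\<^bsub>ring_module R\<^esub> (\<lambda>T\<in>subsets_of_card n i. \<delta> w T) T"
      using T by (simp add: direct_sum_module_simps)
  qed
qed

sublocale D: module_hom R "K (Suc i)" "K i" "diff i" for i by (rule diff_hom)

lemma koszul_diff_J:
  assumes T: "T \<in> subsets_of_card n i" and w: "\<And>S. S \<in> subsets_of_card n (Suc i) \<Longrightarrow> w S \<in> J S"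
  shows "\<delta> w T \<in> J T"
proof -
  have "finite T" "T \<subseteq> {..<n}" using T finite_subset[of T "{..<n}"] by (auto simp: subsets_of_card_def)
  then show ?thesis
    using T by (intro koszul_diff_mem_ideal ideal_J J_mult w insert_in_subsets_of_card) auto
qed

lemma diff_F: "w \<in> F (Suc i) \<Longrightarrow> diff i w \<in> F i"
  unfolding F_def diff_def by (auto intro!: koszul_diff_J)

lemma diff_diff:
  assumes w: "w \<in> carrier (K (Suc (Suc i)))"
  shows "diff i (diff (Suc i) w) = \<zero>\<^bsub>K i\<^esub>"
  unfolding direct_sum_module_simps diff_def[of i]
proof (rule restrict_ext)
  fix U assume U: "U \<in> subsets_of_card n i"
  have ch: "chain (zero_ext (Suc (Suc i)) w)" using chain_zero_ext[OF w] .
  have "\<delta> (diff (Suc i) w) U = \<delta> (\<delta> (zero_ext (Suc (Suc i)) w)) U"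
  proof (rule koszul_diff_cong)
    show "chain (\<delta> (zero_ext (Suc (Suc i)) w))" using ch by simp
    show "U \<subseteq> {..<length ys}" using subset_lessThan[OF U] .
    fix s assume "s < length ys" "s \<notin> U"
    then have "insert s U \<in> subsets_of_card n (Suc i)" using U by (simp add: insert_in_subsets_of_card)
    then show "diff (Suc i) w (insert s U) = \<delta> (zero_ext (Suc (Suc i)) w) (insert s U)"
      using koszul_diff_zero_ext[OF w] by (simp add: diff_def)
  qed
  then show "\<delta> (diff (Suc i) w) U = \<zero>\<^bsub>ring_module R\<^esub>"
    using koszul_diff_koszul_diff[OF ch subset_lessThan[OF U]] by simp
qed

lemma proj_surj: "proj i ` carrier (K i) = carrier (C i)"
proof
  show "proj i ` carrier (K i) \<subseteq> carrier (C i)" using P.hom_closed by auto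
  show "carrier (C i) \<subseteq> proj i ` carrier (K i)"
  proof
    fix z assume z: "z \<in> carrier (C i)"
    have "\<forall>S. \<exists>x. S \<in> subsets_of_card n i \<longrightarrow> x \<in> carrier R \<and> z S = J S +> x"
      using z unfolding carrier_C PiE_iff by blast
    then obtain w where w: "\<And>S. S \<in> subsets_of_card n i \<Longrightarrow> w S \<in> carrier R \<and> z S = J S +> w S"
      by metis
    have "z = proj i (\<lambda>S\<in>subsets_of_card n i. w S)"
    proof
      fix S
      show "z S = proj i (\<lambda>S\<in>subsets_of_card n i. w S) S"
        using w[of S] z unfolding carrier_C proj_def
        by (cases "S \<in> subsets_of_card n i") (auto simp: PiE_iff extensional_def)
    qed
    moreover have "(\<lambda>S\<in>subsets_of_card n i. w S) \<in> carrier (K i)" using w by (auto simp: carrier_K)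
    ultimately show "z \<in> proj i ` carrier (K i)" by blast
  qed
qed

lemma proj_eq_zero_iff:
  assumes "w \<in> carrier (K i)"
  shows "proj i w = \<zero>\<^bsub>C i\<^esub> \<longleftrightarrow> w \<in> F i"
proof -
  have wS: "w S \<in> carrier R" if "S \<in> subsets_of_card n i" for S
    using assms that by (auto simp: carrier_K PiE_iff)
  have "J S +> w S = J S \<longleftrightarrow> w S \<in> J S" if "S \<in> subsets_of_card n i" for S
    using module_quotient.coset_eq_self_iff[OF Q, of "w S" S] wS[OF that] by simp
  moreover have "proj i w = \<zero>\<^bsub>C i\<^esub> \<longleftrightarrow> (\<forall>S\<in>subsets_of_card n i. J S +> w S = J S)"
  proof
    assume "proj i w = \<zero>\<^bsub>C i\<^esub>"
    then have eq: "proj i w S = \<zero>\<^bsub>C i\<^esub> S" for S by simp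
    show "\<forall>S\<in>subsets_of_card n i. J S +> w S = J S"
    proof
      fix S assume "S \<in> subsets_of_card n i"
      then show "J S +> w S = J S"
        using eq[of S] by (simp add: proj_def C_eq direct_sum_module_simps module_quotient.zero_quot[OF Q])
    qed
  qed (auto simp: proj_def C_eq direct_sum_module_simps module_quotient.zero_quot[OF Q] intro!: restrict_ext)
  ultimately show ?thesis
    using assms by (auto simp: F_def carrier_K PiE_iff)
qed

text \<open>The union in \<open>C_diff\<close> ranges over all lifts, one of which is
  \<open>w\<close>. Two lifts differ by a chain with values in the ideals \<open>J S\<close>, whose
  differential lies in \<open>J T\<close>, so every lift yields the same coset.\<close>

lemma C_diff_proj:
  assumes w: "w \<in> carrier (K (Suc i))"
  shows "C_diff R I\<^sub>1 I\<^sub>2 xs\<^sub>1 xs\<^sub>2 n\<^sub>1 n\<^sub>2 (Suc i) (proj (Suc i) w) = proj i (diff i w)"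
  unfolding C_diff_def proj_def[of i] diff_Suc_1
proof (rule restrict_ext)
  fix T assume T: "T \<in> subsets_of_card n i"
  interpret J: module_quotient R "ring_module R" "J T" by (rule Q)
  have wS: "w S \<in> carrier R" if "S \<in> subsets_of_card n (Suc i)" for S
    using w that by (auto simp: carrier_K PiE_iff)
  let ?L = "\<Pi>\<^sub>E S\<in>subsets_of_card n (Suc i). proj (Suc i) w S"
  have proj_S: "proj (Suc i) w S = J S +> w S" if "S \<in> subsets_of_card n (Suc i)" for S
    using that by (simp add: proj_def)
  have "w S \<in> J S +> w S" if "S \<in> subsets_of_card n (Suc i)" for S
    using wS[OF that] abelian_subgroup.a_rcos_self[OF module_quotient.abelian_subgroup_N[OF Q], of "w S" S]
    by simp
  then have wL: "w \<in> ?L" using w proj_S by (auto simp: carrier_K PiE_iff)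
  have "J T +> \<delta> w' T = J T +> \<delta> w T" if w': "w' \<in> ?L" for w'
  proof -
    have w'S: "w' S \<in> carrier R \<and> w' S \<ominus> w S \<in> J S" if S: "S \<in> subsets_of_card n (Suc i)" for S
    proof -
      interpret JS: module_quotient R "ring_module R" "J S" by (rule Q)
      have "w' S \<in> J S +> w S" using w' S proj_S by (auto simp: PiE_iff)
      then show ?thesis
        using JS.N.a_elemrcos_carrier[of "w S" "w' S"] JS.N.a_rcos_module_imp[of "w S" "w' S"] wS[OF S]
        by (simp add: a_minus_def)
    qed
    have w'K: "w' \<in> carrier (K (Suc i))" using w' w'S by (auto simp: carrier_K PiE_iff)
    have c: "\<delta> w' T \<in> carrier R" "\<delta> w T \<in> carrier R"
      using koszul_diff_zero_ext[OF _ T] chain_zero_ext w'K w subset_lessThan[OF T] by simp_all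
    have "\<delta> w' T \<ominus> \<delta> w T = \<delta> (\<lambda>S. zero_ext (Suc i) w' S \<ominus> zero_ext (Suc i) w S) T"
      using koszul_diff_minus[OF chain_zero_ext[OF w'K] chain_zero_ext[OF w] subset_lessThan[OF T]]
        koszul_diff_zero_ext[OF w'K T] koszul_diff_zero_ext[OF w T] by simp
    also have "\<dots> \<in> J T"
      using T w'S by (intro koszul_diff_J) (auto simp: zero_ext_def)
    finally show ?thesis using J.coset_eq_iff[of "\<delta> w' T" "\<delta> w T"] c by simp
  qed
  then have "(\<Union>w\<in>?L. J T +> \<delta> w T) = J T +> \<delta> w T" using wL by blast
  then show "(\<Union>w\<in>?L. J T +> \<delta> w T) = J T +> diff i w T" using T by (simp add: diff_def)
qed

lemma submodule_Z: "submodule (Z i) R (K i)"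
proof (cases i)
  case 0
  then show ?thesis using K.sum.carrier_is_submodule by (simp add: Z_def)
next
  case (Suc j)
  then show ?thesis using D.submodule_vimage[OF submodule_F, of j] by (simp add: Z_def)
qed

lemma submodule_B: "submodule (B i) R (K i)"
  unfolding B_def
  by (intro K.sum.submodule_set_add submodule_F D.submodule_image K.sum.carrier_is_submodule)

lemma F_subset_B: "F i \<subseteq> B i"
  unfolding B_def
  by (intro K.sum.set_add_upper submodule_F D.submodule_image K.sum.carrier_is_submodule)

lemma diff_subset_B: "diff i ` carrier (K (Suc i)) \<subseteq> B i"
  unfolding B_def
  by (intro K.sum.set_add_upper submodule_F D.submodule_image K.sum.carrier_is_submodule)

lemma B_subset_Z: "B i \<subseteq> Z i"
  unfolding B_def
proof (rule K.sum.set_add_least[OF submodule_Z])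
  have FK: "F i \<subseteq> carrier (K i)" for i using K.sum.submodule_simps(2)[OF submodule_F] by blast
  show "F i \<subseteq> Z i"
    by (cases i) (use FK diff_F in \<open>auto simp: Z_def\<close>)
  show "diff i ` carrier (K (Suc i)) \<subseteq> Z i"
    by (cases i) (use K.sum.submodule_simps(1)[OF submodule_F] in \<open>auto simp: Z_def diff_diff\<close>)
qed

lemma Z_subset_K: "Z i \<subseteq> carrier (K i)"
  by (auto simp: Z_def)

lemma C_cycles_eq: "C_cycles R I\<^sub>1 I\<^sub>2 xs\<^sub>1 xs\<^sub>2 n\<^sub>1 n\<^sub>2 i = proj i ` Z i"
proof -
  have "proj i w \<in> C_cycles R I\<^sub>1 I\<^sub>2 xs\<^sub>1 xs\<^sub>2 n\<^sub>1 n\<^sub>2 i \<longleftrightarrow> w \<in> Z i" if w: "w \<in> carrier (K i)" for w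
  proof (cases i)
    case 0
    then show ?thesis using w P.hom_closed[OF w] by (simp add: C_cycles_def Z_def)
  next
    case (Suc j)
    then show ?thesis
      using w P.hom_closed[OF w] C_diff_proj[of w j] proj_eq_zero_iff[of "diff j w" j] D.hom_closed[of w j]
      by (simp add: C_cycles_def Z_def)
  qed
  moreover have "C_cycles R I\<^sub>1 I\<^sub>2 xs\<^sub>1 xs\<^sub>2 n\<^sub>1 n\<^sub>2 i \<subseteq> proj i ` carrier (K i)"
    unfolding proj_surj by (auto simp: C_cycles_def)
  ultimately show ?thesis using Z_subset_K[of i] by blast
qed

lemma C_boundaries_eq:
  "C_boundaries R I\<^sub>1 I\<^sub>2 xs\<^sub>1 xs\<^sub>2 n\<^sub>1 n\<^sub>2 i = proj i ` (diff i ` carrier (K (Suc i)))"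
  unfolding C_boundaries_def proj_surj[symmetric] image_image
  by (rule image_cong) (simp_all add: C_diff_proj)

text \<open>The kernel of \<open>proj i\<close> is \<open>F i\<close>, so the boundaries pull back
  to \<open>F i\<close> plus the Koszul boundaries, which is \<open>B i\<close>.\<close>

lemma module_length_C_homology:
  "homology_length i = rel_length R (K i) (B i) (Z i)"
proof -
  let ?c = "proj i ` Z i" and ?b = "proj i ` (diff i ` carrier (K (Suc i)))"
  have c: "submodule ?c R (C i)" by (intro P.submodule_image submodule_Z)
  have d: "submodule (diff i ` carrier (K (Suc i))) R (K i)"
    by (intro D.submodule_image K.sum.carrier_is_submodule)
  have b: "submodule ?b R (C i)" by (intro P.submodule_image d)
  have bc: "?b \<subseteq> ?c" using diff_subset_B[of i] B_subset_Z[of i] by blast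
  have "homology_length i = rel_length R (C i) ?b ?c"
    unfolding C_homology_def C_cycles_eq C_boundaries_eq
    using module_length_quot_restrict[OF P.N.module_axioms c b bc] .
  moreover have "{w \<in> Z i. proj i w \<in> ?b} = B i"
  proof
    show "B i \<subseteq> {w \<in> Z i. proj i w \<in> ?b}"
    proof
      fix w assume w: "w \<in> B i"
      then obtain f v where fv: "f \<in> F i" "v \<in> diff i ` carrier (K (Suc i))" "w = f \<oplus>\<^bsub>K i\<^esub> v"
        unfolding B_def K.sum.mem_set_add_iff by blast
      have fc: "f \<in> carrier (K i)" "v \<in> carrier (K i)"
        using fv K.sum.submodule_simps(2)[OF submodule_F] K.sum.submodule_simps(2)[OF d] by auto
      have "proj i w = proj i v"
        using fc proj_eq_zero_iff[of f i] fv by (simp add: P.hom_add)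
      then show "w \<in> {w \<in> Z i. proj i w \<in> ?b}" using fv(2) w B_subset_Z by auto
    qed
    show "{w \<in> Z i. proj i w \<in> ?b} \<subseteq> B i"
    proof (clarify)
      fix w u assume w: "w \<in> Z i" and u: "u \<in> carrier (K (Suc i))" and eq: "proj i w = proj i (diff i u)"
      have wc: "w \<in> carrier (K i)" "diff i u \<in> carrier (K i)" using w Z_subset_K u by auto
      have "proj i (w \<ominus>\<^bsub>K i\<^esub> diff i u) = \<zero>\<^bsub>C i\<^esub>"
        using wc eq by (simp add: a_minus_def P.hom_add P.hom_minus P.N.M.r_neg)
      then have "w \<ominus>\<^bsub>K i\<^esub> diff i u \<in> F i" using wc proj_eq_zero_iff by simp
      moreover have "w = (w \<ominus>\<^bsub>K i\<^esub> diff i u) \<oplus>\<^bsub>K i\<^esub> diff i u"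
        using wc by (simp add: a_minus_def K.sum.M.a_assoc K.sum.M.l_neg)
      ultimately show "w \<in> B i" unfolding B_def K.sum.mem_set_add_iff using u by blast
    qed
  qed
  moreover have "?b <+>\<^bsub>C i\<^esub> ?c = ?c"
    using P.N.set_add_least[OF c bc order_refl] P.N.set_add_upper(2)[OF b c] by blast
  ultimately show ?thesis
    using P.rel_length_vimage[OF b submodule_Z] by simp
qed

end

lemma sum_enat: "(\<Sum>x\<in>A. enat (f x)) = enat (\<Sum>x\<in>A. f x)"
  by (induction A rule: infinite_finite_induct) (simp_all add: zero_enat_def)

lemma (in ideal) ideal_prod_subset:
  assumes "\<And>x a. x \<in> A \<Longrightarrow> a \<in> H \<Longrightarrow> x \<otimes> a \<in> I"
  shows "A \<cdot> H \<subseteq> I"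
proof
  fix r assume "r \<in> A \<cdot> H"
  then show "r \<in> I" by (induction rule: ideal_prod.induct) (use assms in auto)
qed

section \<open>The Euler characteristic\<close>

context bigraded_koszul
begin

lemma rel_length_F_K:
  "rel_length R (K i) (F i) (carrier (K i)) =
    (\<Sum>S\<in>subsets_of_card n i. ring_length (J S) (carrier R))"
  unfolding F_def using K.rel_length_direct_sum[OF finite_subsets_of_card, where F = J] submodule_J by simp

text \<open>The differential induces an isomorphism of \<open>K (Suc i) / Z (Suc i)\<close> with
  \<open>B i / F i\<close>, since \<open>Z (Suc i)\<close> is the preimage of
  \<open>F i\<close>.\<close>

lemma rel_length_Z_K:
  "rel_length R (K (Suc i)) (Z (Suc i)) (carrier (K (Suc i))) = rel_length R (K i) (F i) (B i)"
  using D.rel_length_vimage[OF submodule_F K.sum.carrier_is_submodule, of i]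
  by (simp add: Z_def B_def)

lemma rel_length_F_K_0:
  "rel_length R (K 0) (F 0) (carrier (K 0)) =
    rel_length R (K 0) (F 0) (B 0) + rel_length R (K 0) (B 0) (Z 0)"
proof -
  have "Z 0 = carrier (K 0)" by (simp add: Z_def)
  then show ?thesis
    using K.sum.rel_length_add[OF submodule_F submodule_B submodule_Z F_subset_B B_subset_Z, of 0]
    by simp
qed

lemma rel_length_F_K_Suc:
  "rel_length R (K (Suc i)) (F (Suc i)) (carrier (K (Suc i))) =
    rel_length R (K (Suc i)) (F (Suc i)) (B (Suc i)) +
    rel_length R (K (Suc i)) (B (Suc i)) (Z (Suc i)) + rel_length R (K i) (F i) (B i)"
  using K.sum.rel_length_add[OF submodule_F submodule_Z K.sum.carrier_is_submodule
      order_trans[OF F_subset_B B_subset_Z] Z_subset_K, of "Suc i"]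
    K.sum.rel_length_add[OF submodule_F submodule_B submodule_Z F_subset_B B_subset_Z, of "Suc i"]
    rel_length_Z_K
  by simp

text \<open>With \<open>a i\<close> for the length of \<open>B i / F i\<close>, the term of degree
  \<open>Suc i\<close> has length \<open>a (Suc i)\<close> plus the homology length plus
  \<open>a i\<close>. So the alternating sum up to \<open>N\<close> telescopes to that of the
  homology lengths, with the single error term \<open>(- 1) ^ N * int (a N)\<close>. Summing to
  \<open>Suc n\<close>, one degree past the complex, makes this error zero.\<close>

lemma euler_characteristic:
  assumes fin: "\<And>S. ring_length (J S) (carrier R) \<noteq> \<infinity>"
  shows "(\<Sum>i=0..Suc n. (- 1) ^ i *
      int (\<Sum>S\<in>subsets_of_card n i. the_enat (ring_length (J S) (carrier R)))) =
    (\<Sum>i=0..Suc n. (- 1) ^ i * int (h_len R I\<^sub>1 I\<^sub>2 xs\<^sub>1 xs\<^sub>2 n\<^sub>1 n\<^sub>2 i))"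
    and "homology_length i \<noteq> \<infinity>"
    and "n < i \<Longrightarrow> h_len R I\<^sub>1 I\<^sub>2 xs\<^sub>1 xs\<^sub>2 n\<^sub>1 n\<^sub>2 i = 0"
proof -
  define L where "L i = (\<Sum>S\<in>subsets_of_card n i. the_enat (ring_length (J S) (carrier R)))" for i
  define a where "a i = the_enat (rel_length R (K i) (F i) (B i))" for i
  let ?h = "h_len R I\<^sub>1 I\<^sub>2 xs\<^sub>1 xs\<^sub>2 n\<^sub>1 n\<^sub>2"
  have L: "rel_length R (K i) (F i) (carrier (K i)) = enat (L i)" for i
  proof -
    have "ring_length (J S) (carrier R) =
        enat (the_enat (ring_length (J S) (carrier R)))" for S
      using fin[of S] by auto
    then show ?thesis unfolding rel_length_F_K L_def sum_enat[symmetric] by simp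
  qed
  have sub: "F i \<subseteq> B i" "B i \<subseteq> Z i" "Z i \<subseteq> carrier (K i)" for i
    using F_subset_B B_subset_Z Z_subset_K by auto
  have "rel_length R (K i) (F i) (B i) \<le> enat (L i)" for i
    unfolding L[symmetric] using sub[of i] by (intro rel_length_mono) auto
  then have a: "rel_length R (K i) (F i) (B i) = enat (a i)" for i
    unfolding a_def by (metis enat_ile the_enat.simps)
  have "rel_length R (K i) (B i) (Z i) \<le> enat (L i)" for i
    unfolding L[symmetric] using sub[of i] by (intro rel_length_mono) auto
  then have h: "rel_length R (K i) (B i) (Z i) = enat (?h i)" for i
    unfolding h_len_def len_def module_length_C_homology by (metis enat_ile the_enat.simps)
  show "homology_length i \<noteq> \<infinity>"
    unfolding module_length_C_homology h by simp
  have L0: "L 0 = a 0 + ?h 0"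
    using rel_length_F_K_0 unfolding L a h by simp
  have LS: "L (Suc i) = a (Suc i) + ?h (Suc i) + a i" for i
    using rel_length_F_K_Suc[of i] unfolding L a h by simp
  have big: "L i = 0" if "n < i" for i
    using subsets_of_card_empty[OF that] by (simp add: L_def)
  have large: "?h i = 0 \<and> a (i - 1) = 0" if "n < i" for i
    using LS[of "i - 1"] big[OF that] that by (cases i) auto
  then show "n < i \<Longrightarrow> ?h i = 0" by blast
  have alt: "(\<Sum>i=0..N. (- 1) ^ i * int (L i)) = (\<Sum>i=0..N. (- 1) ^ i * int (?h i)) + (- 1) ^ N * int (a N)" for N
  proof (induction N)
    case 0
    show ?case by (simp add: L0)
  next
    case (Suc N)
    then show ?case by (simp add: LS algebra_simps)
  qed
  have "a (Suc n) = 0" using large[of "Suc (Suc n)"] by simp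
  then show "(\<Sum>i=0..Suc n. (- 1) ^ i *
      int (\<Sum>S\<in>subsets_of_card n i. the_enat (ring_length (J S) (carrier R)))) =
    (\<Sum>i=0..Suc n. (- 1) ^ i * int (?h i))"
    unfolding L_def[symmetric] alt by (simp only: of_nat_0 mult_zero_right add_0_right)
qed

section \<open>Homology in degrees zero and one\<close>

lemma J_empty: "J {} = \<F> n\<^sub>1 n\<^sub>2"
  by (simp add: comp_ideal_def)

lemma empty_in_subsets_of_card [simp]: "{} \<in> subsets_of_card m 0"
  by (simp add: subsets_of_card_def)

lemma subsets_of_card_0: "subsets_of_card m 0 = {{}}"
  using finite_subset[of _ "{..<m}"] by (auto simp: subsets_of_card_def)

lemma singleton_in_subsets_of_card [simp]: "{s} \<in> subsets_of_card m (Suc 0) \<longleftrightarrow> s < m"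
  by (simp add: subsets_of_card_def)

text \<open>The last Koszul differential, with \<open>K 0\<close> identified with \<open>R\<close>
  through its only index set \<open>{}\<close>.\<close>

definition aug :: "(nat set \<Rightarrow> 'a) \<Rightarrow> 'a" where
  "aug w = diff 0 w {}"

sublocale E: module_hom R "K 0" "ring_module R" "\<lambda>w. w {}"
  by (rule K.module_hom_component) simp

sublocale aug: module_hom R "K (Suc 0)" "ring_module R" aug
  by (intro module_hom.intro module_hom_axioms.intro K.sum.module_axioms ring_module_module)
    (auto simp: aug_def D.hom_add D.hom_smult E.hom_add E.hom_smult simp del: ring_module_simps)

lemma aug_eq:
  assumes "w \<in> carrier (K (Suc 0))"
  shows "aug w = (\<Oplus>s\<in>{..<length ys}. ys ! s \<otimes> w {s})"
proof -
  have "aug w = (\<Oplus>s\<in>{..<length ys} - {}. sign (card {t \<in> {}. t < s}) \<otimes> (ys ! s \<otimes> w {s}))"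
    by (simp add: aug_def diff_def koszul_diff_eq)
  also have "\<dots> = (\<Oplus>s\<in>{..<length ys}. ys ! s \<otimes> w {s})"
    using assms by (intro finsum_cong') (auto simp: carrier_K PiE_iff)
  finally show ?thesis .
qed

definition single :: "nat \<Rightarrow> 'a \<Rightarrow> nat set \<Rightarrow> 'a" where
  "single j a = (\<lambda>S\<in>subsets_of_card n (Suc 0). if S = {j} then a else \<zero>)"

lemma aug_single:
  assumes j: "j < n" and a: "a \<in> carrier R"
  shows "single j a \<in> carrier (K (Suc 0))" "aug (single j a) = ys ! j \<otimes> a"
proof -
  show c: "single j a \<in> carrier (K (Suc 0))" using a by (auto simp: single_def carrier_K)
  have "aug (single j a) = (\<Oplus>s\<in>{..<length ys}. if j = s then ys ! s \<otimes> a else \<zero>)"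
    unfolding aug_eq[OF c] using a by (intro finsum_cong') (auto simp: single_def)
  also have "\<dots> = ys ! j \<otimes> a"
    using finsum_singleton[of j "{..<length ys}" "\<lambda>s. ys ! s \<otimes> a"] a j by auto
  finally show "aug (single j a) = ys ! j \<otimes> a" .
qed

lemma single_in_F: "a \<in> J {j} \<Longrightarrow> single j a \<in> F (Suc 0)"
  using additive_subgroup.zero_closed[OF ideal.axioms(1)[OF ideal_J]]
  by (auto simp: single_def F_def)

lemma ideal_aug_image: "submodule W R (K (Suc 0)) \<Longrightarrow> ideal (aug ` W) R"
  using aug.submodule_image by (simp add: submodule_ring_module_iff)

lemma aug_image_K: "aug ` carrier (K (Suc 0)) = Idl (set ys)"
proof
  interpret X: ideal "Idl (set ys)" R using ys_closed by (rule genideal_ideal)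
  show "aug ` carrier (K (Suc 0)) \<subseteq> Idl (set ys)"
  proof
    fix r assume "r \<in> aug ` carrier (K (Suc 0))"
    then obtain w where w: "w \<in> carrier (K (Suc 0))" "r = aug w" by blast
    have "ys ! s \<otimes> w {s} \<in> Idl (set ys)" if "s < length ys" for s
    proof (rule X.I_r_closed)
      show "ys ! s \<in> Idl (set ys)" using genideal_self[OF ys_closed] nth_mem[OF that] by blast
      show "w {s} \<in> carrier R" using w(1) that by (auto simp: carrier_K PiE_iff)
    qed
    then show "r \<in> Idl (set ys)" unfolding w(2) aug_eq[OF w(1)] by (intro X.finsum_mem) auto
  qed
  have "set ys \<subseteq> aug ` carrier (K (Suc 0))"
  proof
    fix y assume "y \<in> set ys"
    then obtain j where j: "j < length ys" "y = ys ! j" by (metis in_set_conv_nth)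
    then have "y = aug (single j \<one>)" using aug_single(2)[of j \<one>] ys_nth[OF j(1)] by simp
    then show "y \<in> aug ` carrier (K (Suc 0))" using aug_single(1)[of j \<one>] j by auto
  qed
  then show "Idl (set ys) \<subseteq> aug ` carrier (K (Suc 0))"
    using ideal_aug_image[OF K.sum.carrier_is_submodule] by (intro genideal_minimal)
qed

lemma mem_F_0_iff: "w \<in> carrier (K 0) \<Longrightarrow> w \<in> F 0 \<longleftrightarrow> w {} \<in> J {}"
  unfolding F_def carrier_K by (auto simp: subsets_of_card_0 PiE_iff)

text \<open>In the definition of \<^const>\<open>reduction_quot\<close>, the operator \<open>Idl\<close> applies to the whole
  product: its summands are \<open>Idl (set xs \<cdot> F)\<close>, not \<open>(Idl (set xs)) \<cdot> F\<close>.\<close>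

definition G :: "'a set" where
  "G = Idl (set xs\<^sub>1 \<cdot> \<F> (n\<^sub>1 - 1) n\<^sub>2) <+>\<^bsub>R\<^esub> Idl (set xs\<^sub>2 \<cdot> \<F> n\<^sub>1 (n\<^sub>2 - 1))"

lemma J_singleton:
  "J {s} = (if s < length xs\<^sub>1 then \<F> (n\<^sub>1 - 1) n\<^sub>2 else \<F> n\<^sub>1 (n\<^sub>2 - 1))"
proof -
  have "{s} \<inter> {..<length xs\<^sub>1} = (if s < length xs\<^sub>1 then {s} else {})"
    "{s} - {..<length xs\<^sub>1} = (if s < length xs\<^sub>1 then {} else {s})" by auto
  then show ?thesis by (simp add: comp_ideal_def)
qed

lemma xs_closed: "set xs\<^sub>1 \<subseteq> carrier R" "set xs\<^sub>2 \<subseteq> carrier R"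
  using ys_closed by auto

lemma filt_closed: "\<F> a b \<subseteq> carrier R"
  using ideal.Icarr[OF ideal_filt[OF ideal_I1 ideal_I2]] by blast

lemma parts_closed:
  "set xs\<^sub>1 \<cdot> \<F> (n\<^sub>1 - 1) n\<^sub>2 \<subseteq> carrier R"
  "set xs\<^sub>2 \<cdot> \<F> n\<^sub>1 (n\<^sub>2 - 1) \<subseteq> carrier R"
  using xs_closed filt_closed by (intro ideal.ideal_prod_subset[OF oneideal]; blast)+

lemma ideal_parts:
  "ideal (Idl (set xs\<^sub>1 \<cdot> \<F> (n\<^sub>1 - 1) n\<^sub>2)) R"
  "ideal (Idl (set xs\<^sub>2 \<cdot> \<F> n\<^sub>1 (n\<^sub>2 - 1))) R"
  using parts_closed by (simp_all add: genideal_ideal)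

lemma ideal_G: "ideal G R"
  unfolding G_def using ideal_parts by (rule add_ideals)

text \<open>The denominator of the quotient in the statement is the image of the degree-one part of
  the subcomplex: the coefficient ideal \<open>J {s}\<close> is the filtration ideal with lowered
  first exponent for \<open>s < length xs\<^sub>1\<close>, and the one with lowered second exponent
  otherwise.\<close>

lemma aug_image_F: "aug ` F (Suc 0) = G"
proof
  interpret G: ideal G R by (rule ideal_G)
  note up = self.set_add_upper[unfolded submodule_ring_module_iff, OF ideal_parts, simplified]
  show "aug ` F (Suc 0) \<subseteq> G"
  proof
    fix r assume "r \<in> aug ` F (Suc 0)"
    then obtain w where w: "w \<in> F (Suc 0)" "r = aug w" by blast
    have wc: "w \<in> carrier (K (Suc 0))" using K.sum.submodule_simps(2)[OF submodule_F w(1)] .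
    have "ys ! s \<otimes> w {s} \<in> G" if s: "s < length ys" for s
    proof -
      have wJ: "w {s} \<in> J {s}" using w(1) s by (auto simp: F_def PiE_iff)
      show ?thesis
      proof (cases "s < length xs\<^sub>1")
        case True
        then have "ys ! s \<otimes> w {s} \<in> set xs\<^sub>1 \<cdot> \<F> (n\<^sub>1 - 1) n\<^sub>2"
          using wJ by (intro ideal_prod.prod) (simp_all add: J_singleton nth_append)
        then show ?thesis unfolding G_def using up(1) genideal_self[OF parts_closed(1)] by blast
      next
        case False
        then have "ys ! s \<otimes> w {s} \<in> set xs\<^sub>2 \<cdot> \<F> n\<^sub>1 (n\<^sub>2 - 1)"
          using wJ s by (intro ideal_prod.prod) (simp_all add: J_singleton nth_append)
        then show ?thesis unfolding G_def using up(2) genideal_self[OF parts_closed(2)] by blast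
      qed
    qed
    then show "r \<in> G" unfolding w(2) aug_eq[OF wc] by (intro G.finsum_mem) auto
  qed
  let ?E = "aug ` F (Suc 0)"
  have E: "ideal ?E R" by (rule ideal_aug_image[OF submodule_F])
  have gen: "ys ! s \<otimes> a \<in> ?E" if "s < n" "a \<in> J {s}" for s a
    using aug_single(2)[of s a] single_in_F[OF that(2)] that ideal.Icarr[OF ideal_J that(2)]
    by (metis image_eqI)
  have "Idl (set xs\<^sub>1 \<cdot> \<F> (n\<^sub>1 - 1) n\<^sub>2) \<subseteq> ?E"
  proof (intro genideal_minimal[OF E] ideal.ideal_prod_subset[OF E])
    fix x a assume x: "x \<in> set xs\<^sub>1" and a: "a \<in> \<F> (n\<^sub>1 - 1) n\<^sub>2"
    then obtain s where "s < length xs\<^sub>1" "x = xs\<^sub>1 ! s" by (metis in_set_conv_nth)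
    then show "x \<otimes> a \<in> ?E" using gen[of s a] a by (simp add: J_singleton nth_append)
  qed
  moreover have "Idl (set xs\<^sub>2 \<cdot> \<F> n\<^sub>1 (n\<^sub>2 - 1)) \<subseteq> ?E"
  proof (intro genideal_minimal[OF E] ideal.ideal_prod_subset[OF E])
    fix x a assume x: "x \<in> set xs\<^sub>2" and a: "a \<in> \<F> n\<^sub>1 (n\<^sub>2 - 1)"
    then obtain s where "s < length xs\<^sub>2" "x = xs\<^sub>2 ! s" by (metis in_set_conv_nth)
    then show "x \<otimes> a \<in> ?E" using gen[of "length xs\<^sub>1 + s" a] a by (simp add: J_singleton nth_append)
  qed
  ultimately show "G \<subseteq> ?E"
    unfolding G_def using self.set_add_least[unfolded submodule_ring_module_iff, OF E] by simp
qed

lemma G_subset_J: "G \<subseteq> J {}"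
proof
  fix r assume "r \<in> G"
  then obtain w where "w \<in> F (Suc 0)" "r = diff 0 w {}" unfolding aug_image_F[symmetric] aug_def by blast
  then show "r \<in> J {}" using diff_F[of w 0] by (auto simp: F_def PiE_iff)
qed

lemma G_subset_Idl: "G \<subseteq> Idl (set ys)"
proof -
  have "F (Suc 0) \<subseteq> carrier (K (Suc 0))" using K.sum.submodule_simps(2)[OF submodule_F] by blast
  then show ?thesis unfolding aug_image_F[symmetric] aug_image_K[symmetric] by (rule image_mono)
qed

lemma module_length_reduction_quot:
  "reduction_length = ring_length G (J {})"
  unfolding reduction_quot_def G_def[symmetric] J_empty[symmetric]
  by (intro module_length_quot_restrict ring_module_module submodule_J G_subset_J)
    (simp add: submodule_ring_module_iff ideal_G)

text \<open>Evaluation at \<open>{}\<close> is injective on \<open>K 0\<close>; it carries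
  \<open>Z 0\<close> onto \<open>R\<close>, \<open>F 0\<close> onto \<open>J {}\<close> and the
  Koszul boundaries onto the ideal of the sequence.\<close>

lemma module_length_C_homology_0:
  "homology_length 0 =
    ring_length (J {} <+>\<^bsub>R\<^esub> Idl (set ys)) (carrier R)"
proof -
  let ?e = "\<lambda>w::nat set \<Rightarrow> 'a. w {}"
  have K0: "\<And>w. w \<in> carrier (K 0) \<longleftrightarrow> w {} \<in> carrier R \<and> w \<in> extensional {{}}"
    unfolding carrier_K by (auto simp: subsets_of_card_0 PiE_iff)
  have e_surj: "?e ` W = {r. (\<lambda>S\<in>{{}}. r) \<in> W}" if "W \<subseteq> carrier (K 0)" for W
  proof (intro Set.set_eqI iffI)
    fix r assume "r \<in> ?e ` W"
    then obtain w where w: "w \<in> W" "r = w {}" by blast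
    then have "w = (\<lambda>S\<in>{{}}. r)" using that K0 by (auto simp: extensional_def fun_eq_iff)
    then show "r \<in> {r. (\<lambda>S\<in>{{}}. r) \<in> W}" using w by simp
  next
    fix r assume "r \<in> {r. (\<lambda>S\<in>{{}}. r) \<in> W}"
    then show "r \<in> ?e ` W" by (intro image_eqI[where x = "\<lambda>S\<in>{{}}. r"]) auto
  qed
  have FK: "F 0 \<subseteq> carrier (K 0)" using K.sum.submodule_simps(2)[OF submodule_F] by blast
  have DK: "diff 0 ` carrier (K (Suc 0)) \<subseteq> carrier (K 0)" by auto
  have ZK: "Z 0 = carrier (K 0)" by (simp add: Z_def)
  have "?e ` Z 0 = carrier R"
    unfolding ZK e_surj[OF order_refl] by (auto simp: K0)
  moreover have "?e ` B 0 = J {} <+>\<^bsub>R\<^esub> Idl (set ys)"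
  proof -
    have "?e ` F 0 = J {}" unfolding e_surj[OF FK] by (auto simp: F_def subsets_of_card_0 PiE_iff)
    moreover have "?e ` diff 0 ` carrier (K (Suc 0)) = Idl (set ys)"
      unfolding aug_image_K[symmetric] aug_def by (simp add: image_image)
    moreover have "?e ` (A <+>\<^bsub>K 0\<^esub> A') = ?e ` A <+>\<^bsub>R\<^esub> ?e ` A'"
      if "A \<subseteq> carrier (K 0)" "A' \<subseteq> carrier (K 0)" for A A'
    proof (intro Set.set_eqI iffI)
      fix r assume "r \<in> ?e ` (A <+>\<^bsub>K 0\<^esub> A')"
      then show "r \<in> ?e ` A <+>\<^bsub>R\<^esub> ?e ` A'"
        by (auto simp: K.sum.mem_set_add_iff set_add_def' direct_sum_module_simps) blast
    next
      fix r assume "r \<in> ?e ` A <+>\<^bsub>R\<^esub> ?e ` A'"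
      then obtain a b where ab: "a \<in> A" "b \<in> A'" "r = a {} \<oplus> b {}" by (auto simp: set_add_def')
      then have "a \<oplus>\<^bsub>K 0\<^esub> b \<in> A <+>\<^bsub>K 0\<^esub> A'" unfolding K.sum.mem_set_add_iff by blast
      moreover have "r = (a \<oplus>\<^bsub>K 0\<^esub> b) {}" using ab by (simp add: direct_sum_module_simps)
      ultimately show "r \<in> ?e ` (A <+>\<^bsub>K 0\<^esub> A')" by blast
    qed
    ultimately show ?thesis unfolding B_def using FK DK by simp
  qed
  moreover have "w \<in> B 0" if "w \<in> Z 0" "w {} = \<zero>\<^bsub>ring_module R\<^esub>" for w
  proof -
    have "w \<in> F 0" using that mem_F_0_iff[of w] ZK additive_subgroup.zero_closed[OF ideal.axioms(1)[OF ideal_J]]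
      by simp
    then show ?thesis using F_subset_B by blast
  qed
  ultimately show ?thesis
    using E.rel_length_image[OF submodule_B submodule_Z B_subset_Z]
    by (simp add: module_length_C_homology)
qed

text \<open>\<open>aug\<close> maps \<open>Z (Suc 0)\<close> onto
  \<open>Idl (set ys) \<inter> J {}\<close> and \<open>B (Suc 0)\<close> onto \<open>G\<close>. Its
  kernel consists of Koszul cycles, which are boundaries by exactness and so lie in
  \<open>B (Suc 0)\<close>; hence no length is lost.\<close>

lemma module_length_C_homology_1:
  assumes ex: "exact_above {\<zero>} (Suc 0)"
  shows "homology_length (Suc 0) =
    ring_length G (Idl (set ys) \<inter> J {})"
proof -
  have "aug ` Z (Suc 0) = Idl (set ys) \<inter> J {}"
  proof -
    have "w \<in> Z (Suc 0) \<longleftrightarrow> aug w \<in> J {}" if "w \<in> carrier (K (Suc 0))" for w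
      using that mem_F_0_iff[of "diff 0 w"] by (simp add: Z_def aug_def)
    then show ?thesis
      unfolding aug_image_K[symmetric] using Z_subset_K[of "Suc 0"] by blast
  qed
  moreover have "aug ` B (Suc 0) = G"
  proof
    show "aug ` B (Suc 0) \<subseteq> G"
    proof (clarify)
      fix w assume "w \<in> B (Suc 0)"
      then obtain f v where fv: "f \<in> F (Suc 0)" "v \<in> carrier (K (Suc (Suc 0)))"
        "w = f \<oplus>\<^bsub>K (Suc 0)\<^esub> diff (Suc 0) v" unfolding B_def K.sum.mem_set_add_iff by blast
      have fc: "f \<in> carrier (K (Suc 0))" using K.sum.submodule_simps(2)[OF submodule_F fv(1)] .
      have "aug (diff (Suc 0) v) = \<zero>" using diff_diff[OF fv(2)] by (simp add: aug_def direct_sum_module_simps)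
      moreover have "aug w = aug f \<oplus> aug (diff (Suc 0) v)"
        unfolding fv(3) using aug.hom_add[OF fc D.hom_closed[OF fv(2)]] by simp
      ultimately have "aug w = aug f" using aug.hom_closed[OF fc] by simp
      then show "aug w \<in> G" unfolding aug_image_F[symmetric] using fv(1) by simp
    qed
    show "G \<subseteq> aug ` B (Suc 0)" unfolding aug_image_F[symmetric] using F_subset_B by blast
  qed
  moreover have "w \<in> B (Suc 0)" if w: "w \<in> Z (Suc 0)" and 0: "aug w = \<zero>\<^bsub>ring_module R\<^esub>" for w
  proof -
    have wc: "w \<in> carrier (K (Suc 0))" using w Z_subset_K by blast
    define z where "z = zero_ext (Suc 0) w"
    have z: "chain z" unfolding z_def by (rule chain_zero_ext[OF wc])
    have fin: "finite S" if "S \<subseteq> {..<length ys}" for S using that finite_subset by blast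
    have "above (Suc 0) z" by (auto simp: above_def z_def zero_ext_def subsets_of_card_def)
    moreover have "\<delta> z T \<in> {\<zero>}" if T: "T \<subseteq> {..<length ys}" for T
    proof (cases "T = {}")
      case True
      then show ?thesis
        using koszul_diff_zero_ext[OF wc, of "{}"] 0 by (simp add: z_def aug_def diff_def)
    next
      case False
      have "\<delta> z T = \<delta> (\<lambda>_. \<zero>) T"
        using False fin[OF T] T
        by (intro koszul_diff_cong) (auto simp: chain_def z_def zero_ext_def subsets_of_card_def)
      then show ?thesis using koszul_diff_zero[OF T] by simp
    qed
    ultimately obtain u where u: "chain u" and zu: "\<And>S. S \<subseteq> {..<length ys} \<Longrightarrow> z S \<ominus> \<delta> u S \<in> {\<zero>}"
      using ex z unfolding exact_above_def by blast
    \<comment> \<open>Exactness provides a chain of mixed degrees, but on singletons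
      \<open>\<delta>\<close> only reads the coefficients at sets of two elements.\<close>
    define u' where "u' = (\<lambda>S\<in>subsets_of_card n (Suc (Suc 0)). u S)"
    have u': "u' \<in> carrier (K (Suc (Suc 0)))"
      using u subset_lessThan by (auto simp: u'_def carrier_K)
    have "w = diff (Suc 0) u'"
    proof
      fix S
      show "w S = diff (Suc 0) u' S"
      proof (cases "S \<in> subsets_of_card n (Suc 0)")
        case True
        have sub: "S \<subseteq> {..<length ys}" using True by (rule subset_lessThan)
        have "w S = z S" using True by (simp add: z_def zero_ext_def)
        also have "\<dots> = \<delta> u S"
          using zu[OF sub] z u sub by (simp add: r_right_minus_eq)
        also have "\<dots> = \<delta> u' S"
          using u sub True by (intro koszul_diff_cong[symmetric])
            (auto simp: u'_def insert_in_subsets_of_card)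
        finally show ?thesis using True by (simp add: diff_def)
      next
        case False
        then show ?thesis using wc by (auto simp: diff_def carrier_K PiE_iff extensional_def)
      qed
    qed
    then show ?thesis using diff_subset_B[of "Suc 0"] u' by blast
  qed
  ultimately show ?thesis
    using aug.rel_length_image[OF submodule_B submodule_Z B_subset_Z]
    by (simp add: module_length_C_homology)
qed

text \<open>With \<open>(x)\<close> for the ideal of the sequence, the quotients of
  \<open>J {}\<close> by \<open>J {} \<inter> (x)\<close> and of \<open>(x) + J {}\<close> by
  \<open>(x)\<close> are isomorphic, so the lengths of \<open>J {} / G\<close> and of
  \<open>R / (x)\<close> share this summand. Sums on both sides keep the identity valid in
  \<open>enat\<close>, where subtraction would require finiteness.\<close>

lemma reduction_homology_length:
  assumes ex: "exact_above {\<zero>} (Suc 0)"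
  shows "reduction_length +
      homology_length 0 =
    homology_length (Suc 0) +
      ring_length (Idl (set ys)) (carrier R)"
proof -
  let ?X = "Idl (set ys)" and ?M = "ring_module R"
  have X: "submodule ?X R ?M" using genideal_ideal[OF ys_closed] by (simp add: submodule_ring_module_iff)
  have G: "submodule G R ?M" by (simp add: submodule_ring_module_iff ideal_G)
  have XJ: "submodule (?X <+>\<^bsub>R\<^esub> J {}) R ?M" using self.submodule_set_add[OF X submodule_J] by simp
  interpret id: module_hom R ?M ?M "\<lambda>r. r"
    by (intro module_hom.intro module_hom_axioms.intro ring_module_module) simp_all
  have "ring_length G (J {}) = ring_length G (?X \<inter> J {}) + ring_length (?X \<inter> J {}) (J {})"
    using G_subset_J G_subset_Idl
    by (intro self.rel_length_add G submodule_J self.submodule_inter X) auto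
  moreover have "{r \<in> J {}. r \<in> ?X} = ?X \<inter> J {}" by blast
  then have "ring_length (?X \<inter> J {}) (J {}) = ring_length ?X (?X <+>\<^bsub>R\<^esub> J {})"
    using id.rel_length_vimage[OF X submodule_J[of "{}"]] by simp
  moreover have "ring_length ?X (carrier R) =
      ring_length ?X (?X <+>\<^bsub>R\<^esub> J {}) + ring_length (?X <+>\<^bsub>R\<^esub> J {}) (carrier R)"
    using self.rel_length_add[OF X XJ self.carrier_is_submodule] self.set_add_upper(1)[OF X submodule_J]
      self.submodule_simps(2)[OF XJ] by auto
  moreover have "?X <+>\<^bsub>R\<^esub> J {} = J {} <+>\<^bsub>R\<^esub> ?X"
    using genideal_ideal[OF ys_closed] ideal_J[of "{}"] set_add_comm
    by (auto simp: ideal.Icarr intro!: set_add_comm)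
  ultimately show ?thesis
    by (simp add: module_length_reduction_quot module_length_C_homology_0 module_length_C_homology_1[OF ex]
        ac_simps)
qed

end

section \<open>Noetherian local rings\<close>

lemma (in noetherian_ring) maximal_ideal_in_family:
  assumes "\<A> \<noteq> {}" "\<And>I. I \<in> \<A> \<Longrightarrow> ideal I R"
  shows "\<exists>M\<in>\<A>. \<forall>I\<in>\<A>. M \<subseteq> I \<longrightarrow> I = M"
proof (rule subset_Zorn_nonempty[OF assms(1)])
  fix C assume C: "C \<noteq> {}" "subset.chain \<A> C"
  have "C \<subseteq> \<A>" using C(2) by (auto simp: pred_on.chain_def)
  have "subset.chain {I. ideal I R} C"
    using C(2) assms(2) unfolding pred_on.chain_def by blast
  then have "\<Union>C \<in> C" by (rule ideal_chain_is_trivial[OF C(1)])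
  then show "\<Union>C \<in> \<A>" using \<open>C \<subseteq> \<A>\<close> by blast
qed

locale noetherian_local = cring R for R (structure) +
  fixes m
  assumes local_ring: "local_ring R m"
begin

sublocale noetherian_ring R
  using local_ring by (simp add: local_ring_def)

sublocale m: maximalideal m R
  using local_ring by (simp add: local_ring_def)

text \<open>If \<open>a\<close> generated a proper ideal, a maximal ideal above it, which exists as
  \<open>R\<close> is noetherian, would be \<open>m\<close> and contain \<open>a\<close>.\<close>

lemma inverse_if_not_in_m:
  assumes a: "a \<in> carrier R" "a \<notin> m"
  obtains b where "b \<in> carrier R" "a \<otimes> b = \<one>"
proof -
  have "PIdl a = carrier R"
  proof (rule ccontr)
    assume ne: "PIdl a \<noteq> carrier R"
    let ?A = "{I. ideal I R \<and> PIdl a \<subseteq> I \<and> I \<noteq> carrier R}"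
    have "?A \<noteq> {}" using ne cgenideal_ideal[OF a(1)] by auto
    moreover have "\<And>I. I \<in> ?A \<Longrightarrow> ideal I R" by simp
    ultimately have "\<exists>M\<in>?A. \<forall>I\<in>?A. M \<subseteq> I \<longrightarrow> I = M" by (rule maximal_ideal_in_family)
    then obtain M where M: "M \<in> ?A" "\<forall>I\<in>?A. M \<subseteq> I \<longrightarrow> I = M" by (elim bexE)
    have "maximalideal M R"
    proof (rule maximalidealI)
      fix I assume "ideal I R" "M \<subseteq> I" "I \<subseteq> carrier R"
      then show "I = M \<or> I = carrier R" using M by blast
    qed (use M in auto)
    then have "M = m" using local_ring by (simp add: local_ring_def)
    then show False using M(1) a cgenideal_self[OF a(1)] by blast
  qed
  then have "\<one> \<in> PIdl a" by simp
  then obtain b where "b \<in> carrier R" "\<one> = b \<otimes> a" by (auto simp: cgenideal_def)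
  then show thesis using that[of b] a by (simp add: m_comm)
qed

lemma mem_if_mult_unit_mem:
  assumes X: "ideal X R" and u: "u \<in> carrier R" "u \<notin> m" and b: "b \<in> carrier R" "u \<otimes> b \<in> X"
  shows "b \<in> X"
proof -
  interpret X: ideal X R by (rule X)
  obtain v where v: "v \<in> carrier R" "u \<otimes> v = \<one>" using inverse_if_not_in_m[OF u] .
  have "v \<otimes> (u \<otimes> b) \<in> X" using v b by (simp add: X.I_l_closed)
  moreover have "v \<otimes> (u \<otimes> b) = (u \<otimes> v) \<otimes> b" using u v b by algebra
  ultimately show ?thesis using v b by simp
qed

lemma one_minus_not_in_m: "c \<in> m \<Longrightarrow> \<one> \<ominus> c \<notin> m"
proof
  assume c: "c \<in> m" "\<one> \<ominus> c \<in> m"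
  have "(\<one> \<ominus> c) \<oplus> c \<in> m" using c by simp
  moreover have "(\<one> \<ominus> c) \<oplus> c = \<one>" using m.Icarr[OF c(1)] by algebra
  ultimately show False using m.I_notcarr m.one_imp_carrier by auto
qed

text \<open>Nakayama's lemma for one generator: the unit
  \<open>\<one> \<ominus> a \<otimes> r\<close> multiplies \<open>b\<close> into
  \<open>X\<close>.\<close>

lemma mem_if_minus_mult_mem:
  assumes "ideal X R" and a: "a \<in> m" and b: "b \<in> carrier R" and r: "r \<in> carrier R"
    and mem: "b \<ominus> (a \<otimes> b) \<otimes> r \<in> X"
  shows "b \<in> X"
proof (rule mem_if_mult_unit_mem[OF assms(1)])
  have ac: "a \<in> carrier R" using a by (rule m.Icarr)
  show "\<one> \<ominus> a \<otimes> r \<notin> m" using a r by (intro one_minus_not_in_m) (simp add: m.I_r_closed)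
  show "\<one> \<ominus> a \<otimes> r \<in> carrier R" using ac r by simp
  have "(\<one> \<ominus> a \<otimes> r) \<otimes> b = b \<ominus> (a \<otimes> b) \<otimes> r" using ac b r by algebra
  then show "(\<one> \<ominus> a \<otimes> r) \<otimes> b \<in> X" using mem by simp
qed (rule b)

definition m_radical :: "'a set \<Rightarrow> bool" where
  "m_radical X \<longleftrightarrow> ideal X R \<and> (\<forall>a\<in>m. \<exists>k::nat. a [^] k \<in> X)"

text \<open>Take \<open>b\<close> outside \<open>X\<close> with a maximal annihilator modulo
  \<open>X\<close>. If \<open>a \<otimes> b\<close> were outside \<open>X\<close> for some
  \<open>a\<close> in \<open>m\<close>, the last multiple \<open>a [^] i \<otimes> b\<close> still
  outside \<open>X\<close> would be annihilated by \<open>a\<close> and by everything that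
  annihilates \<open>b\<close>, against maximality.\<close>

lemma socle_element:
  assumes X: "m_radical X" "X \<noteq> carrier R"
  obtains b where "b \<in> carrier R" "b \<notin> X" "\<And>a. a \<in> m \<Longrightarrow> a \<otimes> b \<in> X"
proof -
  interpret X: ideal X R using X by (simp add: m_radical_def)
  define ann where "ann b = {a \<in> carrier R. a \<otimes> b \<in> X}" for b
  have ideal_ann: "ideal (ann b) R" if b: "b \<in> carrier R" for b
  proof -
    have "submodule (ann b) R (ring_module R)"
      by (rule self.submoduleI) (use b in \<open>auto simp: ann_def l_distr l_minus m_assoc X.I_l_closed\<close>)
    then show ?thesis by (simp add: submodule_ring_module_iff)
  qed
  let ?A = "ann ` (carrier R - X)"
  have "?A \<noteq> {}" using X(2) X.a_subset by blast
  moreover have "\<And>I. I \<in> ?A \<Longrightarrow> ideal I R" using ideal_ann by blast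
  ultimately have "\<exists>M\<in>?A. \<forall>I\<in>?A. M \<subseteq> I \<longrightarrow> I = M" by (rule maximal_ideal_in_family)
  then obtain M where M: "M \<in> ?A" "\<forall>I\<in>?A. M \<subseteq> I \<longrightarrow> I = M" by (elim bexE)
  then obtain b where b: "b \<in> carrier R" "b \<notin> X" "M = ann b" by blast
  have "a \<otimes> b \<in> X" if a: "a \<in> m" for a
  proof (rule ccontr)
    assume ab: "a \<otimes> b \<notin> X"
    have ac: "a \<in> carrier R" using a by (rule m.Icarr)
    obtain k :: nat where "a [^] k \<in> X" using X(1) a by (auto simp: m_radical_def)
    then have ex: "\<exists>k::nat. a [^] k \<otimes> b \<in> X" using b by (auto intro: X.I_r_closed)
    define j where "j = (LEAST k::nat. a [^] k \<otimes> b \<in> X)"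
    have j: "a [^] j \<otimes> b \<in> X" using LeastI_ex[OF ex] by (simp add: j_def)
    have "j \<noteq> 0" using j b by (intro notI) simp
    then obtain i where i: "j = Suc i" by (cases j) auto
    define c where "c = a [^] i \<otimes> b"
    have c: "c \<in> carrier R" "c \<notin> X"
      using ac b not_less_Least[of i "\<lambda>k. a [^] k \<otimes> b \<in> X"] i by (auto simp: c_def j_def[symmetric])
    have "ann b \<subseteq> ann c"
    proof
      fix x assume x: "x \<in> ann b"
      then have "a [^] i \<otimes> (x \<otimes> b) \<in> X" using ac by (auto simp: ann_def intro: X.I_l_closed)
      moreover have "a [^] i \<otimes> (x \<otimes> b) = x \<otimes> c" using ac b x by (simp add: c_def ann_def m_lcomm)
      ultimately show "x \<in> ann c" using x by (simp add: ann_def)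
    qed
    then have "ann c = ann b" using M b(3) c by blast
    moreover have "a \<otimes> c = a [^] j \<otimes> b"
      using ac b by (simp add: c_def i m_ac)
    then have "a \<in> ann c" using j ac by (simp add: ann_def)
    ultimately show False using ab by (simp add: ann_def)
  qed
  then show thesis using that b by blast
qed

lemma m_radical_superset: "m_radical X \<Longrightarrow> ideal Y R \<Longrightarrow> X \<subseteq> Y \<Longrightarrow> m_radical Y"
  unfolding m_radical_def by blast

text \<open>A maximal counterexample is a proper ideal, and adjoining a socle element enlarges it.
  The rule climbs from \<open>X\<close> to \<open>R\<close> along factors annihilated by
  \<open>m\<close>, in place of a composition series.\<close>

lemma m_radical_induct [consumes 1, case_names carrier step]:
  assumes X: "m_radical X" and carrier: "P (carrier R)"
    and step: "\<And>X b. m_radical X \<Longrightarrow> b \<in> carrier R \<Longrightarrow> (\<And>a. a \<in> m \<Longrightarrow> a \<otimes> b \<in> X) \<Longrightarrow>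
      P (adjoin X b) \<Longrightarrow> P X"
  shows "P X"
proof (rule ccontr)
  assume "\<not> P X"
  let ?A = "{Y. m_radical Y \<and> \<not> P Y}"
  have "?A \<noteq> {}" using X \<open>\<not> P X\<close> by blast
  moreover have "\<And>I. I \<in> ?A \<Longrightarrow> ideal I R" by (simp add: m_radical_def)
  ultimately have "\<exists>M\<in>?A. \<forall>I\<in>?A. M \<subseteq> I \<longrightarrow> I = M" by (rule maximal_ideal_in_family)
  then obtain M where M: "M \<in> ?A" "\<forall>I\<in>?A. M \<subseteq> I \<longrightarrow> I = M" by (elim bexE)
  then have "M \<noteq> carrier R" using carrier by auto
  then obtain b where b: "b \<in> carrier R" "b \<notin> M" "\<And>a. a \<in> m \<Longrightarrow> a \<otimes> b \<in> M"
    using socle_element[of M] M(1) by auto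
  have iM: "ideal M R" using M(1) by (simp add: m_radical_def)
  have "adjoin M b \<noteq> M" using adjoin_self[OF iM b(1)] b(2) by auto
  moreover have "m_radical (adjoin M b)"
    using m_radical_superset[OF _ ideal_adjoin[OF iM b(1)] adjoin_superset[OF iM b(1)]] M(1) by auto
  ultimately have "P (adjoin M b)" using M adjoin_superset[OF iM b(1)] by blast
  then show False using step[of M b] M(1) b by blast
qed

text \<open>Each step of the induction adds length at most one: an element of
  \<open>adjoin X b\<close> outside \<open>X\<close> is congruent to \<open>b \<otimes> r\<close>
  with \<open>r\<close> a unit, and therefore recovers \<open>b\<close>.\<close>

lemma finite_colength:
  assumes "m_radical X"
  shows "ring_length X (carrier R) \<noteq> \<infinity>"
  using assms
proof (induction rule: m_radical_induct)
  case carrier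
  show ?case by (simp add: rel_length_eq_0_if_superset)
next
  case (step X b)
  have X: "ideal X R" using step by (simp add: m_radical_def)
  note Xs = X[folded submodule_ring_module_iff]
  note As = ideal_adjoin[OF X step(2), folded submodule_ring_module_iff]
  let ?F = "{N. submodule N R (ring_module R) \<and> X \<subseteq> N \<and> N \<subseteq> adjoin X b}"
  have full: "N = adjoin X b" if N: "N \<in> ?F" "X \<noteq> N" for N
  proof -
    have iN: "ideal N R" using N by (simp add: submodule_ring_module_iff)
    interpret N: ideal N R by (rule iN)
    obtain e where e: "e \<in> N" "e \<notin> X" using N by blast
    then obtain r where r: "r \<in> carrier R" "e \<ominus> b \<otimes> r \<in> X" using N by (auto simp: adjoin_def)
    have ec: "e \<in> carrier R" using e by simp
    have "r \<notin> m"
    proof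
      assume "r \<in> m"
      then have "r \<otimes> b \<in> X" by (rule step(3))
      then have "(e \<ominus> b \<otimes> r) \<oplus> r \<otimes> b \<in> X" using r additive_subgroup.a_closed[OF ideal.axioms(1)[OF X]] by blast
      moreover have "(e \<ominus> b \<otimes> r) \<oplus> r \<otimes> b = e" using ec r step(2) by algebra
      ultimately show False using e by simp
    qed
    have "e \<ominus> (e \<ominus> b \<otimes> r) \<in> N" using e r N by (auto simp: a_minus_def)
    moreover have "e \<ominus> (e \<ominus> b \<otimes> r) = r \<otimes> b" using ec r step(2) by algebra
    ultimately have "b \<in> N" using mem_if_mult_unit_mem[OF iN r(1) \<open>r \<notin> m\<close> step(2)] by simp
    then show ?thesis using adjoin_least[OF iN, of X b] N by auto
  qed
  have ne: "?F \<noteq> {}" using Xs adjoin_superset[OF X step(2)] by blast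
  have "\<not> enat 2 \<le> ring_length X (adjoin X b)"
    unfolding rel_length_def enat_le_chain_length_iff[OF ne]
  proof
    assume "\<exists>N. (\<forall>i\<le>2. N i \<in> ?F) \<and> (\<forall>i<2. N i \<subset> N (Suc i))"
    then obtain N :: "nat \<Rightarrow> 'a set" where N: "\<forall>i\<le>2. N i \<in> ?F" "\<forall>i<2. N i \<subset> N (Suc i)" by blast
    have "N 0 \<subset> N 1" "N 1 \<subset> N 2" using N(2) by (auto simp: numeral_2_eq_2)
    moreover have "N 0 \<in> ?F" "N 1 \<in> ?F" "N 2 \<in> ?F" using N(1) by auto
    ultimately show False using full[of "N 1"] by blast
  qed
  then have "ring_length X (adjoin X b) \<noteq> \<infinity>" by (metis enat_ord_code(3))
  moreover have "ring_length X (carrier R) =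
      ring_length X (adjoin X b) + ring_length (adjoin X b) (carrier R)"
    using self.rel_length_add[OF Xs As self.carrier_is_submodule adjoin_superset[OF X step(2)]]
      self.submodule_simps(2)[OF As] by auto
  ultimately show ?case using step(4) by (simp only: plus_eq_infty_iff_enat simp_thms)
qed

text \<open>Each step of the induction costs one factor \<open>I\<close>: if a power lies in
  \<open>adjoin X b\<close>, one more factor from \<open>I \<subseteq> m\<close> sends
  \<open>b\<close> into \<open>X\<close>.\<close>

lemma power_subset:
  assumes "m_radical X" and I: "ideal I R" "I \<subseteq> m"
  shows "\<exists>k::nat. I [^]\<^bsub>ideals_set R\<^esub> k \<subseteq> X"
  using assms(1)
proof (induction rule: m_radical_induct)
  case carrier
  show ?case by (rule exI[of _ 0]) simp
next
  case (step X b)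
  then obtain k where k: "I [^]\<^bsub>ideals_set R\<^esub> (k::nat) \<subseteq> adjoin X b" by blast
  interpret X: ideal X R using step by (simp add: m_radical_def)
  have "(I [^]\<^bsub>ideals_set R\<^esub> k) \<cdot> I \<subseteq> X"
  proof (rule X.ideal_prod_subset)
    fix x a assume x: "x \<in> I [^]\<^bsub>ideals_set R\<^esub> k" and a: "a \<in> I"
    obtain r where r: "x \<in> carrier R" "r \<in> carrier R" "x \<ominus> b \<otimes> r \<in> X"
      using x k by (auto simp: adjoin_def)
    have ac: "a \<in> m" "a \<in> carrier R" using a I m.Icarr by auto
    have "(x \<ominus> b \<otimes> r) \<otimes> a \<oplus> (a \<otimes> b) \<otimes> r \<in> X"
      using r ac step(3)[OF ac(1)] by (simp add: X.I_r_closed)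
    moreover have "(x \<ominus> b \<otimes> r) \<otimes> a \<oplus> (a \<otimes> b) \<otimes> r = x \<otimes> a" using r ac step(2) by algebra
    ultimately show "x \<otimes> a \<in> X" by simp
  qed
  then show ?case by (intro exI[of _ "Suc k"]) simp
qed

text \<open>Krull's intersection theorem for the powers of one element. Let \<open>L\<close> be the
  intersection of the ideals \<open>adjoin X (a [^] N)\<close>. Since the colon ideals of
  \<open>X\<close> by the powers of \<open>a\<close> stabilise, every \<open>y \<in> L\<close> is
  \<open>a\<close> times some \<open>y' \<in> L\<close> modulo \<open>X\<close>. For
  \<open>y\<close> with \<open>adjoin X y\<close> maximal, \<open>y'\<close> is then a multiple of
  \<open>y\<close>, hence of \<open>a \<otimes> y'\<close>, modulo \<open>X\<close>; Nakayama's
  lemma puts \<open>y'\<close>, and with it all of \<open>L\<close>, into \<open>X\<close>.\<close>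

lemma principal_krull_intersection:
  assumes X: "ideal X R" and a: "a \<in> m" and b: "b \<in> carrier R"
    and inter: "\<And>N::nat. b \<in> adjoin X (a [^] N)"
  shows "b \<in> X"
proof -
  interpret X: ideal X R by (rule X)
  have ac: "a \<in> carrier R" using a by (rule m.Icarr)
  define C where "C k = {r \<in> carrier R. a [^] k \<otimes> r \<in> X}" for k :: nat
  have ideal_C: "ideal (C k) R" for k
  proof -
    have "submodule (C k) R (ring_module R)"
      by (rule self.submoduleI) (use ac in \<open>auto simp: C_def r_distr r_minus m_lcomm X.I_l_closed\<close>)
    then show ?thesis by (simp add: submodule_ring_module_iff)
  qed
  obtain c where c: "\<And>k. C c \<subseteq> C k \<Longrightarrow> C k = C c"
    using maximal_ideal_in_family[of "range C"] ideal_C by (metis UNIV_not_empty image_is_empty rangeE rangeI)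
  have "C c \<subseteq> C (Suc c)"
  proof
    fix r assume r: "r \<in> C c"
    then have "a \<otimes> (a [^] c \<otimes> r) \<in> X" using ac by (auto simp: C_def intro: X.I_l_closed)
    moreover have "a \<otimes> (a [^] c \<otimes> r) = a [^] Suc c \<otimes> r" using r ac by (simp add: C_def m_ac)
    ultimately show "r \<in> C (Suc c)" using r by (simp add: C_def)
  qed
  then have Cc: "C (Suc c) = C c" by (rule c)
  define L where "L = {y \<in> carrier R. \<forall>N::nat. y \<in> adjoin X (a [^] N)}"
  have divide: "\<exists>y'\<in>L. y \<ominus> a \<otimes> y' \<in> X" if y: "y \<in> L" for y
  proof -
    have yc: "y \<in> carrier R" using y by (simp add: L_def)
    have "\<exists>r\<in>carrier R. y \<ominus> a [^] N \<otimes> r \<in> X" for N :: nat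
      using y unfolding L_def adjoin_def by blast
    then obtain f where f: "\<And>N::nat. f N \<in> carrier R" "\<And>N::nat. y \<ominus> a [^] N \<otimes> f N \<in> X" by metis
    \<comment> \<open>One factor \<open>a\<close> is split off
      \<open>a [^] Suc c \<otimes> f (Suc c)\<close>, which represents \<open>y\<close> modulo
      \<open>X\<close>. Membership of \<open>y'\<close> in \<open>adjoin X (a [^] N)\<close> results
      from comparison with the representation of exponent \<open>Suc c + N\<close>: the common
      factor \<open>a [^] Suc c\<close> is lowered to \<open>a [^] c\<close> by stability of
      \<open>C\<close> at \<open>c\<close>.\<close>
    define y' where "y' = a [^] c \<otimes> f (Suc c)"
    have y'c: "y' \<in> carrier R" using ac f by (simp add: y'_def)
    have "a \<otimes> y' = a [^] Suc c \<otimes> f (Suc c)" using ac f by (simp add: y'_def m_ac)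
    then have "y \<ominus> a \<otimes> y' \<in> X" using f(2)[of "Suc c"] by simp
    moreover have "y' \<in> adjoin X (a [^] N)" for N :: nat
    proof -
      let ?p = "a [^] Suc c" and ?q = "a [^] N" and ?r = "f (Suc c)" and ?s = "f (Suc c + N)"
      have cl: "?p \<in> carrier R" "?q \<in> carrier R" "?r \<in> carrier R" "?s \<in> carrier R" "a [^] c \<in> carrier R"
        using ac f(1) by auto
      have pq: "a [^] (Suc c + N) = ?p \<otimes> ?q" using nat_pow_mult[OF ac, of "Suc c" N] by (rule sym)
      have "(y \<ominus> (?p \<otimes> ?q) \<otimes> ?s) \<ominus> (y \<ominus> ?p \<otimes> ?r) \<in> X"
        using f(2)[of "Suc c"] f(2)[of "Suc c + N"] unfolding pq by (simp add: a_minus_def)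
      moreover have "(y \<ominus> (?p \<otimes> ?q) \<otimes> ?s) \<ominus> (y \<ominus> ?p \<otimes> ?r) = ?p \<otimes> (?r \<ominus> ?q \<otimes> ?s)"
        using cl yc by algebra
      ultimately have "?r \<ominus> ?q \<otimes> ?s \<in> C (Suc c)" using cl by (simp add: C_def)
      then have "a [^] c \<otimes> (?r \<ominus> ?q \<otimes> ?s) \<in> X" using Cc by (auto simp: C_def)
      moreover have "a [^] c \<otimes> (?r \<ominus> ?q \<otimes> ?s) = y' \<ominus> ?q \<otimes> (a [^] c \<otimes> ?s)"
        unfolding y'_def using cl by algebra
      ultimately show ?thesis using y'c cl by (auto simp: adjoin_def)
    qed
    ultimately show ?thesis using y'c by (auto simp: L_def)
  qed
  have bL: "b \<in> L" using b inter by (simp add: L_def)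
  have "\<And>I. I \<in> adjoin X ` L \<Longrightarrow> ideal I R" using ideal_adjoin[OF X] by (auto simp: L_def)
  moreover have "adjoin X ` L \<noteq> {}" using bL by blast
  ultimately have "\<exists>M\<in>adjoin X ` L. \<forall>I\<in>adjoin X ` L. M \<subseteq> I \<longrightarrow> I = M"
    by (intro maximal_ideal_in_family)
  then obtain y where y: "y \<in> L" and max: "\<And>z. z \<in> L \<Longrightarrow> adjoin X y \<subseteq> adjoin X z \<Longrightarrow> adjoin X z = adjoin X y"
    by blast
  obtain y' where y': "y' \<in> L" "y \<ominus> a \<otimes> y' \<in> X" using divide[OF y] by blast
  have cl: "y \<in> carrier R" "y' \<in> carrier R" using y y' by (auto simp: L_def)
  note iy' = ideal_adjoin[OF X cl(2)]
  interpret Y': ideal "adjoin X y'" R by (rule iy')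
  have "(y \<ominus> a \<otimes> y') \<oplus> a \<otimes> y' \<in> adjoin X y'"
    using y'(2) adjoin_superset[OF X cl(2)] adjoin_self[OF X cl(2)] ac by (auto intro: Y'.I_l_closed)
  moreover have "(y \<ominus> a \<otimes> y') \<oplus> a \<otimes> y' = y" using cl ac by algebra
  ultimately have "adjoin X y \<subseteq> adjoin X y'"
    using adjoin_least[OF iy' adjoin_superset[OF X cl(2)], of y] by simp
  then have eq: "adjoin X y' = adjoin X y" using max y' by blast
  then have "y' \<in> adjoin X y" using adjoin_self[OF X cl(2)] by simp
  then obtain s where s: "s \<in> carrier R" "y' \<ominus> y \<otimes> s \<in> X"
    unfolding adjoin_def by blast
  have "(y' \<ominus> y \<otimes> s) \<oplus> (y \<ominus> a \<otimes> y') \<otimes> s \<in> X" using s y' by (simp add: X.I_r_closed)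
  moreover have "(y' \<ominus> y \<otimes> s) \<oplus> (y \<ominus> a \<otimes> y') \<otimes> s = y' \<ominus> (a \<otimes> y') \<otimes> s" using s cl ac by algebra
  ultimately have "y' \<in> X" using mem_if_minus_mult_mem[OF X a cl(2) s(1)] by simp
  then have "adjoin X y = X"
    using adjoin_least[OF X order_refl] adjoin_superset[OF X cl(2)] eq by blast
  then have "adjoin X b = X" using max[OF bL] adjoin_superset[OF X b] by auto
  then show ?thesis using adjoin_self[OF X b] by auto
qed

text \<open>The ideals generated by \<open>G\<close> and a power of \<open>a\<close>, from some
  exponent on, descend inside \<open>F\<close>. Finite length forces a repetition, where Nakayama's
  lemma puts the power itself into \<open>G\<close>.\<close>

lemma m_radical_if_finite_length:
  assumes G: "ideal G R" and F: "m_radical F" and GF: "G \<subseteq> F"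
    and fin: "ring_length G F \<noteq> \<infinity>"
  shows "m_radical G"
  unfolding m_radical_def
proof (intro conjI ballI G)
  fix a assume a: "a \<in> m"
  have ac: "a \<in> carrier R" using a by (rule m.Icarr)
  interpret F: ideal F R using F by (simp add: m_radical_def)
  obtain t :: nat where t: "a [^] t \<in> F" using F a by (auto simp: m_radical_def)
  define N where "N i = adjoin G (a [^] (t + i))" for i
  have iN: "ideal (N i) R" for i using ac by (simp add: N_def ideal_adjoin[OF G])
  show "\<exists>k::nat. a [^] k \<in> G"
  proof (cases "\<exists>i. a [^] (t + i) \<in> N (Suc i)")
    case True
    then obtain i r where r: "r \<in> carrier R" "a [^] (t + i) \<ominus> a [^] (t + Suc i) \<otimes> r \<in> G"
      by (auto simp: N_def adjoin_def)
    moreover have "a [^] (t + Suc i) = a \<otimes> a [^] (t + i)" using ac by (simp add: m_comm)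
    ultimately have "a [^] (t + i) \<in> G"
      using mem_if_minus_mult_mem[OF G a, of "a [^] (t + i)" r] ac by simp
    then show ?thesis ..
  next
    case False
    have NF: "N i \<subseteq> F" for i
      unfolding N_def
    proof (rule adjoin_least[OF F.ideal_axioms GF])
      show "a [^] (t + i) \<in> F" using t ac by (simp add: nat_pow_mult[symmetric] F.I_r_closed)
    qed
    have strict: "N (Suc i) \<subset> N i" for i
    proof
      interpret Ni: ideal "N i" R by (rule iN)
      have self: "a [^] (t + i) \<in> N i" unfolding N_def using ac by (intro adjoin_self[OF G]) simp
      then have "a [^] (t + i) \<otimes> a \<in> N i" using ac by (simp add: Ni.I_r_closed)
      then show "N (Suc i) \<subseteq> N i"
        unfolding N_def[of "Suc i"] using adjoin_superset[OF G, of "a [^] (t + i)"] ac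
        by (intro adjoin_least iN) (auto simp: N_def)
      show "N (Suc i) \<noteq> N i" using False self by blast
    qed
    obtain q where q: "ring_length G F = enat q" using fin by auto
    have "enat (Suc q) \<le> ring_length G F"
      unfolding rel_length_def
    proof (subst enat_le_chain_length_iff)
      have mem: "N i \<in> {N. submodule N R (ring_module R) \<and> G \<subseteq> N \<and> N \<subseteq> F}" for i
        using iN NF adjoin_superset[OF G, of "a [^] (t + i)"] ac
        by (auto simp: N_def submodule_ring_module_iff)
      then show "{N. submodule N R (ring_module R) \<and> G \<subseteq> N \<and> N \<subseteq> F} \<noteq> {}" by blast
      have "N (Suc q - i) \<subset> N (Suc q - Suc i)" if "i < Suc q" for i
        using strict[of "q - i"] that by (simp add: Suc_diff_le)
      then show "\<exists>N. (\<forall>i\<le>Suc q. N i \<in> {N. submodule N R (ring_module R) \<and> G \<subseteq> N \<and> N \<subseteq> F}) \<and>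
          (\<forall>i<Suc q. N i \<subset> N (Suc i))"
        using mem by (intro exI[of _ "\<lambda>i. N (Suc q - i)"]) blast
    qed
    then show ?thesis using q by simp
  qed
qed

text \<open>A congruence of \<open>a [^] p\<close> with \<open>b \<otimes> r\<close> modulo
  \<open>L\<close> may be raised to the power \<open>N\<close>.\<close>

lemma m_radical_adjoin_power:
  assumes L: "ideal L R" and b: "b \<in> carrier R" and X: "m_radical (adjoin L b)"
  shows "m_radical (adjoin L (b [^] (N::nat)))"
  unfolding m_radical_def
proof (intro conjI ballI)
  show "ideal (adjoin L (b [^] N)) R" using b by (intro ideal_adjoin[OF L]) simp
  interpret L: ideal L R by (rule L)
  fix a assume a: "a \<in> m"
  have ac: "a \<in> carrier R" using a by (rule m.Icarr)
  obtain p :: nat where "a [^] p \<in> adjoin L b" using X a by (auto simp: m_radical_def)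
  then obtain r where r: "r \<in> carrier R" "a [^] p \<ominus> b \<otimes> r \<in> L" by (auto simp: adjoin_def)
  define e where "e = a [^] p"
  have e: "e \<in> carrier R" "e \<ominus> b \<otimes> r \<in> L" using ac r by (auto simp: e_def)
  have "e [^] N \<ominus> b [^] N \<otimes> r [^] N \<in> L"
  proof (induction N)
    case 0
    then show ?case by (simp add: a_minus_def r_neg)
  next
    case (Suc N)
    have "e [^] N \<otimes> (e \<ominus> b \<otimes> r) \<oplus> (e [^] N \<ominus> b [^] N \<otimes> r [^] N) \<otimes> (b \<otimes> r) \<in> L"
      using Suc e b r by (simp add: L.I_l_closed L.I_r_closed)
    moreover have "e [^] N \<otimes> (e \<ominus> b \<otimes> r) \<oplus> (e [^] N \<ominus> b [^] N \<otimes> r [^] N) \<otimes> (b \<otimes> r) =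
        e [^] Suc N \<ominus> b [^] Suc N \<otimes> r [^] Suc N"
    proof -
      have "e [^] N \<in> carrier R" "b [^] N \<in> carrier R" "r [^] N \<in> carrier R" using e b r by auto
      then show ?thesis unfolding nat_pow_Suc using e(1) b r(1) by algebra
    qed
    ultimately show ?case by simp
  qed
  moreover have "e [^] N = a [^] (p * N)" using ac by (simp add: e_def nat_pow_pow)
  ultimately have "a [^] (p * N) \<in> adjoin L (b [^] N)" using ac b r by (auto simp: adjoin_def)
  then show "\<exists>k::nat. a [^] k \<in> adjoin L (b [^] N)" ..
qed

end

section \<open>Systems of parameters in Cohen-Macaulay local rings\<close>

lemma (in cring) mem_genideal_set:
  assumes "set as \<subseteq> carrier R" "e \<in> Idl (set as)"
  obtains b where "\<And>s. s < length as \<Longrightarrow> b s \<in> carrier R" "e = (\<Oplus>s\<in>{..<length as}. as ! s \<otimes> b s)"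
proof -
  \<comment> \<open>The locale is instantiated with both ideals equal to the ring, only to read
    coefficients off \<open>aug_image_K\<close>.\<close>
  interpret bigraded_koszul R "carrier R" "carrier R" as "[]" 0 0
    by unfold_locales (use assms oneideal in auto)
  obtain w where w: "w \<in> carrier (K (Suc 0))" "e = aug w"
    using assms(2) aug_image_K by auto
  have "w {s} \<in> carrier R" if "s < length as" for s
    using w(1) that unfolding carrier_K by (auto simp: PiE_iff)
  moreover have "e = (\<Oplus>s\<in>{..<length as}. as ! s \<otimes> w {s})"
    using aug_eq[OF w(1)] w(2) by simp
  ultimately show thesis using that[of "\<lambda>s. w {s}"] by blast
qed

text \<open>Write \<open>x \<otimes> r\<close> as a combination of \<open>as\<close> with
  coefficients \<open>b s\<close>. The \<open>b s\<close>, with \<open>\<ominus> r\<close> at the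
  last place, form a cycle of degree one; as it is a boundary, its last coefficient is a combination
  of the elements of \<open>as\<close>.\<close>

lemma (in koszul) exact_above_imp_colon:
  assumes ys: "ys = as @ [x]" and ex: "exact_above {\<zero>} (Suc 0)"
    and r: "r \<in> carrier R" "x \<otimes> r \<in> Idl (set as)"
  shows "r \<in> Idl (set as)"
proof -
  let ?n = "length as"
  have as: "set as \<subseteq> carrier R" and x: "x \<in> carrier R" using ys ys_closed by auto
  have len: "length ys = Suc ?n" and nth: "ys ! ?n = x" "\<And>s. s < ?n \<Longrightarrow> ys ! s = as ! s"
    using ys by (simp_all add: nth_append)
  interpret A: ideal "Idl (set as)" R using as by (rule genideal_ideal)
  obtain b where b: "\<And>s. s < ?n \<Longrightarrow> b s \<in> carrier R" "x \<otimes> r = (\<Oplus>s\<in>{..<?n}. as ! s \<otimes> b s)"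
    using mem_genideal_set[OF as r(2)] by blast
  define z where "z S = (if card S = 1 then if the_elem S = ?n then \<ominus> r else b (the_elem S) else \<zero>)"
    for S :: "nat set"
  have z1: "z {s} = (if s = ?n then \<ominus> r else b s)" for s by (simp add: z_def)
  have z: "chain z"
    unfolding chain_def
  proof (intro allI impI)
    fix S assume S: "S \<subseteq> {..<length ys}"
    show "z S \<in> carrier R"
    proof (cases "card S = 1")
      case True
      then obtain s where "S = {s}" by (rule card_1_singletonE)
      then show ?thesis using S b(1)[of s] r len by (auto simp: z1 less_Suc_eq)
    qed (simp add: z_def)
  qed
  have fin: "finite S" if "S \<subseteq> {..<length ys}" for S using that finite_subset by blast
  have "above (Suc 0) z" using fin by (auto simp: above_def z_def)
  moreover have "\<delta> z T \<in> {\<zero>}" if T: "T \<subseteq> {..<length ys}" for T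
  proof (cases "T = {}")
    case True
    have asn: "as ! s \<in> carrier R" if "s < ?n" for s using as that by (auto simp: subset_iff)
    have "\<delta> z T = (\<Oplus>s\<in>insert ?n {..<?n}. ys ! s \<otimes> z {s})"
      unfolding koszul_diff_eq True
    proof (rule finsum_cong')
      show "{..<length ys} - {} = insert ?n {..<?n}" using len by auto
      show "(\<lambda>s. ys ! s \<otimes> z {s}) \<in> insert ?n {..<?n} \<rightarrow> carrier R"
        using z len by (intro Pi_I m_closed) auto
      fix s assume "s \<in> insert ?n {..<?n}"
      then have "ys ! s \<in> carrier R" "z {s} \<in> carrier R" using z len by auto
      then show "sign (card {t \<in> {}. t < s}) \<otimes> (ys ! s \<otimes> z (insert s {})) = ys ! s \<otimes> z {s}" by simp
    qed
    also have "\<dots> = ys ! ?n \<otimes> z {?n} \<oplus> (\<Oplus>s\<in>{..<?n}. ys ! s \<otimes> z {s})"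
    proof (rule finsum_insert)
      show "(\<lambda>s. ys ! s \<otimes> z {s}) \<in> {..<?n} \<rightarrow> carrier R" "ys ! ?n \<otimes> z {?n} \<in> carrier R"
        using z len by (auto intro!: m_closed)
    qed auto
    also have "(\<Oplus>s\<in>{..<?n}. ys ! s \<otimes> z {s}) = (\<Oplus>s\<in>{..<?n}. as ! s \<otimes> b s)"
      using asn b(1) by (intro finsum_cong') (auto simp: z1 nth)
    also have "\<dots> = x \<otimes> r" using b(2) by simp
    also have "ys ! ?n \<otimes> z {?n} \<oplus> x \<otimes> r = \<zero>"
      using x r by (simp add: z1 nth r_minus l_neg)
    finally show ?thesis by simp
  next
    case False
    have "\<delta> z T = \<delta> (\<lambda>_. \<zero>) T"
      using False fin[OF T] T by (intro koszul_diff_cong) (auto simp: chain_def z_def)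
    then show ?thesis using koszul_diff_zero[OF T] by simp
  qed
  ultimately obtain u where u: "chain u" and zu: "\<And>S. S \<subseteq> {..<length ys} \<Longrightarrow> z S \<ominus> \<delta> u S \<in> {\<zero>}"
    using ex z unfolding exact_above_def by blast
  have sub: "{?n} \<subseteq> {..<length ys}" using len by simp
  have "\<delta> u {?n} \<in> Idl (set as)"
    unfolding koszul_diff_eq
  proof (rule A.finsum_mem)
    fix s assume s: "s \<in> {..<length ys} - {?n}"
    then have sn: "s < ?n" using len by auto
    then have "ys ! s \<in> Idl (set as)"
      using genideal_self[OF as] nth_mem[OF sn] nth(2)[OF sn] by auto
    moreover have "u (insert s {?n}) \<in> carrier R" using u s sub by auto
    ultimately show "sign (card {t \<in> {?n}. t < s}) \<otimes> (ys ! s \<otimes> u (insert s {?n})) \<in> Idl (set as)"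
      by (auto intro: A.I_l_closed A.I_r_closed)
  qed simp
  moreover have "z {?n} = \<delta> u {?n}"
    using zu[OF sub] z u sub by (simp add: r_right_minus_eq)
  ultimately have "\<ominus> (\<ominus> r) \<in> Idl (set as)" by (simp add: z1)
  then show ?thesis using r by simp
qed

locale cohen_macaulay_local = noetherian_local +
  fixes d :: nat
  assumes depth: "depth R m = enat d"
begin

text \<open>As the elements lie in \<open>m\<close>, their ideal is proper, so
  \<open>m_radical\<close> means primary to \<open>m\<close> here. In a Cohen-Macaulay ring the
  depth \<open>d\<close> is also the dimension, whence the name.\<close>

definition system_of_parameters :: "'a list \<Rightarrow> bool" where
  "system_of_parameters xs \<longleftrightarrow> set xs \<subseteq> m \<and> length xs = d \<and> m_radical (Idl (set xs))"

lemma m_subset: "m \<subseteq> carrier R"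
  using m.a_subset .

text \<open>The supremum defining the depth exceeds \<open>d - 1\<close> when \<open>d > 0\<close>,
  so some regular sequence has at least \<open>d\<close> members. Regularity is restated as a colon
  condition in \<open>R\<close>, to leave the quotient rings behind.\<close>

lemma regular_sequence_of_length_d:
  "\<exists>zs. d \<le> length zs \<and> set zs \<subseteq> m \<and> (\<forall>i<length zs. \<forall>r\<in>carrier R.
    zs ! i \<otimes> r \<in> Idl (set (take i zs)) \<longrightarrow> r \<in> Idl (set (take i zs)))"
proof (cases d)
  case 0
  then show ?thesis by (intro exI[of _ "[]"]) simp
next
  case (Suc e)
  have "enat e < Sup {enat (length ys) | ys. set ys \<subseteq> m \<and> regular_sequence R ys}"
    using depth Suc by (simp add: depth_def)
  then obtain zs where zs: "set zs \<subseteq> m" "regular_sequence R zs" "e < length zs"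
    unfolding less_Sup_iff by auto
  have "r \<in> Idl (set (take i zs))"
    if i: "i < length zs" and r: "r \<in> carrier R" and mem: "zs ! i \<otimes> r \<in> Idl (set (take i zs))" for i r
  proof -
    let ?J = "Idl (set (take i zs))"
    have "set (take i zs) \<subseteq> carrier R" using zs(1) m_subset set_take_subset[of i zs] by blast
    then interpret J: ideal ?J R by (rule genideal_ideal)
    have zi: "zs ! i \<in> carrier R" using zs(1) m_subset i by (meson nth_mem subsetD)
    have "nonzerodivisor (R Quot ?J) (?J +> zs ! i)"
      using zs(2) i by (simp add: regular_sequence_def Let_def)
    then have nzd: "y \<in> carrier (R Quot ?J) \<Longrightarrow> (?J +> zs ! i) \<otimes>\<^bsub>R Quot ?J\<^esub> y = \<zero>\<^bsub>R Quot ?J\<^esub> \<Longrightarrow>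
        y = \<zero>\<^bsub>R Quot ?J\<^esub>" for y
      by (simp add: nonzerodivisor_def)
    have "?J +> r \<in> carrier (R Quot ?J)"
      using r a_rcosetsI[OF J.a_subset] by (simp add: FactRing_def)
    moreover have "(?J +> zs ! i) \<otimes>\<^bsub>R Quot ?J\<^esub> (?J +> r) = \<zero>\<^bsub>R Quot ?J\<^esub>"
      using J.rcoset_mult_add[OF zi r] J.a_rcos_const[OF mem] by (simp add: FactRing_def)
    ultimately have "?J +> r = ?J" using nzd by (simp add: FactRing_def)
    then show ?thesis using J.a_rcos_self[OF r] by simp
  qed
  then show ?thesis using zs Suc by (intro exI[of _ zs]) auto
qed

text \<open>The homology over \<open>R / (z\<^sub>1, \<dots>, z\<^sub>i)\<close>, for a regular sequence of length \<open>d\<close>, vanishes in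
  degrees above \<open>i\<close>: going down from \<open>i = d\<close>, each \<open>z\<^sub>i\<close> acts injectively, but a power of it lies in
  \<open>(xs)\<close> and so acts as \<open>0\<close>.\<close>

lemma koszul_exact:
  assumes xs: "system_of_parameters xs"
  shows "koszul.exact_above R xs {\<zero>} (Suc 0)"
proof -
  interpret koszul R xs
    by unfold_locales (use xs m_subset in \<open>auto simp: system_of_parameters_def\<close>)
  obtain zs where zs: "d \<le> length zs" "set zs \<subseteq> m" and
    reg: "\<And>i r. i < length zs \<Longrightarrow> r \<in> carrier R \<Longrightarrow> zs ! i \<otimes> r \<in> Idl (set (take i zs)) \<Longrightarrow>
      r \<in> Idl (set (take i zs))"
    using regular_sequence_of_length_d by blast
  have sub: "set (take i zs) \<subseteq> carrier R" for i
    using zs(2) m_subset set_take_subset[of i zs] by blast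
  have "exact_above (Idl (set (take i zs))) (Suc i)" if "i \<le> d" for i
    using that
  proof (induction rule: inc_induct)
    \<comment> \<open>Here the number of parameters matters: degree \<open>Suc d\<close> lies above
      all index sets because \<open>xs\<close> has exactly \<open>d\<close> elements.\<close>
    case base
    show ?case
      using exact_above_length[OF genideal_ideal[OF sub, of d]] xs by (simp add: system_of_parameters_def)
  next
    case (step i)
    then have i: "i < length zs" using zs(1) by simp
    then have zi: "zs ! i \<in> m" "zs ! i \<in> carrier R" using zs(2) m_subset nth_mem by blast+
    have "set (take (Suc i) zs) = insert (zs ! i) (set (take i zs))"
      using i by (simp add: take_Suc_conv_app_nth)
    then have adj: "Idl (set (take (Suc i) zs)) = adjoin (Idl (set (take i zs))) (zs ! i)"
      using genideal_insert[OF sub zi(2)] by simp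
    obtain N :: nat where "zs ! i [^] N \<in> Idl (set xs)"
      using xs zi(1) by (auto simp: system_of_parameters_def m_radical_def)
    then show ?case
      using exact_above_adjoin[OF genideal_ideal[OF sub] zi(2) _ reg[OF i]] step(3) unfolding adj by blast
  qed
  from this[of 0] show ?thesis by (simp add: genideal_empty)
qed

text \<open>Descending induction on the position \<open>j\<close>, starting at the last one with
  \<open>koszul_exact\<close>. The induction has to range over all systems of parameters at once,
  because its step applies to a rearranged list with a power of one member.\<close>

lemma parameters_regular:
  assumes "system_of_parameters xs" "j < d" "r \<in> carrier R" "xs ! j \<otimes> r \<in> Idl (set (take j xs))"
  shows "r \<in> Idl (set (take j xs))"
proof -
  have "j \<le> d - 1" "0 < d" using assms(2) by auto
  have "\<forall>xs r. system_of_parameters xs \<longrightarrow> r \<in> carrier R \<longrightarrow> xs ! j \<otimes> r \<in> Idl (set (take j xs)) \<longrightarrow>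
      r \<in> Idl (set (take j xs))"
    using \<open>j \<le> d - 1\<close>
  proof (induction rule: inc_induct)
    case base
    show ?case
    proof (intro allI impI)
      fix xs r assume xs: "system_of_parameters xs" and r: "r \<in> carrier R"
        and mem: "xs ! (d - 1) \<otimes> r \<in> Idl (set (take (d - 1) xs))"
      interpret koszul R xs
        by unfold_locales (use xs m_subset in \<open>auto simp: system_of_parameters_def\<close>)
      have len: "length xs = Suc (d - 1)" using xs \<open>0 < d\<close> by (simp add: system_of_parameters_def)
      then have "xs = take (d - 1) xs @ [xs ! (d - 1)]"
        by (metis lessI order_refl take_Suc_conv_app_nth take_all)
      then show "r \<in> Idl (set (take (d - 1) xs))"
        using exact_above_imp_colon[OF _ koszul_exact[OF xs] r mem] by blast
    qed
  next
    case (step j)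
    show ?case
    proof (intro allI impI)
      fix xs r assume xs: "system_of_parameters xs" and r: "r \<in> carrier R"
        and mem: "xs ! j \<otimes> r \<in> Idl (set (take j xs))"
      have len: "length xs = d" "Suc j < d" and xm: "set xs \<subseteq> m"
        using xs step(2) by (auto simp: system_of_parameters_def)
      define A where "A = set (take j xs)"
      define b where "b = xs ! Suc j"
      define S where "S = A \<union> {xs ! j} \<union> set (drop (Suc (Suc j)) xs)"
      have AS: "A \<subseteq> m" "S \<subseteq> m" "b \<in> m"
        using xm len set_take_subset[of j xs] set_drop_subset[of "Suc (Suc j)" xs]
        by (auto simp: A_def S_def b_def subset_iff)
      then have c: "A \<subseteq> carrier R" "S \<subseteq> carrier R" "b \<in> carrier R" using m_subset by auto
      have "xs = take j xs @ xs ! j # xs ! Suc j # drop (Suc (Suc j)) xs"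
        using len by (metis Cons_nth_drop_Suc Suc_lessD append_take_drop_id)
      then have "set xs = insert b S"
        unfolding S_def A_def b_def by (metis (no_types, lifting) Un_insert_left Un_insert_right insert_commute
            list.simps(15) set_append sup_bot_right)
      then have rad: "m_radical (adjoin (Idl S) b)"
        using xs genideal_insert[OF c(2,3)] by (simp add: system_of_parameters_def)
      have "r \<in> adjoin (Idl A) (b [^] N)" for N :: nat
      proof (cases N)
        \<comment> \<open>\<open>b [^] 0\<close> is \<open>\<one>\<close> and cannot be a parameter,
          so this exponent is treated directly, with \<open>r\<close> itself as the
          coefficient.\<close>
        case 0
        have "r \<ominus> \<one> \<otimes> r \<in> Idl A"
          using r additive_subgroup.zero_closed[OF ideal.axioms(1)[OF genideal_ideal[OF c(1)]]]
          by (simp add: a_minus_def r_neg)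
        then show ?thesis using r 0 unfolding adjoin_def by auto
      next
        case (Suc N')
        \<comment> \<open>The element \<open>xs ! j\<close> now sits at position
          \<open>Suc j\<close>, preceded by \<open>take j xs\<close> and \<open>b [^] N\<close>, so
          the induction hypothesis yields \<open>r \<in> adjoin (Idl A) (b [^] N)\<close>.\<close>
        define xs' where "xs' = take j xs @ b [^] N # xs ! j # drop (Suc (Suc j)) xs"
        have bN: "b [^] N \<in> m" "b [^] N \<in> carrier R" using AS(3) c(3) Suc by (simp_all add: m.I_l_closed)
        have "set xs' = insert (b [^] N) S" by (auto simp: xs'_def S_def A_def)
        then have "system_of_parameters xs'"
          using m_radical_adjoin_power[OF genideal_ideal[OF c(2)] c(3) rad, of N] AS bN(1)
            genideal_insert[OF c(2) bN(2)] len
          by (simp add: system_of_parameters_def xs'_def)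
        moreover have "take (Suc j) xs' = take j xs @ [b [^] N]" "xs' ! Suc j = xs ! j"
          using len by (simp_all add: xs'_def nth_append)
        moreover have adj: "Idl (set (take j xs @ [b [^] N])) = adjoin (Idl A) (b [^] N)"
          using genideal_insert[OF c(1) bN(2)] by (simp add: A_def)
        moreover have "xs ! j \<otimes> r \<in> adjoin (Idl A) (b [^] N)"
          using mem adjoin_superset[OF genideal_ideal[OF c(1)] bN(2)] by (auto simp: A_def)
        ultimately show ?thesis using step(3) r by metis
      qed
      then show "r \<in> Idl (set (take j xs))"
        using principal_krull_intersection[OF genideal_ideal[OF c(1)] AS(3) r] by (simp add: A_def)
    qed
  qed
  then show ?thesis using assms by blast
qed

end

section \<open>Iterated backward differences\<close>

definition bdiff :: "nat \<Rightarrow> (int \<Rightarrow> 'c::comm_ring_1) \<Rightarrow> int \<Rightarrow> 'c" where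
  "bdiff k f a = (\<Sum>p\<le>k. (- 1) ^ p * of_nat (k choose p) * f (a - int p))"

lemma bdiff_0 [simp]: "bdiff 0 f a = f a"
  by (simp add: bdiff_def)

lemma bdiff_Suc: "bdiff (Suc k) f a = bdiff k f a - bdiff k f (a - 1)"
proof -
  have "bdiff (Suc k) f a =
      f a + (\<Sum>p\<le>k. (- 1) ^ Suc p * of_nat (Suc k choose Suc p) * f (a - int (Suc p)))"
    unfolding bdiff_def by (subst sum.atMost_Suc_shift) simp
  also have "\<dots> = (f a + (\<Sum>p\<le>k. (- 1) ^ Suc p * of_nat (k choose Suc p) * f (a - int (Suc p)))) -
      (\<Sum>p\<le>k. (- 1) ^ p * of_nat (k choose p) * f (a - 1 - int p))"
    by (simp add: sum_subtractf[symmetric] sum.distrib[symmetric] sum_negf[symmetric] algebra_simps)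
  also have "f a + (\<Sum>p\<le>k. (- 1) ^ Suc p * of_nat (k choose Suc p) * f (a - int (Suc p))) =
      (\<Sum>p\<le>Suc k. (- 1) ^ p * of_nat (k choose p) * f (a - int p))"
    by (subst sum.atMost_Suc_shift) simp
  also have "\<dots> = bdiff k f a"
    by (simp add: bdiff_def binomial_eq_0)
  finally show ?thesis by (simp add: bdiff_def)
qed

lemma bdiff_minus: "bdiff k (\<lambda>a. f a - g a) a = bdiff k f a - bdiff k g a"
  by (simp add: bdiff_def sum_subtractf[symmetric] algebra_simps)

lemma bdiff_sum: "bdiff k (\<lambda>a. \<Sum>x\<in>A. f x a) a = (\<Sum>x\<in>A. bdiff k (f x) a)"
  unfolding bdiff_def by (simp add: sum_distrib_left) (rule sum.swap)

lemma bdiff_mult_left: "bdiff k (\<lambda>a. c * f a) a = c * bdiff k f a"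
  unfolding bdiff_def sum_distrib_left by (intro sum.cong) (simp_all add: mult_ac)

lemma bdiff_mult_right: "bdiff k (\<lambda>a. f a * c) a = bdiff k f a * c"
  unfolding bdiff_def sum_distrib_right by (intro sum.cong) (simp_all add: mult_ac)

lemma bdiff_of_int: "bdiff k (\<lambda>a. of_int (f a)) a = of_int (bdiff k f a)"
  by (simp add: bdiff_def)

lemma bdiff_cong: "(\<And>p. p \<le> k \<Longrightarrow> f (a - int p) = g (a - int p)) \<Longrightarrow> bdiff k f a = bdiff k g a"
  by (simp add: bdiff_def)

text \<open>\<open>diff2\<close> sums over the antidiagonals \<open>p + q = i\<close>; outside the
  rectangle \<open>p \<le> k\<close>, \<open>q \<le> l\<close> a binomial coefficient vanishes, so
  the triangle may be cut down to the rectangle and the two sums separated.\<close>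

lemma diff2_eq_bdiff: "diff2 k l f a b = bdiff k (\<lambda>a. bdiff l (f a) b) a"
proof -
  define g where "g q p = (- 1) ^ (p + q) * (of_nat (k choose p) * of_nat (l choose q) * f (a - int p) (b - int q))"
    for q p
  have "diff2 k l f a b = (\<Sum>i\<le>k + l. \<Sum>j\<le>i. g j (i - j))"
    unfolding diff2_def g_def by (simp add: sum_distrib_left atMost_atLeast0)
  also have "\<dots> = (\<Sum>(q, p)\<in>{(q, p). q + p \<le> k + l}. g q p)"
    by (rule sum.triangle_reindex_eq[symmetric])
  also have "\<dots> = (\<Sum>(q, p)\<in>{..l} \<times> {..k}. g q p)"
  proof (rule sum.mono_neutral_right)
    show "finite {(q, p). q + p \<le> k + l}"
      by (rule finite_subset[of _ "{..k + l} \<times> {..k + l}"]) auto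
    have "g q p = 0" if "l < q \<or> k < p" for q p
      using that by (auto simp: g_def binomial_eq_0)
    then show "\<forall>x\<in>{(q, p). q + p \<le> k + l} - {..l} \<times> {..k}. (case x of (q, p) \<Rightarrow> g q p) = 0"
      by (metis (mono_tags, lifting) DiffD2 SigmaI atMost_iff case_prodE case_prodI2 linorder_not_le prod.case surj_pair)
  qed auto
  also have "\<dots> = (\<Sum>q\<le>l. \<Sum>p\<le>k. g q p)"
    by (rule sum.cartesian_product[symmetric])
  also have "\<dots> = (\<Sum>p\<le>k. \<Sum>q\<le>l. g q p)"
    by (rule sum.swap)
  also have "\<dots> = bdiff k (\<lambda>a. bdiff l (f a) b) a"
    by (simp add: bdiff_def g_def sum_distrib_left power_add mult_ac)
  finally show ?thesis .
qed

lemma bdiff_power: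
  "(i < k \<longrightarrow> bdiff k (\<lambda>a. of_int a ^ i :: 'c::comm_ring_1) a = 0) \<and>
    (i \<le> k \<longrightarrow> bdiff k (\<lambda>a. of_int a ^ i :: 'c) a = bdiff k (\<lambda>a. of_int a ^ i) b)"
proof (induction k arbitrary: i a b)
  case 0
  then show ?case by simp
next
  case (Suc k)
  \<comment> \<open>The coefficients of the difference of consecutive powers: in the binomial
    expansion of \<open>(a - 1) ^ i\<close> the top power cancels against \<open>a ^ i\<close>, so
    each difference lowers the degree.\<close>
  define c :: "nat \<Rightarrow> 'c" where "c l = - (of_nat (i choose l) * (- 1) ^ (i - l))" for l
  have diff: "of_int a ^ i - of_int (a - 1) ^ i = (\<Sum>l<i. c l * of_int a ^ l)" for a :: int
  proof -
    have "of_int (a - 1) ^ i = (\<Sum>l\<le>i. of_nat (i choose l) * of_int a ^ l * (- 1 :: 'c) ^ (i - l))"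
      using binomial_ring[of "of_int a :: 'c" "- 1" i] by simp
    also have "\<dots> = (\<Sum>l<i. of_nat (i choose l) * of_int a ^ l * (- 1 :: 'c) ^ (i - l)) + of_int a ^ i"
      by (simp add: lessThan_Suc_atMost[symmetric])
    finally show ?thesis
      by (simp add: c_def sum_negf[symmetric] mult_ac)
  qed
  have shift: "bdiff (Suc k) (\<lambda>a. of_int a ^ i :: 'c) a = (\<Sum>l<i. c l * bdiff k (\<lambda>a. of_int a ^ l) a)" for a
  proof -
    have "bdiff k (\<lambda>a. of_int a ^ i :: 'c) (a - 1) = bdiff k (\<lambda>a. of_int (a - 1) ^ i) a"
      by (simp add: bdiff_def algebra_simps)
    then have "bdiff (Suc k) (\<lambda>a. of_int a ^ i :: 'c) a = bdiff k (\<lambda>a. of_int a ^ i - of_int (a - 1) ^ i) a"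
      by (simp only: bdiff_Suc bdiff_minus)
    then show ?thesis by (simp only: diff bdiff_sum bdiff_mult_left)
  qed
  have "bdiff k (\<lambda>a. of_int a ^ l :: 'c) a = bdiff k (\<lambda>a. of_int a ^ l) b" if "l \<le> k" for l
    using Suc.IH that by blast
  moreover have "bdiff k (\<lambda>a. of_int a ^ l :: 'c) a = 0" if "l < k" for l a
    using Suc.IH that by blast
  ultimately show ?case unfolding shift by (auto intro!: sum.cong sum.neutral)
qed

lemma poly2_eq_sum:
  "poly2 P a b = (\<Sum>i\<le>Polynomial.degree P. \<Sum>j\<le>Polynomial.degree (Polynomial.coeff P i).
    of_int a ^ i * (Polynomial.coeff (Polynomial.coeff P i) j * of_int b ^ j))"
  by (simp add: poly2_def poly_altdef[of P] poly_sum poly_altdef[of "Polynomial.coeff P _"]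
      sum_distrib_right sum_distrib_left mult_ac)

text \<open>A monomial of bidegree \<open>(i, j)\<close> with \<open>i + j \<le> k + l\<close> has
  \<open>i < k\<close>, or \<open>j < l\<close>, or \<open>(i, j) = (k, l)\<close>. In the first two
  cases it is killed, in the last one its difference does not depend on the point.\<close>

lemma diff2_poly2_constant:
  assumes P: "has_total_degree P (k + l)"
  shows "diff2 k l (poly2 P) a b = diff2 k l (poly2 P) a' b'"
proof -
  let ?c = "\<lambda>i j. Polynomial.coeff (Polynomial.coeff P i) j"
  have eq: "diff2 k l (poly2 P) a b = (\<Sum>i\<le>Polynomial.degree P. \<Sum>j\<le>Polynomial.degree (Polynomial.coeff P i).
      bdiff k (\<lambda>a. of_int a ^ i) a * (?c i j * bdiff l (\<lambda>b. of_int b ^ j) b))" for a b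
    unfolding diff2_eq_bdiff poly2_eq_sum[abs_def]
    by (simp add: bdiff_sum bdiff_mult_left bdiff_mult_right)
  have "bdiff k (\<lambda>a. of_int a ^ i) a * (?c i j * bdiff l (\<lambda>b. of_int b ^ j) b) =
      bdiff k (\<lambda>a. of_int a ^ i) a' * (?c i j * bdiff l (\<lambda>b. of_int b ^ j) b')" for i j
  proof (cases "?c i j = 0")
    case False
    then have "i + j \<le> k + l" using P by (auto simp: has_total_degree_def)
    then consider "i < k" | "j < l" | "i = k" "j = l" by linarith
    then show ?thesis
    proof cases
      case 3
      then show ?thesis
        using bdiff_power[of k k a a', where ?'c = rat] bdiff_power[of l l b b', where ?'c = rat] by simp
    qed (use bdiff_power[where ?'c = rat] in simp_all)
  qed simp
  then show ?thesis unfolding eq by (intro sum.cong refl)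
qed

text \<open>Group the index sets by the number \<open>j\<close> of elements in the second block: a
  member of a group is a free choice of \<open>i - j\<close> elements from the first block and
  \<open>j\<close> from the second. This matches the terms of the complex with the coefficients of
  \<open>diff2\<close>.\<close>

lemma sum_subsets_of_card:
  "(\<Sum>S\<in>subsets_of_card (k + l) i. g (card (S \<inter> {..<k})) (card (S - {..<k}))) =
    (\<Sum>j=0..i. of_nat (k choose (i - j)) * of_nat (l choose j) * (g (i - j) j :: 'c::comm_semiring_1))"
proof -
  let ?S = "subsets_of_card (k + l) i"
  have fin: "finite S" if "S \<in> ?S" for S
    using that finite_subset[of S "{..<k + l}"] by (auto simp: subsets_of_card_def)
  have split: "card (S \<inter> {..<k}) + card (S - {..<k}) = i" if "S \<in> ?S" for S
    using card_Int_Diff[OF fin[OF that]] that by (simp add: subsets_of_card_def)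
  have "(\<Sum>S\<in>?S. g (card (S \<inter> {..<k})) (card (S - {..<k}))) =
      (\<Sum>j\<in>{0..i}. \<Sum>S\<in>{S \<in> ?S. card (S - {..<k}) = j}. g (card (S \<inter> {..<k})) (card (S - {..<k})))"
    using split by (intro sum.group[symmetric]) fastforce+
  also have "\<dots> = (\<Sum>j\<in>{0..i}. of_nat (k choose (i - j)) * of_nat (l choose j) * g (i - j) j)"
  proof (rule sum.cong[OF refl])
    fix j assume j: "j \<in> {0..i}"
    let ?T = "{S \<in> ?S. card (S - {..<k}) = j}"
    let ?A = "{A. A \<subseteq> {..<k} \<and> card A = i - j}" and ?B = "{B. B \<subseteq> {k..<k + l} \<and> card B = j}"
    have "bij_betw (\<lambda>S. (S \<inter> {..<k}, S - {..<k})) ?T (?A \<times> ?B)"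
    proof (rule bij_betw_byWitness[where f' = "\<lambda>(A, B). A \<union> B"])
      show "(\<lambda>S. (S \<inter> {..<k}, S - {..<k})) ` ?T \<subseteq> ?A \<times> ?B"
      proof
        fix x assume "x \<in> (\<lambda>S. (S \<inter> {..<k}, S - {..<k})) ` ?T"
        then obtain S where S: "S \<in> ?S" "card (S - {..<k}) = j" "x = (S \<inter> {..<k}, S - {..<k})" by blast
        have "card (S \<inter> {..<k}) = i - j" using S split[OF S(1)] by simp
        moreover have "S \<subseteq> {..<k + l}" using S(1) by (simp add: subsets_of_card_def)
        then have "S - {..<k} \<subseteq> {k..<k + l}" by auto
        ultimately show "x \<in> ?A \<times> ?B" using S by simp
      qed
      show "(\<lambda>(A, B). A \<union> B) ` (?A \<times> ?B) \<subseteq> ?T"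
      proof
        fix S assume "S \<in> (\<lambda>(A, B). A \<union> B) ` (?A \<times> ?B)"
        then obtain A B where AB: "A \<subseteq> {..<k}" "card A = i - j" "B \<subseteq> {k..<k + l}" "card B = j" "S = A \<union> B"
          by blast
        have fin: "finite A" "finite B" using AB finite_subset by blast+
        have "A \<inter> B = {}" "A \<union> B - {..<k} = B" "A \<union> B \<subseteq> {..<k + l}" using AB(1,3) by (force+)
        then show "S \<in> ?T"
          using AB(2,4,5) j card_Un_disjoint[OF fin] by (simp add: subsets_of_card_def)
      qed
    qed (auto simp: subset_iff)
    then have "card ?T = (k choose (i - j)) * (l choose j)"
      using n_subsets[of "{..<k}" "i - j"] n_subsets[of "{k..<k + l}" j]
      by (simp add: bij_betw_same_card card_cartesian_product)
    moreover have "(\<Sum>S\<in>?T. g (card (S \<inter> {..<k})) (card (S - {..<k}))) = (\<Sum>S\<in>?T. g (i - j) j)"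
      using split by (intro sum.cong) fastforce+
    ultimately show "(\<Sum>S\<in>?T. g (card (S \<inter> {..<k})) (card (S - {..<k}))) =
        of_nat (k choose (i - j)) * of_nat (l choose j) * g (i - j) j" by simp
  qed
  finally show ?thesis .
qed

section \<open>Superficial sequences and the Hilbert function\<close>

lemma (in ring_hom_cring) ideal_prod_image:
  assumes A: "A \<subseteq> carrier R" and B: "B \<subseteq> carrier R"
  shows "h ` ideal_prod R A B = ideal_prod S (h ` A) (h ` B)"
proof
  have "r \<in> carrier R \<and> h r \<in> ideal_prod S (h ` A) (h ` B)" if "r \<in> ideal_prod R A B" for r
    using that
  proof (induction rule: ideal_prod.induct)
    case (prod i j)
    then have "i \<in> carrier R" "j \<in> carrier R" using A B by auto
    then show ?case using prod by (auto intro: ideal_prod.prod)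
  qed (auto intro: ideal_prod.sum)
  then show "h ` ideal_prod R A B \<subseteq> ideal_prod S (h ` A) (h ` B)" by blast
  show "ideal_prod S (h ` A) (h ` B) \<subseteq> h ` ideal_prod R A B"
  proof
    fix s assume "s \<in> ideal_prod S (h ` A) (h ` B)"
    then have "\<exists>r\<in>carrier R. r \<in> ideal_prod R A B \<and> s = h r"
    proof (induction rule: ideal_prod.induct)
      case (prod i j)
      then obtain a b where ab: "a \<in> A" "b \<in> B" "i = h a" "j = h b" by blast
      then have "a \<in> carrier R" "b \<in> carrier R" using A B by auto
      then show ?case using ab by (intro bexI[of _ "a \<otimes>\<^bsub>R\<^esub> b"]) (auto intro: ideal_prod.prod)
    next
      case (sum s t)
      then obtain a b where "a \<in> carrier R" "b \<in> carrier R" "a \<in> ideal_prod R A B" "b \<in> ideal_prod R A B"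
        "s = h a" "t = h b" by blast
      then show ?case by (intro bexI[of _ "a \<oplus>\<^bsub>R\<^esub> b"]) (auto intro: ideal_prod.sum)
    qed
    then show "s \<in> h ` ideal_prod R A B" by blast
  qed
qed

text \<open>Superficiality is stated with the filtration built from the image ideals in a quotient
  ring; this turns it into a statement about the image of the filtration of
  \<open>R\<close>.\<close>

lemma (in ring_hom_cring) filt_image:
  assumes surj: "h ` carrier R = carrier S" and I: "ideal I R" and I': "ideal I' R"
  shows "h ` filt R I I' a b = filt S (h ` I) (h ` I') a b"
proof -
  have pow: "h ` ideal_pow R I n = ideal_pow S (h ` I) n" if I: "ideal I R" for I n
  proof -
    have sub: "I [^]\<^bsub>ideals_set R\<^esub> k \<subseteq> carrier R" for k :: nat
      using ideal.Icarr[OF R.ideal_nat_pow[OF I]] by (rule subsetI)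
    have IR: "I \<subseteq> carrier R" using ideal.Icarr[OF I] by (rule subsetI)
    have "h ` (I [^]\<^bsub>ideals_set R\<^esub> k) = (h ` I) [^]\<^bsub>ideals_set S\<^esub> k" for k :: nat
      by (induction k) (simp_all add: surj ideal_prod_image[OF sub IR])
    then show ?thesis unfolding ideal_pow_def using surj by presburger
  qed
  have "ideal_pow R I n \<subseteq> carrier R" if "ideal I R" for I n
    using ideal.Icarr[OF R.ideal_ideal_pow[OF that]] by blast
  then show ?thesis
    unfolding filt_def using I I' by (simp add: ideal_prod_image pow)
qed

lemma carrier_FactRing: "carrier (R Quot J) = (\<lambda>r. J +>\<^bsub>R\<^esub> r) ` carrier R"
  by (auto simp: FactRing_def A_RCOSETS_def')

section \<open>Superficial elements and colon ideals\<close>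

context cring
begin

text \<open>In \<open>R / J\<close> the class of \<open>y \<otimes> r\<close> lies in the principal
  ideal of \<open>y\<close> and in the image of \<open>B\<close>, hence is the class of
  \<open>y \<otimes> s\<close> with \<open>s \<in> A\<close>; regularity of \<open>y\<close> modulo
  \<open>J\<close> then cancels \<open>y\<close>.\<close>

lemma colon_if_superficial:
  assumes J: "ideal J R" and A: "A \<subseteq> carrier R" and B: "B \<subseteq> carrier R" and y: "y \<in> carrier R"
    and nzd: "\<And>r. r \<in> carrier R \<Longrightarrow> y \<otimes> r \<in> J \<Longrightarrow> r \<in> J"
    and eq: "PIdl\<^bsub>R Quot J\<^esub> (J +> y) \<inter> (\<lambda>r. J +> r) ` B = (J +> y) <#\<^bsub>R Quot J\<^esub> ((\<lambda>r. J +> r) ` A)"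
    and r: "r \<in> carrier R" "y \<otimes> r \<in> J <+>\<^bsub>R\<^esub> B"
  shows "r \<in> J <+>\<^bsub>R\<^esub> A"
proof -
  interpret J: ideal J R by (rule J)
  interpret h: ring_hom_cring R "R Quot J" "\<lambda>r. J +> r" by (rule J.rcos_ring_hom_cring[OF cring_axioms])
  obtain j b where jb: "j \<in> J" "b \<in> B" "y \<otimes> r = j \<oplus> b" using r(2) by (auto simp: mem_set_add_iff)
  have bc: "b \<in> carrier R" using jb B by auto
  have "J +> (y \<otimes> r) = J +> b"
  proof (rule J.a_repr_independence'[symmetric])
    show "y \<otimes> r \<in> J +> b" unfolding jb(3) a_r_coset_def' using jb(1) by blast
  qed (rule bc)
  moreover have "J +> (y \<otimes> r) = (J +> r) \<otimes>\<^bsub>R Quot J\<^esub> (J +> y)"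
    using y r(1) by (simp add: m_comm[of y r])
  moreover have "J +> r \<in> carrier (R Quot J)" using r(1) by simp
  ultimately have "J +> (y \<otimes> r) \<in> PIdl\<^bsub>R Quot J\<^esub> (J +> y) \<inter> (\<lambda>r. J +> r) ` B"
    using jb(2) unfolding cgenideal_def by blast
  then obtain s where s: "s \<in> A" "J +> (y \<otimes> r) = (J +> y) \<otimes>\<^bsub>R Quot J\<^esub> (J +> s)"
    unfolding eq by (auto simp: l_coset_def)
  have sc: "s \<in> carrier R" using s A by auto
  have "J +> (y \<otimes> r) = J +> (y \<otimes> s)" using s(2) y sc by simp
  then have "y \<otimes> r \<in> J +> (y \<otimes> s)" using J.a_rcos_self[of "y \<otimes> r"] y r(1) by simp
  then have "y \<otimes> r \<oplus> \<ominus> (y \<otimes> s) \<in> J" using J.a_rcos_module_imp[of "y \<otimes> s" "y \<otimes> r"] y sc by simp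
  moreover have "y \<otimes> r \<oplus> \<ominus> (y \<otimes> s) = y \<otimes> (r \<ominus> s)" using y r(1) sc by algebra
  ultimately have "r \<ominus> s \<in> J" using nzd[of "r \<ominus> s"] r(1) sc by simp
  moreover have "r = (r \<ominus> s) \<oplus> s" using r(1) sc by algebra
  ultimately show ?thesis using s(1) unfolding mem_set_add_iff by blast
qed

text \<open>Multiplication by \<open>y\<close> embeds \<open>R\<close> modulo the colon ideal into
  \<open>R / B\<close>, with cokernel \<open>R\<close> modulo \<open>adjoin B y\<close>.\<close>

lemma rel_length_colon:
  assumes B: "ideal B R" and y: "y \<in> carrier R"
  shows "ring_length B (carrier R) =
    ring_length {r \<in> carrier R. y \<otimes> r \<in> B} (carrier R) +
    ring_length (adjoin B y) (carrier R)"
proof -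
  interpret f: module_hom R "ring_module R" "ring_module R" "\<lambda>r. y \<otimes> r" by (rule mult_hom[OF y])
  note Bs = B[folded submodule_ring_module_iff]
  note As = ideal_adjoin[OF B y, folded submodule_ring_module_iff]
  have "ring_length {r \<in> carrier R. y \<otimes> r \<in> B} (carrier R) = ring_length B (adjoin B y)"
    using f.rel_length_vimage[OF Bs self.carrier_is_submodule] by (simp add: adjoin_eq_set_add[OF B y])
  moreover have "ring_length B (carrier R) =
      ring_length B (adjoin B y) + ring_length (adjoin B y) (carrier R)"
    using self.rel_length_add[OF Bs As self.carrier_is_submodule adjoin_superset[OF B y]]
      self.submodule_simps(2)[OF As] by auto
  ultimately show ?thesis by simp
qed

text \<open>The colon formula for \<open>J + B\<close>: here the colon ideal is
  \<open>J + A\<close>, one inclusion coming from \<open>mult\<close> and the other from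
  \<open>colon\<close>.\<close>

lemma rel_length_adjoin:
  assumes J: "ideal J R" and A: "ideal A R" and B: "ideal B R" and y: "y \<in> carrier R"
    and mult: "\<And>a. a \<in> A \<Longrightarrow> y \<otimes> a \<in> B"
    and colon: "\<And>r. r \<in> carrier R \<Longrightarrow> y \<otimes> r \<in> J <+>\<^bsub>R\<^esub> B \<Longrightarrow> r \<in> J <+>\<^bsub>R\<^esub> A"
  shows "ring_length (J <+>\<^bsub>R\<^esub> B) (carrier R) =
    ring_length (J <+>\<^bsub>R\<^esub> A) (carrier R) +
    ring_length (adjoin J y <+>\<^bsub>R\<^esub> B) (carrier R)"
proof -
  interpret J: ideal J R by (rule J)
  note upper = self.set_add_upper[unfolded submodule_ring_module_iff, simplified]
  note least = self.set_add_least[unfolded submodule_ring_module_iff, simplified]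
  have JA: "ideal (J <+>\<^bsub>R\<^esub> A) R" and JB: "ideal (J <+>\<^bsub>R\<^esub> B) R"
    using add_ideals[OF J A] add_ideals[OF J B] .
  have Jy: "ideal (adjoin J y) R" using ideal_adjoin[OF J y] .
  have "{r \<in> carrier R. y \<otimes> r \<in> J <+>\<^bsub>R\<^esub> B} = J <+>\<^bsub>R\<^esub> A"
  proof
    show "J <+>\<^bsub>R\<^esub> A \<subseteq> {r \<in> carrier R. y \<otimes> r \<in> J <+>\<^bsub>R\<^esub> B}"
    proof
      fix r assume "r \<in> J <+>\<^bsub>R\<^esub> A"
      then obtain j a where ja: "j \<in> J" "a \<in> A" "r = j \<oplus> a" by (auto simp: mem_set_add_iff)
      have c: "j \<in> carrier R" "a \<in> carrier R" using ja ideal.Icarr[OF A] by auto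
      have "y \<otimes> r = y \<otimes> j \<oplus> y \<otimes> a" using c y ja(3) by (simp add: r_distr)
      moreover have "y \<otimes> j \<in> J" using ja(1) y by (rule J.I_l_closed)
      ultimately show "r \<in> {r \<in> carrier R. y \<otimes> r \<in> J <+>\<^bsub>R\<^esub> B}"
        using mult[OF ja(2)] c ja(3) unfolding mem_set_add_iff by auto
    qed
  qed (use colon in auto)
  moreover have "adjoin (J <+>\<^bsub>R\<^esub> B) y = adjoin J y <+>\<^bsub>R\<^esub> B"
  proof
    have i1: "ideal (adjoin J y <+>\<^bsub>R\<^esub> B) R" using add_ideals[OF Jy B] .
    show "adjoin (J <+>\<^bsub>R\<^esub> B) y \<subseteq> adjoin J y <+>\<^bsub>R\<^esub> B"
      using upper[OF Jy B] adjoin_superset[OF J y] adjoin_self[OF J y]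
      by (intro adjoin_least[OF i1] least[OF i1]) blast+
    have i2: "ideal (adjoin (J <+>\<^bsub>R\<^esub> B) y) R" using ideal_adjoin[OF JB y] .
    show "adjoin J y <+>\<^bsub>R\<^esub> B \<subseteq> adjoin (J <+>\<^bsub>R\<^esub> B) y"
      using upper[OF J B] adjoin_superset[OF JB y] adjoin_self[OF JB y]
      by (intro adjoin_least[OF i2] least[OF i2]) blast+
  qed
  ultimately show ?thesis using rel_length_colon[OF JB y] by simp
qed

lemma filt_subset_ideal_pow:
  assumes I: "ideal I R" and I': "ideal I' R" and "int k \<le> a"
  shows "filt R I I' a b \<subseteq> I [^]\<^bsub>ideals_set R\<^esub> k"
proof -
  have "I [^]\<^bsub>ideals_set R\<^esub> l \<subseteq> I [^]\<^bsub>ideals_set R\<^esub> k" if "k \<le> l" for l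
    using that
  proof (induction rule: dec_induct)
    case (step l)
    then show ?case using ideal_prod_inter[OF ideal_nat_pow[OF I] I, of l] by auto
  qed simp
  moreover have "filt R I I' a b \<subseteq> ideal_pow R I a"
    unfolding filt_def using ideal_prod_inter[OF ideal_ideal_pow[OF I] ideal_ideal_pow[OF I']] by blast
  moreover have "ideal_pow R I a = I [^]\<^bsub>ideals_set R\<^esub> nat a"
    using assms(3) by (intro ideal_pow_nonneg) simp
  ultimately show ?thesis using assms(3) by (metis le_nat_iff of_nat_0_le_iff order_trans)
qed

end

lemma primary_to_ideal: "primary_to R p I \<Longrightarrow> ideal I R"
  by (simp add: primary_to_def primary_ideal_def)

lemma (in cring) primary_to_subset:
  assumes I: "primary_to R p I"
  shows "I \<subseteq> p"
proof
  fix c assume c: "c \<in> I"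
  then have cc: "c \<in> carrier R" using ideal.Icarr[OF primary_to_ideal[OF I]] by blast
  then have "c [^] (1::nat) \<in> I" using c by simp
  then have "c \<in> radical R I" using cc unfolding radical_def by blast
  then show "c \<in> p" using I by (simp add: primary_to_def)
qed

context noetherian_local
begin

text \<open>If \<open>c [^] p\<close> lies in \<open>I\<close>, then \<open>c [^] (p * l)\<close>
  lies in the power of \<open>I\<close> with exponent \<open>l\<close>.\<close>

lemma m_radical_filt:
  assumes I1: "primary_to R m I\<^sub>1" and I2: "primary_to R m I\<^sub>2"
  shows "m_radical (filt R I\<^sub>1 I\<^sub>2 a b)"
  unfolding m_radical_def
proof (intro conjI ballI)
  show "ideal (filt R I\<^sub>1 I\<^sub>2 a b) R" by (rule ideal_filt[OF primary_to_ideal[OF I1] primary_to_ideal[OF I2]])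
  fix c assume c: "c \<in> m"
  have cc: "c \<in> carrier R" using c by (rule m.Icarr)
  have pow: "\<exists>k::nat. c [^] k \<in> ideal_pow R I n" if I: "primary_to R m I" for I n
  proof -
    have "c \<in> radical R I" using I c by (simp add: primary_to_def)
    then obtain p :: nat where p: "c [^] p \<in> I" by (auto simp: radical_def)
    have "c [^] (p * l) \<in> I [^]\<^bsub>ideals_set R\<^esub> l" for l :: nat
    proof (induction l)
      case (Suc l)
      have "c [^] (p * Suc l) = c [^] (p * l) \<otimes> c [^] p"
        using nat_pow_mult[OF cc, of "p * l" p] by (simp add: add.commute)
      then show ?case using Suc p by (auto intro: ideal_prod.prod)
    qed (simp add: cc)
    then have "c [^] (p * nat n) \<in> ideal_pow R I n"
      unfolding ideal_pow_def using cc nat_pow_closed by presburger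
    then show ?thesis ..
  qed
  obtain k l :: nat where "c [^] k \<in> ideal_pow R I\<^sub>1 a" "c [^] l \<in> ideal_pow R I\<^sub>2 b"
    using pow[OF I1] pow[OF I2] by blast
  then have "c [^] (k + l) \<in> filt R I\<^sub>1 I\<^sub>2 a b"
    unfolding filt_def nat_pow_mult[OF cc, symmetric] by (rule ideal_prod.prod)
  then show "\<exists>k::nat. c [^] k \<in> filt R I\<^sub>1 I\<^sub>2 a b" ..
qed

end

section \<open>Hilbert functions modulo initial segments of the sequence\<close>

locale superficial_parameters = cohen_macaulay_local R m d for R (structure) and m d +
  fixes I\<^sub>1 I\<^sub>2 :: "'a set" and xs\<^sub>1 xs\<^sub>2 :: "'a list"
  assumes I1: "primary_to R m I\<^sub>1" and I2: "primary_to R m I\<^sub>2"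
    and superficial: "rees_superficial_sequence R I\<^sub>1 I\<^sub>2 xs\<^sub>1 xs\<^sub>2"
    and parameters: "system_of_parameters (xs\<^sub>1 @ xs\<^sub>2)"
begin

lemma ideal_I1: "ideal I\<^sub>1 R" and ideal_I2: "ideal I\<^sub>2 R"
  using I1 I2 by (simp_all add: primary_to_ideal)

abbreviation "ys \<equiv> xs\<^sub>1 @ xs\<^sub>2"

abbreviation \<F> where "\<F> \<equiv> filt R I\<^sub>1 I\<^sub>2"

definition X :: "nat \<Rightarrow> 'a set" where
  "X i = Idl (set (take i ys))"

text \<open>The Hilbert function of the images of both ideals in \<open>R / X i\<close>, expressed
  through ideals of \<open>R\<close> so that lengths over different quotient rings need not be
  compared.\<close>

definition H :: "nat \<Rightarrow> int \<Rightarrow> int \<Rightarrow> int" where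
  "H i a b = int (the_enat (ring_length (X i <+>\<^bsub>R\<^esub> \<F> a b) (carrier R)))"

lemma ys_m: "set ys \<subseteq> m" and length_ys: "length ys = d"
  using parameters by (simp_all add: system_of_parameters_def)

lemma take_closed: "set (take i ys) \<subseteq> carrier R"
  using ys_m m_subset set_take_subset[of i ys] by blast

lemma ideal_X: "ideal (X i) R"
  unfolding X_def using take_closed by (rule genideal_ideal)

lemma X_Suc: "i < d \<Longrightarrow> X (Suc i) = adjoin (X i) (ys ! i)"
proof -
  assume i: "i < d"
  then have "set (take (Suc i) ys) = insert (ys ! i) (set (take i ys))"
    using length_ys by (simp only: take_Suc_conv_app_nth) simp
  moreover have "ys ! i \<in> carrier R" using i length_ys ys_m m_subset nth_mem by blast
  ultimately show ?thesis unfolding X_def using genideal_insert[OF take_closed] by simp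
qed

lemma ideal_filt': "ideal (\<F> a b) R"
  by (rule ideal_filt[OF ideal_I1 ideal_I2])

lemma rel_length_X_finite:
  "ring_length (X i <+>\<^bsub>R\<^esub> \<F> a b) (carrier R) \<noteq> \<infinity>"
proof (rule finite_colength)
  show "m_radical (X i <+>\<^bsub>R\<^esub> \<F> a b)"
    using self.set_add_upper(2)[unfolded submodule_ring_module_iff, OF ideal_X ideal_filt']
    by (intro m_radical_superset[OF m_radical_filt[OF I1 I2] add_ideals[OF ideal_X ideal_filt']]) simp
qed

text \<open>Regularity of the parameters supplies the cancellation. The equation \<open>eq\<close>
  is superficiality at a single pair of exponents, with \<open>a'\<close> and \<open>b'\<close> left
  open so that the lemma serves both variables.\<close>

lemma superficial_step:
  assumes i: "i < d"
    and mult: "\<And>c. c \<in> \<F> a' b' \<Longrightarrow> ys ! i \<otimes> c \<in> \<F> a b"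
    and eq: "PIdl\<^bsub>R Quot X i\<^esub> (X i +> ys ! i) \<inter> filt (R Quot X i) ((\<lambda>r. X i +> r) ` I\<^sub>1) ((\<lambda>r. X i +> r) ` I\<^sub>2) a b =
      (X i +> ys ! i) <#\<^bsub>R Quot X i\<^esub> filt (R Quot X i) ((\<lambda>r. X i +> r) ` I\<^sub>1) ((\<lambda>r. X i +> r) ` I\<^sub>2) a' b'"
  shows "H (Suc i) a b = H i a b - H i a' b'"
proof -
  interpret J: ideal "X i" R by (rule ideal_X)
  interpret h: ring_hom_cring R "R Quot X i" "\<lambda>r. X i +> r"
    by (rule J.rcos_ring_hom_cring[OF cring_axioms])
  have yc: "ys ! i \<in> carrier R" using i length_ys ys_m m_subset nth_mem by blast
  note img = h.filt_image[OF carrier_FactRing[symmetric] ideal_I1 ideal_I2]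
  have filt_sub: "\<F> a b \<subseteq> carrier R" for a b using ideal.Icarr[OF ideal_filt'] by blast
  have nzd: "r \<in> X i" if "r \<in> carrier R" "ys ! i \<otimes> r \<in> X i" for r
    using parameters_regular[OF parameters i that(1)] that(2) by (simp add: X_def)
  have "r \<in> X i <+>\<^bsub>R\<^esub> \<F> a' b'"
    if "r \<in> carrier R" "ys ! i \<otimes> r \<in> X i <+>\<^bsub>R\<^esub> \<F> a b" for r
    using colon_if_superficial[OF ideal_X filt_sub filt_sub yc nzd _ that] eq unfolding img by blast
  then have "ring_length (X i <+>\<^bsub>R\<^esub> \<F> a b) (carrier R) =
    ring_length (X i <+>\<^bsub>R\<^esub> \<F> a' b') (carrier R) +
    ring_length (X (Suc i) <+>\<^bsub>R\<^esub> \<F> a b) (carrier R)"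
    unfolding X_Suc[OF i] by (intro rel_length_adjoin ideal_X ideal_filt' yc mult)
  then show ?thesis
    using rel_length_X_finite[of i a b] rel_length_X_finite[of i a' b'] rel_length_X_finite[of "Suc i" a b]
    by (auto simp: H_def)
qed

lemma H_Suc_fst:
  assumes i: "i < length xs\<^sub>1"
  shows "\<exists>N. \<forall>a\<ge>N. \<forall>b\<ge>0. H (Suc i) a b = H i a b - H i (a - 1) b"
proof -
  have id: "i < d" using i length_ys by simp
  have xi: "ys ! i \<in> I\<^sub>1"
    using superficial i by (auto simp: rees_superficial_sequence_def nth_append)
  have "superficial_fst (R Quot X i) ((\<lambda>r. X i +> r) ` I\<^sub>1) ((\<lambda>r. X i +> r) ` I\<^sub>2) (X i +> ys ! i)"
    using superficial i unfolding rees_superficial_sequence_def Let_def X_def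
    by (auto simp del: take_append nth_append dest!: spec[of _ i])
  then show ?thesis
    unfolding superficial_fst_def eventually_at_top_linorder
    using superficial_step[OF id filt_mult_fst[OF ideal_I1 ideal_I2 xi]] by blast
qed

lemma H_Suc_snd:
  assumes i: "length xs\<^sub>1 \<le> i" "i < d"
  shows "\<exists>N. \<forall>b\<ge>N. \<forall>a\<ge>0. H (Suc i) a b = H i a b - H i a (b - 1)"
proof -
  have xi: "ys ! i \<in> I\<^sub>2"
    using superficial i length_ys by (auto simp: rees_superficial_sequence_def nth_append)
  have "superficial_snd (R Quot X i) ((\<lambda>r. X i +> r) ` I\<^sub>1) ((\<lambda>r. X i +> r) ` I\<^sub>2) (X i +> ys ! i)"
    using superficial i length_ys unfolding rees_superficial_sequence_def Let_def X_def
    by (auto simp del: take_append nth_append dest!: spec[of _ i])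
  then show ?thesis
    unfolding superficial_snd_def eventually_at_top_linorder
    using superficial_step[OF i(2) filt_mult_snd[OF ideal_I1 ideal_I2 xi]] by blast
qed

lemma H_fst:
  assumes "i \<le> length xs\<^sub>1"
  shows "\<exists>N. \<forall>a\<ge>N. \<forall>b\<ge>N. H i a b = bdiff i (\<lambda>a. H 0 a b) a"
  using assms
proof (induction i)
  case (Suc i)
  then obtain N where N: "\<And>a b. a \<ge> N \<Longrightarrow> b \<ge> N \<Longrightarrow> H i a b = bdiff i (\<lambda>a. H 0 a b) a" by auto
  obtain N' where N': "\<And>a b. a \<ge> N' \<Longrightarrow> b \<ge> 0 \<Longrightarrow> H (Suc i) a b = H i a b - H i (a - 1) b"
    using H_Suc_fst[of i] Suc by auto
  \<comment> \<open>The bound moves up by one because the value at \<open>a - 1\<close> must also be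
    in the range of the induction hypothesis; it is kept non-negative because superficiality is only
    given for \<open>b \<ge> 0\<close>.\<close>
  have "H (Suc i) a b = bdiff (Suc i) (\<lambda>a. H 0 a b) a"
    if "a \<ge> max (N + 1) (max N' 0)" "b \<ge> max (N + 1) (max N' 0)" for a b
    using that N[of a b] N[of "a - 1" b] N'[of a b] by (simp add: bdiff_Suc)
  then show ?case by blast
qed simp

lemma H_snd:
  assumes "length xs\<^sub>1 + j \<le> d"
  shows "\<exists>N. \<forall>a\<ge>N. \<forall>b\<ge>N. H (length xs\<^sub>1 + j) a b = bdiff (length xs\<^sub>1) (\<lambda>a. bdiff j (H 0 a) b) a"
  using assms
proof (induction j)
  case 0
  then show ?case using H_fst[of "length xs\<^sub>1"] by simp
next
  case (Suc j)
  let ?k = "length xs\<^sub>1"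
  obtain N where N: "\<And>a b. a \<ge> N \<Longrightarrow> b \<ge> N \<Longrightarrow> H (?k + j) a b = bdiff ?k (\<lambda>a. bdiff j (H 0 a) b) a"
    using Suc by auto
  obtain N' where N': "\<And>a b. b \<ge> N' \<Longrightarrow> a \<ge> 0 \<Longrightarrow> H (?k + Suc j) a b = H (?k + j) a b - H (?k + j) a (b - 1)"
    using H_Suc_snd[of "?k + j"] Suc by auto
  have "H (?k + Suc j) a b = bdiff ?k (\<lambda>a. bdiff (Suc j) (H 0 a) b) a"
    if "a \<ge> max (N + 1) (max N' 0)" "b \<ge> max (N + 1) (max N' 0)" for a b
    using that N[of a b] N[of a "b - 1"] N'[of b a] by (simp add: bdiff_Suc[abs_def] bdiff_minus)
  then show ?case by blast
qed

lemma hilbert_fun_eq: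
  "hilbert_fun R I\<^sub>1 I\<^sub>2 a b =
    int (the_enat (ring_length (\<F> a b) (carrier R)))"
proof -
  interpret Q: module_quotient R "ring_module R" "\<F> a b"
    by (intro module_quotient.intro ring_module_module module_quotient_axioms.intro)
      (simp add: submodule_ring_module_iff ideal_filt')
  show ?thesis by (simp add: hilbert_fun_def len_def Q.module_length_quot)
qed

lemma H_0: "H 0 = hilbert_fun R I\<^sub>1 I\<^sub>2"
proof (intro ext)
  fix a b
  have sub: "\<F> a b \<subseteq> carrier R" using ideal.Icarr[OF ideal_filt'] by blast
  have "{\<zero>} <+>\<^bsub>R\<^esub> \<F> a b = \<F> a b"
    using sub by (force simp: set_add_def')
  then show "H 0 a b = hilbert_fun R I\<^sub>1 I\<^sub>2 a b"
    by (simp add: H_def X_def genideal_empty hilbert_fun_eq)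
qed

text \<open>The ideal of the whole sequence contains a power of the first ideal, so it absorbs
  \<open>\<F> a b\<close> as soon as \<open>a\<close> is large, and the last Hilbert function is
  constant there.\<close>

lemma diff2_hilbert_fun_eventually:
  "\<exists>N. \<forall>a\<ge>N. \<forall>b\<ge>N. diff2 (length xs\<^sub>1) (length xs\<^sub>2) (hilbert_fun R I\<^sub>1 I\<^sub>2) a b =
    int (the_enat (ring_length (Idl (set ys)) (carrier R)))"
proof -
  have d: "length xs\<^sub>1 + length xs\<^sub>2 = d" using length_ys by simp
  obtain N where N: "\<And>a b. a \<ge> N \<Longrightarrow> b \<ge> N \<Longrightarrow>
      H d a b = diff2 (length xs\<^sub>1) (length xs\<^sub>2) (hilbert_fun R I\<^sub>1 I\<^sub>2) a b"
    using H_snd[of "length xs\<^sub>2"] d by (auto simp: H_0 diff2_eq_bdiff)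
  have Xd: "X d = Idl (set ys)" using length_ys by (simp add: X_def)
  have "m_radical (X d)" using parameters Xd by (simp add: system_of_parameters_def)
  then obtain K :: nat where K: "I\<^sub>1 [^]\<^bsub>ideals_set R\<^esub> K \<subseteq> X d"
    using power_subset[OF _ ideal_I1 primary_to_subset[OF I1]] by blast
  have "H d a b = int (the_enat (ring_length (Idl (set ys)) (carrier R)))"
    if "a \<ge> int K" for a b
  proof -
    have "\<F> a b \<subseteq> X d"
      using filt_subset_ideal_pow[OF ideal_I1 ideal_I2 that] K by blast
    then have "X d <+>\<^bsub>R\<^esub> \<F> a b = X d"
      using self.set_add_least[unfolded submodule_ring_module_iff, OF ideal_X, of "X d" d "\<F> a b"]
        self.set_add_upper(1)[unfolded submodule_ring_module_iff, OF ideal_X ideal_filt', of d a b]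
      by simp
    then show ?thesis by (simp add: H_def Xd)
  qed
  then show ?thesis using N by (metis max.bounded_iff)
qed

end

lemma diff2_minus_of_int:
  "diff2 k l (\<lambda>a b. f a b - of_int (g a b)) a b = diff2 k l f a b - of_int (diff2 k l g a b)"
  unfolding diff2_eq_bdiff by (simp add: bdiff_minus bdiff_of_int)

text \<open>\<open>len\<close> is only meaningful for modules of finite length, which is what
  \<open>finite_length\<close> ensures for the quotient. The sum over \<open>i \<ge> 2\<close> stops
  at \<open>d\<close> because the complex is zero in higher degrees.\<close>

theorem corollary3p3:
  fixes R :: "('a, 'b) ring_scheme"
    and m I\<^sub>1 I\<^sub>2 :: "'a set"
    and xs\<^sub>1 xs\<^sub>2 :: "'a list"
    and d k :: nat
    and P :: "rat poly poly"
    and n\<^sub>1 n\<^sub>2 :: int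
  assumes cm: "cohen_macaulay_local_ring R m"
    and dim: "krull_dim R = enat d"
    and residue_field: "infinite (carrier (R Quot m))"
    and I1: "primary_to R m I\<^sub>1"
    and I2: "primary_to R m I\<^sub>2"
    and k: "k \<le> d"
    and len1: "length xs\<^sub>1 = k"
    and len2: "length xs\<^sub>2 = d - k"
    and superficial: "rees_superficial_sequence R I\<^sub>1 I\<^sub>2 xs\<^sub>1 xs\<^sub>2"
    and hilbert_poly: "is_hilbert_poly R I\<^sub>1 I\<^sub>2 d P"
    and finite_length: "module_length R (reduction_quot R I\<^sub>1 I\<^sub>2 xs\<^sub>1 xs\<^sub>2 n\<^sub>1 n\<^sub>2) \<noteq> \<infinity>"
  shows "diff2 k (d - k) (\<lambda>a b. poly2 P a b - of_int (hilbert_fun R I\<^sub>1 I\<^sub>2 a b)) n\<^sub>1 n\<^sub>2 =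
    of_nat (len R (reduction_quot R I\<^sub>1 I\<^sub>2 xs\<^sub>1 xs\<^sub>2 n\<^sub>1 n\<^sub>2)) -
    (\<Sum>i=2..d. (- 1) ^ i * of_nat (h_len R I\<^sub>1 I\<^sub>2 xs\<^sub>1 xs\<^sub>2 n\<^sub>1 n\<^sub>2 i))"
proof -
  have local: "local_ring R m" and depth: "depth R m = enat d"
    using cm dim by (simp_all add: cohen_macaulay_local_ring_def)
  then interpret cohen_macaulay_local R m d
    by (intro cohen_macaulay_local.intro noetherian_local.intro noetherian_local_axioms.intro
        cohen_macaulay_local_axioms.intro) (auto simp: local_ring_def)
  have d: "length xs\<^sub>1 + length xs\<^sub>2 = d" using len1 len2 k by simp
  have xs: "set xs\<^sub>1 \<subseteq> I\<^sub>1" "set xs\<^sub>2 \<subseteq> I\<^sub>2"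
    using superficial by (simp_all add: rees_superficial_sequence_def)
  interpret C: bigraded_koszul R I\<^sub>1 I\<^sub>2 xs\<^sub>1 xs\<^sub>2 n\<^sub>1 n\<^sub>2
    by (intro bigraded_koszul.intro cring_axioms bigraded_koszul_axioms.intro
        primary_to_ideal[OF I1] primary_to_ideal[OF I2] xs)
  let ?ys = "xs\<^sub>1 @ xs\<^sub>2" and ?H = "hilbert_fun R I\<^sub>1 I\<^sub>2"
  let ?h = "h_len R I\<^sub>1 I\<^sub>2 xs\<^sub>1 xs\<^sub>2 n\<^sub>1 n\<^sub>2" and ?r = "len R (reduction_quot R I\<^sub>1 I\<^sub>2 xs\<^sub>1 xs\<^sub>2 n\<^sub>1 n\<^sub>2)"
  define c where "c = the_enat (rel_length R (ring_module R) (Idl\<^bsub>R\<^esub> (set ?ys)) (carrier R))"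
  have iX: "ideal (Idl\<^bsub>R\<^esub> (set ?ys)) R" by (rule genideal_ideal[OF C.ys_closed])
  have "m_radical C.G"
    using m_radical_if_finite_length[OF C.ideal_G _ C.G_subset_J] finite_length m_radical_filt[OF I1 I2]
    by (simp add: C.module_length_reduction_quot C.J_empty)
  then have radX: "m_radical (Idl\<^bsub>R\<^esub> (set ?ys))"
    using m_radical_superset iX C.G_subset_Idl by blast
  have sop: "system_of_parameters ?ys"
    using radX xs primary_to_subset[OF I1] primary_to_subset[OF I2] d
    by (auto simp: system_of_parameters_def)
  interpret S: superficial_parameters R m d I\<^sub>1 I\<^sub>2 xs\<^sub>1 xs\<^sub>2
    by (intro superficial_parameters.intro cohen_macaulay_local_axioms
        superficial_parameters_axioms.intro I1 I2 superficial sop)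
  have J_len: "rel_length R (ring_module R) (C.J T) (carrier R) \<noteq> \<infinity>" for T
    unfolding comp_ideal_def using finite_colength[OF m_radical_filt[OF I1 I2]] by blast
  note euler = C.euler_characteristic[OF J_len, unfolded d]
  have "diff2 k (d - k) ?H n\<^sub>1 n\<^sub>2 = (\<Sum>i=0..d. (- 1) ^ i *
      int (\<Sum>T\<in>subsets_of_card d i. the_enat (rel_length R (ring_module R) (C.J T) (carrier R))))"
  proof -
    let ?g = "\<lambda>p q. ?H (n\<^sub>1 - int p) (n\<^sub>2 - int q)"
    have kd: "k + (d - k) = d" using k by simp
    have "(\<Sum>j=0..i. of_nat (k choose (i - j)) * of_nat ((d - k) choose j) * ?g (i - j) j) =
        int (\<Sum>T\<in>subsets_of_card d i. the_enat (rel_length R (ring_module R) (C.J T) (carrier R)))" for i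
      unfolding sum_subsets_of_card[where k = k and l = "d - k" and i = i and g = ?g, symmetric] kd
      by (simp add: comp_ideal_def S.hilbert_fun_eq len1)
    then show ?thesis unfolding diff2_def kd by (simp only:)
  qed
  also have "\<dots> = (\<Sum>i=0..d. (- 1) ^ i * int (?h i))"
    using euler(1) euler(3)[of "Suc d"] subsets_of_card_empty[of d "Suc d"] by simp
  \<comment> \<open>The range is extended to \<open>Suc d\<close> so that degrees zero and one can
    be split off even when \<open>d = 0\<close>.\<close>
  also have "\<dots> = (\<Sum>i=0..Suc d. (- 1) ^ i * int (?h i))"
    using euler(3)[of "Suc d"] by simp
  also have "\<dots> = int (?h 0) - int (?h 1) + (\<Sum>i=2..Suc d. (- 1) ^ i * int (?h i))"
    by (simp add: sum.atLeast_Suc_atMost numeral_2_eq_2)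
  also have "(\<Sum>i=2..Suc d. (- 1) ^ i * int (?h i)) = (\<Sum>i=2..d. (- 1) ^ i * int (?h i))"
    using euler(3)[of "Suc d"] by (cases "d = 0") simp_all
  finally have H: "diff2 k (d - k) ?H n\<^sub>1 n\<^sub>2 =
      int (?h 0) - int (?h 1) + (\<Sum>i=2..d. (- 1) ^ i * int (?h i))" .
  have red: "?r + ?h 0 = ?h 1 + c"
  proof -
    have fin: "module_length R (C_homology R I\<^sub>1 I\<^sub>2 xs\<^sub>1 xs\<^sub>2 n\<^sub>1 n\<^sub>2 i) = enat (?h i)" for i
      using euler(2)[of i] by (auto simp: h_len_def len_def)
    have "module_length R (reduction_quot R I\<^sub>1 I\<^sub>2 xs\<^sub>1 xs\<^sub>2 n\<^sub>1 n\<^sub>2) = enat ?r"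
      using finite_length by (auto simp: len_def)
    moreover have "rel_length R (ring_module R) (Idl\<^bsub>R\<^esub> (set ?ys)) (carrier R) = enat c"
      using finite_colength[OF radX] by (auto simp: c_def)
    ultimately show ?thesis
      using C.reduction_homology_length[OF koszul_exact[OF sop]] by (simp add: fin)
  qed
  have P: "diff2 k (d - k) (poly2 P) n\<^sub>1 n\<^sub>2 = of_nat c"
  proof -
    obtain N where N: "\<And>a b. a \<ge> N \<Longrightarrow> b \<ge> N \<Longrightarrow> poly2 P a b = of_int (?H a b)"
      using hilbert_poly by (auto simp: is_hilbert_poly_def)
    obtain N' where N': "\<And>a b. a \<ge> N' \<Longrightarrow> b \<ge> N' \<Longrightarrow> diff2 k (d - k) ?H a b = int c"
      using S.diff2_hilbert_fun_eventually by (auto simp: len1 len2 c_def)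
    \<comment> \<open>The shift by \<open>d\<close> keeps all points \<open>M - p\<close> and
      \<open>M - q\<close> at which the differences evaluate at or above \<open>N\<close>.\<close>
    define M where "M = max N N' + int d"
    have "diff2 k (d - k) (poly2 P) n\<^sub>1 n\<^sub>2 = diff2 k (d - k) (poly2 P) M M"
      using hilbert_poly k by (intro diff2_poly2_constant) (simp add: is_hilbert_poly_def)
    also have "\<dots> = bdiff k (\<lambda>a. bdiff (d - k) (\<lambda>b. of_int (?H a b)) M) M"
      unfolding diff2_eq_bdiff using k by (intro bdiff_cong N) (auto simp: M_def)
    also have "\<dots> = of_int (diff2 k (d - k) ?H M M)"
      by (simp only: diff2_eq_bdiff bdiff_of_int)
    also have "diff2 k (d - k) ?H M M = int c" by (rule N') (auto simp: M_def)
    finally show ?thesis by simp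
  qed
  have "diff2 k (d - k) (\<lambda>a b. poly2 P a b - of_int (?H a b)) n\<^sub>1 n\<^sub>2 =
      (of_int (int c - (int (?h 0) - int (?h 1) + (\<Sum>i=2..d. (- 1) ^ i * int (?h i)))) :: rat)"
    unfolding diff2_minus_of_int P H by simp
  also have "int c - (int (?h 0) - int (?h 1) + (\<Sum>i=2..d. (- 1) ^ i * int (?h i))) =
      int ?r - (\<Sum>i=2..d. (- 1) ^ i * int (?h i))"
    using red by linarith
  finally show ?thesis by simp
qed

end
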